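(* Let $G$ be a finitely generated group with a finitely generated subgroup $H$ such that $e(G,H)\geq 2$. If there is a non-trivial $H$-almost invariant subset $X$ of $G$ such that $i(H\backslash X,H\backslash X)=0$, then $G$ has a splitting over some subgroup $H'$ commensurable with $H$. Further, one of the $H'$-almost invariant sets $Y$ determined by the splitting is equivalent to $X$.
   Context: Almost invariant sets. Two sets are almost equal if their symmetric difference is finite. $G$ acts on the right on the set $H\backslash G$ of cosets $Hg$; $P\subset H\backslash G$ is almost invariant if $Pg$ is almost equal to $P$ for all $g\in G$. For $X\subset G$ write $X^*=G-X$. $X$ is $H$-almost invariant if $hX=X$ for all $h\in H$ and the image $H\backslash X$ of $X$ in $H\backslash G$ is almost invariant; it is non-trivial if $H\backslash X$ and $H\backslash X^*$ are both infinite. A subset of $G$ is $H$-finite if it lies in a finite union of cosets $Hg$; two subsets of $G$ are $H$-almost equal if their symmetric difference is $H$-finite. An $H$-almost invariant set $X$ and an $H'$-almost invariant set $Y$ are equivalent if they are $H$-almost equal. Two subgroups are commensurable if their intersection has finite index in both. $e(G,H)$ is the number of ends of the quotient graph $H\backslash\Gamma$, where $\Gamma$ is the Cayley graph of $G$ (with left $G$-action) for a finite generating set. Intersection number. $gX$ crosses $X$ if each of the four sets $gX\cap X$, $gX^*\cap X$, $gX\cap X^*$, $gX^*\cap X^*$ projects to an infinite subset of $H\backslash G$. $i(H\backslash X,H\backslash X)$ is the number of double cosets $HgH$ such that $gX$ crosses $X$. Splittings. A splitting of a group $G$ is either (a) proper subgroups $A,B$ of $G$ and a subgroup $H\subset A\cap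 B$ such that the natural map $A*_HB\to G$ is an isomorphism, or (b) a subgroup $A$ of $G$ and subgroups $H_0,H_1$ of $A$ such that some $t\in G$ conjugates $H_0$ to $H_1$ and the natural map $A*_H\to G$ from the resulting HNN extension (with stable letter mapped to $t$) is an isomorphism; here $H=H_0$. It is called a splitting of $G$ over $H$. Almost invariant sets determined by a splitting over $H$. If $G=A*_HB$, choose transversals $T_A,T_B$ (containing the identity) for the cosets $gH$ of $H$ in $A$ and in $B$; each $g\in G$ is uniquely $a_1b_1a_2\cdots a_nb_nh$ with $h\in H$, $a_i\in T_A$, $b_i\in T_B$, where only $h,a_1,b_n$ may be trivial; let $Z$ be the set of elements with $a_1$ non-trivial. If $G=A*_H$, let $\alpha_1,\alpha_2:H\to A$ be the two inclusions with $t^{-1}\alpha_1(h)t=\alpha_2(h)$ ($H$ being identified with $\alpha_1(H)$), and choose transversals $T_i$ (containing the identity) for the cosets $g\alpha_i(H)$ in $A$; each $g\in G$ is uniquely $a_1t^{\epsilon_1}a_2\cdots a_nt^{\epsilon_n}a_{n+1}$ with $a_{n+1}\in A$, $\epsilon_i=\pm1$, $a_i\in T_1$ if $\epsilon_i=1$, $a_i\in T_2$ if $\epsilon_i=-1$, and $a_i\neq1$ if $\epsilon_{i-1}\neq\epsilon_i$; let $Z$ be the set of elements with $a_1$ trivial and $\epsilon_1=1$. The $H$-almost invariant sets determined by the splitting are $Z$, $Z\cup H$, $Z^*$, $Z^*-H$. *)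

theory Defs
  imports "HOL-Algebra.Coset" "HOL-Algebra.Generated_Groups" "HOL-Library.Extended_Nat"
begin

section \<open>Cardinalities, generation, commensurability\<close>

definition ecard :: "'a set \<Rightarrow> enat" where
  "ecard A = (if finite A then enat (card A) else \<infinity>)"

definition finite_generating_set :: "('a, 'm) monoid_scheme \<Rightarrow> 'a set \<Rightarrow> 'a set \<Rightarrow> bool" where
  "finite_generating_set G S H \<longleftrightarrow> finite S \<and> S \<subseteq> carrier G \<and> generate G S = H"

definition finite_index :: "('a, 'm) monoid_scheme \<Rightarrow> 'a set \<Rightarrow> 'a set \<Rightarrow> bool" where
  "finite_index G K H \<longleftrightarrow> K \<subseteq> H \<and> finite (rcosets\<^bsub>G\<lparr>carrier := H\<rparr>\<^esub> K)"

definition commensurable :: "('a, 'm) monoid_scheme \<Rightarrow> 'a set \<Rightarrow> 'a set \<Rightarrow> bool" where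
  "commensurable G H K \<longleftrightarrow> finite_index G (H \<inter> K) H \<and> finite_index G (H \<inter> K) K"


section \<open>Ends of the quotient graph of a Cayley graph\<close>

text \<open>A graph is given by its vertices and oriented edges; orientations are ignored when
  connected components are formed. The number of ends of a (connected, locally finite) graph is the
  supremum, over the finite sets of vertices removed, of the number of infinite components left.\<close>

definition graph_components :: "'v set \<Rightarrow> ('v \<times> 'v) set \<Rightarrow> 'v set set" where
  "graph_components V E =
     V // {(x, y). x \<in> V \<and> y \<in> V \<and> (x, y) \<in> ((E \<union> E\<inverse>) \<inter> V \<times> V)\<^sup>*}"

definition number_of_ends :: "'v set \<Rightarrow> ('v \<times> 'v) set \<Rightarrow> enat" where
  "number_of_ends V E =
     (SUP K \<in> {K. finite K \<and> K \<subseteq> V}. ecard {C \<in> graph_components (V - K) E. infinite C})"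

definition cayley_edges :: "('a, 'm) monoid_scheme \<Rightarrow> 'a set \<Rightarrow> ('a \<times> 'a) set" where
  "cayley_edges G S = {(g, g \<otimes>\<^bsub>G\<^esub> s) | g s. g \<in> carrier G \<and> s \<in> S}"

text \<open>The number \<open>e(G,H)\<close>, computed with the generating set \<open>S\<close>. The left action of \<open>G\<close> on its
  Cayley graph identifies the vertices of the quotient by \<open>H\<close> with the cosets \<open>Hg\<close>.\<close>

definition ends_of_pair :: "('a, 'm) monoid_scheme \<Rightarrow> 'a set \<Rightarrow> 'a set \<Rightarrow> enat" where
  "ends_of_pair G S H =
     number_of_ends (rcosets\<^bsub>G\<^esub> H)
       ((\<lambda>(g, g'). (H #>\<^bsub>G\<^esub> g, H #>\<^bsub>G\<^esub> g')) ` cayley_edges G S)"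


section \<open>Almost invariant sets\<close>

definition almost_equal :: "'b set \<Rightarrow> 'b set \<Rightarrow> bool" where
  "almost_equal P Q \<longleftrightarrow> finite (sym_diff P Q)"

text \<open>The image \<open>H\X\<close> of \<open>X\<close> in the set of cosets \<open>Hg\<close>.\<close>

definition coset_image :: "('a, 'm) monoid_scheme \<Rightarrow> 'a set \<Rightarrow> 'a set \<Rightarrow> 'a set set" where
  "coset_image G H X = (\<lambda>x. H #>\<^bsub>G\<^esub> x) ` X"

definition almost_invariant :: "('a, 'm) monoid_scheme \<Rightarrow> 'a set set \<Rightarrow> bool" where
  "almost_invariant G P \<longleftrightarrow>
     (\<forall>g \<in> carrier G. almost_equal ((\<lambda>C. C #>\<^bsub>G\<^esub> g) ` P) P)"

definition H_almost_invariant :: "('a, 'm) monoid_scheme \<Rightarrow> 'a set \<Rightarrow> 'a set \<Rightarrow> bool" where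
  "H_almost_invariant G H X \<longleftrightarrow>
     X \<subseteq> carrier G \<and> (\<forall>h \<in> H. h <#\<^bsub>G\<^esub> X = X) \<and> almost_invariant G (coset_image G H X)"

definition H_nontrivial :: "('a, 'm) monoid_scheme \<Rightarrow> 'a set \<Rightarrow> 'a set \<Rightarrow> bool" where
  "H_nontrivial G H X \<longleftrightarrow>
     infinite (coset_image G H X) \<and> infinite (coset_image G H (carrier G - X))"

definition H_finite :: "('a, 'm) monoid_scheme \<Rightarrow> 'a set \<Rightarrow> 'a set \<Rightarrow> bool" where
  "H_finite G H X \<longleftrightarrow> (\<exists>F. finite F \<and> F \<subseteq> carrier G \<and> X \<subseteq> (\<Union>f\<in>F. H #>\<^bsub>G\<^esub> f))"

definition H_almost_equal :: "('a, 'm) monoid_scheme \<Rightarrow> 'a set \<Rightarrow> 'a set \<Rightarrow> 'a set \<Rightarrow> bool" where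
  "H_almost_equal G H X Y \<longleftrightarrow> H_finite G H (sym_diff X Y)"

definition ai_equivalent ::
  "('a, 'm) monoid_scheme \<Rightarrow> 'a set \<Rightarrow> 'a set \<Rightarrow> 'a set \<Rightarrow> 'a set \<Rightarrow> bool" where
  "ai_equivalent G H X H' Y \<longleftrightarrow>
     H_almost_invariant G H X \<and> H_almost_invariant G H' Y \<and> H_almost_equal G H X Y"


section \<open>Self-intersection number\<close>

definition translate_crosses :: "('a, 'm) monoid_scheme \<Rightarrow> 'a set \<Rightarrow> 'a set \<Rightarrow> 'a \<Rightarrow> bool" where
  "translate_crosses G H X g \<longleftrightarrow>
     infinite (coset_image G H ((g <#\<^bsub>G\<^esub> X) \<inter> X)) \<and>
     infinite (coset_image G H ((g <#\<^bsub>G\<^esub> (carrier G - X)) \<inter> X)) \<and>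
     infinite (coset_image G H ((g <#\<^bsub>G\<^esub> X) \<inter> (carrier G - X))) \<and>
     infinite (coset_image G H ((g <#\<^bsub>G\<^esub> (carrier G - X)) \<inter> (carrier G - X)))"

text \<open>\<open>i(H\X, H\X)\<close>: the number of double cosets \<open>HgH\<close> with \<open>gX\<close> crossing \<open>X\<close>.\<close>

definition self_intersection_number ::
  "('a, 'm) monoid_scheme \<Rightarrow> 'a set \<Rightarrow> 'a set \<Rightarrow> enat" where
  "self_intersection_number G H X =
     ecard {(H #>\<^bsub>G\<^esub> g) <#>\<^bsub>G\<^esub> H | g. g \<in> carrier G \<and> translate_crosses G H X g}"


section \<open>Monoid presentations\<close>

text \<open>Words over the alphabet \<open>L\<close> modulo the congruence generated by the relations \<open>R\<close>.\<close>

inductive word_congruent :: "'l set \<Rightarrow> ('l list \<times> 'l list) set \<Rightarrow> 'l list \<Rightarrow> 'l list \<Rightarrow> bool"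
  for L :: "'l set" and R :: "('l list \<times> 'l list) set" where
  rel: "(u, v) \<in> R \<Longrightarrow> u \<in> lists L \<Longrightarrow> v \<in> lists L \<Longrightarrow> p \<in> lists L \<Longrightarrow> q \<in> lists L \<Longrightarrow>
          word_congruent L R (p @ u @ q) (p @ v @ q)"
| refl: "u \<in> lists L \<Longrightarrow> word_congruent L R u u"
| sym: "word_congruent L R u v \<Longrightarrow> word_congruent L R v u"
| trans: "word_congruent L R u v \<Longrightarrow> word_congruent L R v w \<Longrightarrow> word_congruent L R u w"

definition word_class :: "'l set \<Rightarrow> ('l list \<times> 'l list) set \<Rightarrow> 'l list \<Rightarrow> 'l list set" where
  "word_class L R u = {v. word_congruent L R u v}"

definition presented_monoid :: "'l set \<Rightarrow> ('l list \<times> 'l list) set \<Rightarrow> 'l list set monoid" where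
  "presented_monoid L R =
     \<lparr>carrier = word_class L R ` lists L,
      monoid.mult = (\<lambda>P Q. \<Union>p\<in>P. \<Union>q\<in>Q. word_class L R (p @ q)),
      one = word_class L R []\<rparr>"

definition word_value :: "('a, 'm) monoid_scheme \<Rightarrow> ('l \<Rightarrow> 'a) \<Rightarrow> 'l list \<Rightarrow> 'a" where
  "word_value G f w = foldr (\<lambda>l x. f l \<otimes>\<^bsub>G\<^esub> x) w \<one>\<^bsub>G\<^esub>"

text \<open>The map on congruence classes induced by \<open>f\<close>; the value on a class is determined
  whenever \<open>f\<close> respects the relations.\<close>

definition induced_map :: "('a, 'm) monoid_scheme \<Rightarrow> ('l \<Rightarrow> 'a) \<Rightarrow> 'l list set \<Rightarrow> 'a" where
  "induced_map G f P = the_elem (word_value G f ` P)"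


section \<open>Amalgamated free products and HNN extensions\<close>

text \<open>The amalgamated free product of two groups along a common subgroup \<open>H\<close>. The multiplication
  tables of the factors are among the relations, so the presented monoid is a group.\<close>

definition amalgam_relations ::
  "('a, 'm) monoid_scheme \<Rightarrow> ('a, 'n) monoid_scheme \<Rightarrow> 'a set \<Rightarrow> (('a + 'a) list \<times> ('a + 'a) list) set"
where
  "amalgam_relations A B H =
     {([Inl x, Inl y], [Inl (x \<otimes>\<^bsub>A\<^esub> y)]) | x y. x \<in> carrier A \<and> y \<in> carrier A} \<union>
     {([Inr x, Inr y], [Inr (x \<otimes>\<^bsub>B\<^esub> y)]) | x y. x \<in> carrier B \<and> y \<in> carrier B} \<union>
     {([Inl \<one>\<^bsub>A\<^esub>], []), ([Inr \<one>\<^bsub>B\<^esub>], [])} \<union>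
     {([Inl h], [Inr h]) | h. h \<in> H}"

definition amalgam ::
  "('a, 'm) monoid_scheme \<Rightarrow> ('a, 'n) monoid_scheme \<Rightarrow> 'a set \<Rightarrow> ('a + 'a) list set monoid" where
  "amalgam A B H = presented_monoid (carrier A <+> carrier B) (amalgam_relations A B H)"

text \<open>The HNN extension of \<open>A\<close> with respect to \<open>\<phi>\<close>, defined on the subgroup \<open>H\<close> of \<open>A\<close>: the stable
  letter \<open>t\<close> satisfies \<open>t\<^sup>-\<^sup>1 h t = \<phi> h\<close>.\<close>

datatype 'a hnn_letter = Base 'a | Stable | Stable_inv

definition hnn_relations ::
  "('a, 'm) monoid_scheme \<Rightarrow> 'a set \<Rightarrow> ('a \<Rightarrow> 'a) \<Rightarrow> ('a hnn_letter list \<times> 'a hnn_letter list) set"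
where
  "hnn_relations A H \<phi> =
     {([Base x, Base y], [Base (x \<otimes>\<^bsub>A\<^esub> y)]) | x y. x \<in> carrier A \<and> y \<in> carrier A} \<union>
     {([Base \<one>\<^bsub>A\<^esub>], []), ([Stable, Stable_inv], []), ([Stable_inv, Stable], [])} \<union>
     {([Stable_inv, Base h, Stable], [Base (\<phi> h)]) | h. h \<in> H}"

definition hnn_extension ::
  "('a, 'm) monoid_scheme \<Rightarrow> 'a set \<Rightarrow> ('a \<Rightarrow> 'a) \<Rightarrow> 'a hnn_letter list set monoid" where
  "hnn_extension A H \<phi> =
     presented_monoid (Base ` carrier A \<union> {Stable, Stable_inv}) (hnn_relations A H \<phi>)"


section \<open>Splittings\<close>

text \<open>\<open>Amalgam A B H\<close> stands for \<open>G = A *\<^sub>H B\<close>, and \<open>HNN A H0 H1 t\<close> for \<open>G = A *\<^sub>H\<close> with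
  \<open>H = H0\<close> and \<open>t\<^sup>-\<^sup>1 H0 t = H1\<close>.\<close>

datatype 'a splitting = Amalgam "'a set" "'a set" "'a set" | HNN "'a set" "'a set" "'a set" 'a

fun splitting_over :: "('a, 'm) monoid_scheme \<Rightarrow> 'a set \<Rightarrow> 'a splitting \<Rightarrow> bool" where
  "splitting_over G H' (Amalgam A B H) \<longleftrightarrow>
     H' = H \<and>
     subgroup A G \<and> A \<noteq> carrier G \<and> subgroup B G \<and> B \<noteq> carrier G \<and>
     subgroup H G \<and> H \<subseteq> A \<inter> B \<and>
     induced_map G (case_sum (\<lambda>a. a) (\<lambda>b. b))
       \<in> iso (amalgam (G\<lparr>carrier := A\<rparr>) (G\<lparr>carrier := B\<rparr>) H) G"
| "splitting_over G H' (HNN A H0 H1 t) \<longleftrightarrow>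
     H' = H0 \<and>
     subgroup A G \<and> subgroup H0 G \<and> H0 \<subseteq> A \<and> subgroup H1 G \<and> H1 \<subseteq> A \<and>
     t \<in> carrier G \<and> (\<lambda>h. inv\<^bsub>G\<^esub> t \<otimes>\<^bsub>G\<^esub> h \<otimes>\<^bsub>G\<^esub> t) ` H0 = H1 \<and>
     induced_map G (case_hnn_letter (\<lambda>a. a) t (inv\<^bsub>G\<^esub> t))
       \<in> iso (hnn_extension (G\<lparr>carrier := A\<rparr>) H0 (\<lambda>h. inv\<^bsub>G\<^esub> t \<otimes>\<^bsub>G\<^esub> h \<otimes>\<^bsub>G\<^esub> t)) G"


section \<open>Almost invariant sets determined by a splitting\<close>

definition left_transversal :: "('a, 'm) monoid_scheme \<Rightarrow> 'a set \<Rightarrow> 'a set \<Rightarrow> 'a set \<Rightarrow> bool" where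
  "left_transversal G A H T \<longleftrightarrow>
     T \<subseteq> A \<and> \<one>\<^bsub>G\<^esub> \<in> T \<and> (\<forall>a \<in> A. \<exists>!x. x \<in> T \<and> x \<in> a <#\<^bsub>G\<^esub> H)"

text \<open>\<open>g = a\<^sub>1 b\<^sub>1 a\<^sub>2 \<dots> a\<^sub>n b\<^sub>n h\<close> with \<open>n \<ge> 1\<close>, where only \<open>a\<^sub>1\<close>, \<open>b\<^sub>n\<close> and \<open>h\<close> may be trivial; the list
  is \<open>[(a\<^sub>1, b\<^sub>1), \<dots>, (a\<^sub>n, b\<^sub>n)]\<close>.\<close>

definition amalgam_normal_form ::
  "('a, 'm) monoid_scheme \<Rightarrow> 'a set \<Rightarrow> 'a set \<Rightarrow> 'a set \<Rightarrow> 'a \<Rightarrow> ('a \<times> 'a) list \<Rightarrow> 'a \<Rightarrow> bool" where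
  "amalgam_normal_form G H TA TB g ps h \<longleftrightarrow>
     ps \<noteq> [] \<and> set ps \<subseteq> TA \<times> TB \<and> h \<in> H \<and>
     (\<forall>i < length ps. 0 < i \<longrightarrow> fst (ps ! i) \<noteq> \<one>\<^bsub>G\<^esub>) \<and>
     (\<forall>i. Suc i < length ps \<longrightarrow> snd (ps ! i) \<noteq> \<one>\<^bsub>G\<^esub>) \<and>
     g = foldr (\<lambda>(a, b) x. a \<otimes>\<^bsub>G\<^esub> (b \<otimes>\<^bsub>G\<^esub> x)) ps h"

definition amalgam_Z ::
  "('a, 'm) monoid_scheme \<Rightarrow> 'a set \<Rightarrow> 'a set \<Rightarrow> 'a set \<Rightarrow> 'a set" where
  "amalgam_Z G H TA TB =
     {g \<in> carrier G. \<exists>ps h. amalgam_normal_form G H TA TB g ps h \<and> fst (hd ps) \<noteq> \<one>\<^bsub>G\<^esub>}"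

text \<open>\<open>g = a\<^sub>1 t\<^bsup>\<epsilon>\<^sub>1\<^esup> a\<^sub>2 \<dots> a\<^sub>n t\<^bsup>\<epsilon>\<^sub>n\<^esup> a\<^sub>n\<^sub>+\<^sub>1\<close> with \<open>n \<ge> 0\<close>; the list is
  \<open>[(a\<^sub>1, \<epsilon>\<^sub>1), \<dots>, (a\<^sub>n, \<epsilon>\<^sub>n)]\<close> and \<open>c\<close> is \<open>a\<^sub>n\<^sub>+\<^sub>1\<close>.\<close>

definition hnn_normal_form ::
  "('a, 'm) monoid_scheme \<Rightarrow> 'a set \<Rightarrow> 'a \<Rightarrow> 'a set \<Rightarrow> 'a set \<Rightarrow> 'a \<Rightarrow> ('a \<times> int) list \<Rightarrow> 'a \<Rightarrow> bool"
where
  "hnn_normal_form G A t T1 T2 g es c \<longleftrightarrow>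
     set es \<subseteq> T1 \<times> {1} \<union> T2 \<times> {-1} \<and> c \<in> A \<and>
     (\<forall>i. Suc i < length es \<longrightarrow> snd (es ! i) \<noteq> snd (es ! Suc i) \<longrightarrow>
            fst (es ! Suc i) \<noteq> \<one>\<^bsub>G\<^esub>) \<and>
     g = foldr (\<lambda>(a, e) x. a \<otimes>\<^bsub>G\<^esub> ((t [^]\<^bsub>G\<^esub> e) \<otimes>\<^bsub>G\<^esub> x)) es c"

definition hnn_Z ::
  "('a, 'm) monoid_scheme \<Rightarrow> 'a set \<Rightarrow> 'a \<Rightarrow> 'a set \<Rightarrow> 'a set \<Rightarrow> 'a set" where
  "hnn_Z G A t T1 T2 =
     {g \<in> carrier G. \<exists>es c. hnn_normal_form G A t T1 T2 g es c \<and>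
        es \<noteq> [] \<and> fst (hd es) = \<one>\<^bsub>G\<^esub> \<and> snd (hd es) = 1}"

fun determined_set :: "('a, 'm) monoid_scheme \<Rightarrow> 'a splitting \<Rightarrow> 'a set \<Rightarrow> bool" where
  "determined_set G (Amalgam A B H) Y \<longleftrightarrow>
     (\<exists>TA TB. left_transversal G A H TA \<and> left_transversal G B H TB \<and>
        (let Z = amalgam_Z G H TA TB
         in Y \<in> {Z, Z \<union> H, carrier G - Z, (carrier G - Z) - H}))"
| "determined_set G (HNN A H0 H1 t) Y \<longleftrightarrow>
     (\<exists>T1 T2. left_transversal G A H0 T1 \<and> left_transversal G A H1 T2 \<and>
        (let Z = hnn_Z G A t T1 T2
         in Y \<in> {Z, Z \<union> H0, carrier G - Z, (carrier G - Z) - H0}))"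

end

theory Submission
  imports Defs
begin

text \<open>For \<open>U\<close> and \<open>V\<close> among the translates of \<open>X\<close> and of its complement, let \<open>U \<le> V\<close> mean that
  \<open>U\<close> lies in a bounded neighbourhood of \<open>V\<close>, that is, \<open>U \<subseteq> VD\<close> for some finite \<open>D\<close>. This relation
  is visibly transitive and \<open>G\<close>-invariant; almost invariance makes complementation order-reversing,
  and \<open>i(H\X, H\X) = 0\<close> says that any two translates are nested. Among translates with \<open>U \<le> V \<le> U\<close>
  the preorder is refined by a signed count of the translates between \<open>U\<close> and \<open>V\<close>. As \<open>G\<close> and \<open>H\<close>
  are finitely generated, all but finitely many double cosets \<open>HgH\<close> give translates having an
  empty corner with \<open>X\<close>; hence one finite set \<open>D\<close> serves for all comparable pairs, and intervals
  are finite because only finitely many translates separate two given elements of \<open>G\<close>.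

  Such a nested order with finite intervals is the set of oriented edges of a tree (Dunwoody). The
  stabilizer \<open>H'\<close> of the edge \<open>X\<close> is commensurable with \<open>H\<close>. Vertex stabilizers (or the stabilizer of
  an unoriented edge, if some element inverts \<open>X\<close>) generate \<open>G\<close>, and the set \<open>Z\<close> of all \<open>g\<close> that
  translate the edge \<open>X\<close> to the far side of \<open>X\<close> is a ping-pong set. This set yields the free product
  or HNN structure, it is the set \<open>Z\<close> of the normal forms, and its complement is \<open>H\<close>-almost
  equal to \<open>X\<close>.\<close>

section \<open>Presented groups\<close>

text \<open>Inclusion up to \<open>H\<close>-finite sets would not do as the order: a translate
  \<open>gX\<close> is invariant under a conjugate of \<open>H\<close>, and finiteness over
  different conjugates cannot be compared. A bounded neighbourhood, formed by multiplication on the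
  right, refers to no subgroup. What it cannot see is the order inside a class of coarsely equal
  translates, where two opposite corners are small at once; such a class may be infinite, so
  intervals would not be finite without the signed count. Equivalent translates at count zero are
  treated as one edge, and this may enlarge \<open>H\<close> to \<open>H'\<close>. The count has a
  second use: it is positive on strict inclusions, so that for a pair with an empty corner the
  refined order is literal inclusion. A constant is needed only for the other pairs, which are
  finite in number up to translation. No tree is built; a vertex is a class of \<open>adj\<close>.
  The group structure is read off from the action of \<open>G\<close> on itself: the side of
  \<open>X\<close> to which \<open>g\<close> moves the edge shows that reduced words are non-trivial
  and also decides the first syllable of a normal form. Hence the ping-pong set equals
  \<open>Z\<close> exactly.\<close>

lemma word_congruent_lists:
  "word_congruent L R u v \<Longrightarrow> u \<in> lists L \<and> v \<in> lists L"
  by (induction rule: word_congruent.induct) auto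

lemma word_congruent_context:
  assumes "word_congruent L R u v" "p \<in> lists L" "q \<in> lists L"
  shows "word_congruent L R (p @ u @ q) (p @ v @ q)"
  using assms
proof (induction rule: word_congruent.induct)
  case (rel u v p' q')
  then show ?case
    using word_congruent.rel[of u v R L "p @ p'" "q' @ q"] by simp
next
  case (refl u)
  then show ?case by (intro word_congruent.refl) auto
qed (blast intro: word_congruent.sym word_congruent.trans)+

lemma word_congruent_append:
  assumes "word_congruent L R u u'" "word_congruent L R v v'"
  shows "word_congruent L R (u @ v) (u' @ v')"
proof -
  have "word_congruent L R (u @ v) (u' @ v)"
    using word_congruent_context[OF assms(1), of "[]" v] word_congruent_lists[OF assms(2)] by simp
  moreover have "word_congruent L R (u' @ v) (u' @ v')"
    using word_congruent_context[OF assms(2), of u' "[]"] word_congruent_lists[OF assms(1)] by simp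
  ultimately show ?thesis by (rule word_congruent.trans)
qed

lemma word_class_eq_iff:
  assumes "u \<in> lists L"
  shows "word_class L R u = word_class L R v \<longleftrightarrow> word_congruent L R u v"
  using word_congruent.sym word_congruent.trans word_congruent.refl[OF assms, of R]
  unfolding word_class_def by blast

lemma word_class_mult:
  assumes "u \<in> lists L" "v \<in> lists L"
  shows "monoid.mult (presented_monoid L R) (word_class L R u) (word_class L R v) = word_class L R (u @ v)"
proof -
  have "word_class L R (p @ q) = word_class L R (u @ v)"
    if "p \<in> word_class L R u" "q \<in> word_class L R v" for p q
    using that word_congruent_append[of L R u p v q] word_class_eq_iff[of "u @ v" L R "p @ q"] assms
    by (auto simp: word_class_def)
  moreover have "u \<in> word_class L R u" "v \<in> word_class L R v"
    using assms by (auto simp: word_class_def intro: word_congruent.refl)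
  ultimately have "(\<Union>p\<in>word_class L R u. \<Union>q\<in>word_class L R v. word_class L R (p @ q))
      = word_class L R (u @ v)"
    by (intro equalityI UN_least) blast+
  then show ?thesis by (simp add: presented_monoid_def)
qed

text \<open>Inverses of the letters, concatenated in reverse order, invert a word. Thus a presented
  monoid with invertible letters is a group, and a trivial kernel gives injectivity.\<close>

lemma word_inverse:
  assumes inv: "\<And>l. l \<in> L \<Longrightarrow> \<exists>w \<in> lists L. word_congruent L R (l # w) [] \<and> word_congruent L R (w @ [l]) []"
    and "u \<in> lists L"
  shows "\<exists>v \<in> lists L. word_congruent L R (u @ v) [] \<and> word_congruent L R (v @ u) []"
  using assms(2)
proof (induction u)
  case Nil
  then show ?case by (auto intro!: bexI[of _ "[]"] word_congruent.refl)
next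
  case (Cons l u)
  obtain v where v: "v \<in> lists L" "word_congruent L R (u @ v) []" "word_congruent L R (v @ u) []"
    using Cons by auto
  obtain w where w: "w \<in> lists L" "word_congruent L R (l # w) []" "word_congruent L R (w @ [l]) []"
    using inv[of l] Cons.hyps by force
  have "word_congruent L R ([l] @ (u @ v) @ w) ([l] @ [] @ w)"
    using word_congruent_context[OF v(2), of "[l]" w] Cons.hyps w(1) by simp
  moreover have "word_congruent L R (v @ (w @ [l]) @ u) (v @ [] @ u)"
    using word_congruent_context[OF w(3), of v u] Cons.hyps v(1) by simp
  ultimately have "word_congruent L R ((l # u) @ v @ w) []" "word_congruent L R ((v @ w) @ l # u) []"
    using v w by (simp_all, (blast intro: word_congruent.trans)+)
  moreover have "v @ w \<in> lists L" using v w by simp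
  ultimately show ?case by blast
qed

context group
begin

lemma word_value_closed:
  assumes "f \<in> L \<rightarrow> carrier G" "w \<in> lists L"
  shows "word_value G f w \<in> carrier G"
  using assms(2) by (induction w) (use assms(1) in \<open>auto simp: word_value_def\<close>)

lemma word_value_Nil: "word_value G f [] = \<one>"
  by (simp add: word_value_def)

lemma word_value_Cons: "word_value G f (l # w) = f l \<otimes> word_value G f w"
  by (simp add: word_value_def)

lemma word_value_append:
  assumes "f \<in> L \<rightarrow> carrier G" "u \<in> lists L" "v \<in> lists L"
  shows "word_value G f (u @ v) = word_value G f u \<otimes> word_value G f v"
  using assms(2)
proof (induction u)
  case (Cons l u)
  have "f l \<in> carrier G" using assms(1) Cons by auto
  moreover have "word_value G f u \<in> carrier G" "word_value G f v \<in> carrier G"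
    using word_value_closed[OF assms(1)] assms(3) Cons.hyps by blast+
  ultimately show ?case
    using Cons.IH by (simp add: word_value_Cons m_assoc)
qed (use word_value_closed[OF assms(1,3)] in \<open>simp add: word_value_Nil\<close>)

lemma word_value_congruent:
  assumes f: "f \<in> L \<rightarrow> carrier G"
    and R: "\<And>u v. (u, v) \<in> R \<Longrightarrow> u \<in> lists L \<Longrightarrow> v \<in> lists L \<Longrightarrow> word_value G f u = word_value G f v"
    and "word_congruent L R u v"
  shows "word_value G f u = word_value G f v"
  using assms(3)
proof (induction rule: word_congruent.induct)
  case (rel u v p q)
  have eq: "word_value G f u = word_value G f v" by (rule R) (fact rel)+
  have "word_value G f (p @ w @ q) = word_value G f p \<otimes> (word_value G f w \<otimes> word_value G f q)"
    if "w \<in> lists L" for w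
    using word_value_append[OF f rel(4), of "w @ q"] word_value_append[OF f that rel(5)]
      append_in_lists_conv[of w q L] that rel(5) by argo
  with eq rel(2,3) show ?case by metis
next
  case (sym u v)
  show ?case by (rule HOL.sym[OF sym.IH])
next
  case (trans u v w)
  show ?case by (rule HOL.trans[OF trans.IH])
qed (rule HOL.refl)

text \<open>\<open>R\<close> makes \<open>word_value\<close> constant on congruence classes, so that
  \<open>the_elem\<close> in \<open>induced_map\<close> is well defined; \<open>inv\<close> makes
  the presented monoid a group, and so \<open>ker\<close> has to treat only words of value
  \<open>\<one>\<close>.\<close>

lemma induced_map_iso:
  assumes f: "f \<in> L \<rightarrow> carrier G"
    and R: "\<And>u v. (u, v) \<in> R \<Longrightarrow> u \<in> lists L \<Longrightarrow> v \<in> lists L \<Longrightarrow> word_value G f u = word_value G f v"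
    and inv: "\<And>l. l \<in> L \<Longrightarrow> \<exists>w \<in> lists L. word_congruent L R (l # w) [] \<and> word_congruent L R (w @ [l]) []"
    and surj: "\<And>g. g \<in> carrier G \<Longrightarrow> \<exists>w \<in> lists L. word_value G f w = g"
    and ker: "\<And>w. w \<in> lists L \<Longrightarrow> word_value G f w = \<one> \<Longrightarrow> word_congruent L R w []"
  shows "induced_map G f \<in> iso (presented_monoid L R) G"
proof -
  have val: "word_value G f u = word_value G f v" if "word_congruent L R u v" for u v
    by (rule word_value_congruent[OF f _ that]) (rule R)
  have map: "induced_map G f (word_class L R u) = word_value G f u" if u: "u \<in> lists L" for u
  proof -
    have "word_value G f ` word_class L R u = {word_value G f u}"
    proof (intro equalityI subsetI)
      fix x assume "x \<in> word_value G f ` word_class L R u"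
      then obtain v where "word_congruent L R u v" "x = word_value G f v"
        by (auto simp: word_class_def)
      with val show "x \<in> {word_value G f u}" by (metis singletonI)
    next
      fix x assume "x \<in> {word_value G f u}"
      then show "x \<in> word_value G f ` word_class L R u"
        using word_congruent.refl[OF u, of R] by (simp add: word_class_def)
    qed
    then show ?thesis by (simp add: induced_map_def)
  qed
  have car: "carrier (presented_monoid L R) = word_class L R ` lists L"
    by (simp add: presented_monoid_def)
  have "induced_map G f \<in> hom (presented_monoid L R) G"
  proof (rule homI)
    fix P assume "P \<in> carrier (presented_monoid L R)"
    then show "induced_map G f P \<in> carrier G"
      using map word_value_closed[OF f] unfolding car by force
  next
    fix P Q assume "P \<in> carrier (presented_monoid L R)" "Q \<in> carrier (presented_monoid L R)"
    then obtain u v where "P = word_class L R u" "u \<in> lists L" "Q = word_class L R v" "v \<in> lists L"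
      unfolding car by blast
    then show "induced_map G f (P \<otimes>\<^bsub>presented_monoid L R\<^esub> Q) = induced_map G f P \<otimes> induced_map G f Q"
      by (simp add: word_class_mult map word_value_append[OF f])
  qed
  moreover have "inj_on (induced_map G f) (carrier (presented_monoid L R))"
  proof (rule inj_onI)
    fix P Q
    assume PQ: "P \<in> carrier (presented_monoid L R)" "Q \<in> carrier (presented_monoid L R)"
      "induced_map G f P = induced_map G f Q"
    then obtain u v where u: "P = word_class L R u" "u \<in> lists L"
      and v: "Q = word_class L R v" "v \<in> lists L"
      by (auto simp: car)
    have eq: "word_value G f u = word_value G f v"
      using PQ u v map by simp
    have "\<exists>w \<in> lists L. word_congruent L R (v @ w) [] \<and> word_congruent L R (w @ v) []"
      by (rule word_inverse[OF _ v(2)]) (rule inv)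
    then obtain w where w: "w \<in> lists L" "word_congruent L R (v @ w) []" "word_congruent L R (w @ v) []"
      by blast
    have "word_value G f (u @ w) = word_value G f (v @ w)"
      using eq u v w by (simp add: word_value_append[OF f])
    also have "\<dots> = \<one>"
      using val[OF w(2)] by (simp add: word_value_Nil)
    finally have "word_congruent L R (u @ w) []"
      using ker u w by auto
    then have "word_congruent L R (u @ w @ v) v"
      using word_congruent_context[of L R "u @ w" "[]" "[]" v] v by simp
    moreover have "word_congruent L R (u @ w @ v) u"
      using word_congruent_context[OF w(3), of u "[]"] u by simp
    ultimately have "word_congruent L R u v"
      by (blast intro: word_congruent.sym word_congruent.trans)
    then show "P = Q"
      using u v by (simp add: word_class_eq_iff)
  qed
  moreover have "induced_map G f ` carrier (presented_monoid L R) = carrier G"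
  proof -
    have "induced_map G f ` carrier (presented_monoid L R) = word_value G f ` lists L"
      unfolding car image_image using map by (rule image_cong[OF HOL.refl])
    also have "\<dots> = carrier G"
      using surj word_value_closed[OF f] by blast
    finally show ?thesis .
  qed
  ultimately show ?thesis
    by (simp add: iso_def bij_betw_def)
qed

end

section \<open>A ping-pong criterion for amalgamated free products\<close>

lemma not_successivelyE:
  assumes "\<not> successively P w"
  obtains p x y q where "w = p @ [x, y] @ q" "\<not> P x y"
proof -
  have "\<exists>p x y q. w = p @ [x, y] @ q \<and> \<not> P x y"
    using assms
  proof (induction P w rule: successively.induct)
    case (3 P x y xs)
    show ?case
    proof (cases "P x y")
      case True
      with 3 obtain p x' y' q where "y # xs = p @ [x', y'] @ q \<and> \<not> P x' y'" by auto
      then show ?thesis by (metis append_Cons)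
    qed (metis append_Cons append_Nil)
  qed auto
  then show thesis using that by blast
qed

lemma successively_imp_all:
  assumes "successively P w" "\<And>x y. P x y \<Longrightarrow> Q x \<and> Q y" "length w \<ge> 2" "x \<in> set w"
  shows "Q x"
  using assms(1,3,4)
proof (induction w rule: induct_list012)
  case (3 y z w)
  have "Q y" "Q z" using 3(3) assms(2)[of y z] by auto
  then show ?case using 3 by (cases w) auto
qed auto

text \<open>The rewriting step for normal forms: \<open>k\<close>, an element of the amalgamated or
  an associated subgroup, is handed on to the remainder \<open>r\<close>.\<close>

lemma (in monoid) mult_shift:
  assumes "x \<otimes> b = b' \<otimes> k" "x \<in> carrier G" "b \<in> carrier G" "b' \<in> carrier G" "k \<in> carrier G" "r \<in> carrier G"
  shows "x \<otimes> (b \<otimes> r) = b' \<otimes> (k \<otimes> r)"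
  using assms m_assoc[of x b r] m_assoc[of b' k r] by simp

lemma (in group) left_transversal_exists:
  assumes "subgroup A G" "subgroup H G" "H \<subseteq> A"
  obtains T where "left_transversal G A H T"
proof -
  interpret A: subgroup A G by fact
  interpret H: subgroup H G by fact
  \<comment> \<open>A transversal must contain the identity, hence the special choice for the coset
    \<open>H\<close> itself.\<close>
  define rep where "rep C = (if \<one> \<in> C then \<one> else SOME x. x \<in> C)" for C
  have self: "a \<in> a <# H" if "a \<in> A" for a
    using that H.one_closed by (force simp: l_coset_def)
  have rep: "rep (a <# H) \<in> a <# H" if "a \<in> A" for a
    using self[OF that] by (auto simp: rep_def intro: someI)
  have sub: "a <# H \<subseteq> A" if "a \<in> A" for a
    using that assms(3) by (auto simp: l_coset_def)
  have eq: "x <# H = a <# H" if "a \<in> A" "x \<in> a <# H" for a x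
    using l_repr_independence[OF that(2) _ assms(2)] that(1) by auto
  have "left_transversal G A H (rep ` (\<lambda>a. a <# H) ` A)"
    unfolding left_transversal_def
  proof (intro conjI ballI ex1I)
    show "rep ` (\<lambda>a. a <# H) ` A \<subseteq> A"
      using rep sub by blast
    have "rep (\<one> <# H) = \<one>"
      using self[OF A.one_closed] by (simp add: rep_def)
    then show "\<one> \<in> rep ` (\<lambda>a. a <# H) ` A"
      using A.one_closed by (metis imageI)
  next
    fix a assume "a \<in> A"
    then show "rep (a <# H) \<in> rep ` (\<lambda>a. a <# H) ` A" "rep (a <# H) \<in> a <# H"
      using rep by auto
  next
    fix a x assume "a \<in> A" "x \<in> rep ` (\<lambda>a. a <# H) ` A \<and> x \<in> a <# H"
    then obtain a' where "a' \<in> A" "x = rep (a' <# H)" "x \<in> a <# H" by blast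
    then show "x = rep (a <# H)"
      using eq[of a x] eq[of a' x] rep[of a'] \<open>a \<in> A\<close> by simp
  qed
  then show thesis using that by blast
qed

lemma (in group) left_transversal_decompose:
  assumes "subgroup A G" "subgroup H G" "H \<subseteq> A" "left_transversal G A H T" "a \<in> A"
  obtains x h where "x \<in> T" "h \<in> H" "a = x \<otimes> h" "x = \<one> \<longleftrightarrow> a \<in> H"
proof -
  interpret A: subgroup A G by fact
  interpret H: subgroup H G by fact
  obtain x where x: "x \<in> T" "x \<in> a <# H"
    using assms(4,5) by (auto simp: left_transversal_def)
  then obtain h where h: "h \<in> H" "x = a \<otimes> h" by (auto simp: l_coset_def)
  have carr: "a \<in> carrier G" "h \<in> carrier G" using assms(5) h by auto
  have "a = x \<otimes> inv h" using h carr by (simp add: m_assoc)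
  moreover have "x = \<one> \<longleftrightarrow> a \<in> H"
  proof
    assume "x = \<one>"
    then show "a \<in> H" using calculation h(1) by simp
  next
    assume a: "a \<in> H"
    have "\<one> \<in> a <# H"
      using a carr by (auto simp: l_coset_def intro!: bexI[of _ "inv a"])
    then show "x = \<one>" using x assms(4,5) by (auto simp: left_transversal_def)
  qed
  ultimately show thesis using that x h by blast
qed

lemma (in group) left_transversal_notin:
  assumes "subgroup A G" "subgroup H G" "H \<subseteq> A" "left_transversal G A H T" "x \<in> T" "x \<noteq> \<one>"
  shows "x \<in> A - H"
proof -
  interpret H: subgroup H G by fact
  have x: "x \<in> A" using assms by (auto simp: left_transversal_def)
  then have xc: "x \<in> carrier G" by (rule subgroup.mem_carrier[OF assms(1)])
  have "x \<in> x <# H"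
    using xc H.one_closed by (force simp: l_coset_def)
  moreover have "\<one> \<in> x <# H" if "x \<in> H"
    using that xc by (auto simp: l_coset_def intro!: bexI[of _ "inv x"])
  ultimately show ?thesis using x assms(4-6) by (auto simp: left_transversal_def)
qed

text \<open>Ping-pong for \<open>G\<close> acting on itself by left multiplication, played between
  \<open>D\<close> and its complement. \<open>D\<close> is meant to be the set of elements whose
  normal form begins in \<open>A - H\<close>; \<open>BD\<close> starts the game, since every normal
  form ends with an element of \<open>B\<close>.\<close>

locale amalgam_pingpong = group G for G (structure) +
  fixes A B H D :: "'a set"
  assumes A: "subgroup A G" and B: "subgroup B G" and H: "subgroup H G"
    and HA: "H \<subseteq> A" and HB: "H \<subseteq> B"
    and gen: "generate G (A \<union> B) = carrier G"
    and D: "D \<subseteq> carrier G"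
    and A_into: "a \<in> A - H \<Longrightarrow> r \<in> carrier G - D \<Longrightarrow> a \<otimes> r \<in> D"
    and B_outof: "b \<in> B - H \<Longrightarrow> r \<in> D \<Longrightarrow> b \<otimes> r \<notin> D"
    and BD: "B \<inter> D = {}"
begin

sublocale A: subgroup A G by (rule A)
sublocale B: subgroup B G by (rule B)
sublocale H: subgroup H G by (rule H)

abbreviation (input) letters :: "('a + 'a) set" where "letters \<equiv> A <+> B"
abbreviation (input) rels where
  "rels \<equiv> amalgam_relations (G\<lparr>carrier := A\<rparr>) (G\<lparr>carrier := B\<rparr>) H"
abbreviation (input) letter :: "'a + 'a \<Rightarrow> 'a" where
  "letter \<equiv> case_sum (\<lambda>a. a) (\<lambda>b. b)"
abbreviation (input) cong_words where
  "cong_words \<equiv> word_congruent letters rels"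

lemma letter_closed: "letter \<in> letters \<rightarrow> carrier G"
  by auto

lemma cong_rel: "(u, v) \<in> rels \<Longrightarrow> u \<in> lists letters \<Longrightarrow> v \<in> lists letters \<Longrightarrow> cong_words u v"
  using word_congruent.rel[of u v rels letters "[]" "[]"] by simp

lemma cong_basic:
  "x \<in> A \<Longrightarrow> y \<in> A \<Longrightarrow> cong_words [Inl x, Inl y] [Inl (x \<otimes> y)]"
  "x \<in> B \<Longrightarrow> y \<in> B \<Longrightarrow> cong_words [Inr x, Inr y] [Inr (x \<otimes> y)]"
  "cong_words [Inl \<one>] []" "cong_words [Inr \<one>] []"
  "x \<in> H \<Longrightarrow> cong_words [Inl x] [Inr x]"
  by ((rule cong_rel; use HA HB in \<open>auto simp: amalgam_relations_def\<close>)+)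

lemma one_notin_D: "\<one> \<notin> D"
  using BD B.one_closed by blast

text \<open>An element of \<open>H\<close> may be read in either factor, so neighbouring letters can
  be merged even if they come from different factors.\<close>

lemma cong_mixed:
  assumes "x \<in> A" "y \<in> B" "x \<in> H \<or> y \<in> H"
  shows "\<exists>l \<in> letters. cong_words [Inl x, Inr y] [l]" "\<exists>l \<in> letters. cong_words [Inr y, Inl x] [l]"
proof -
  have *: "(\<exists>l \<in> letters. cong_words [Inl x, Inr y] [l]) \<and> (\<exists>l \<in> letters. cong_words [Inr y, Inl x] [l])"
  proof (cases "x \<in> H")
    case True
    have "cong_words [Inl x, Inr y] [Inr x, Inr y]" "cong_words [Inr y, Inl x] [Inr y, Inr x]"
      using word_congruent_context[OF cong_basic(5)[OF True], of "[]" "[Inr y]"]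
        word_congruent_context[OF cong_basic(5)[OF True], of "[Inr y]" "[]"] assms by auto
    moreover have "x \<in> B" using True HB by auto
    ultimately have "cong_words [Inl x, Inr y] [Inr (x \<otimes> y)]" "cong_words [Inr y, Inl x] [Inr (y \<otimes> x)]"
      using assms by (blast intro: word_congruent.trans cong_basic(2))+
    then show ?thesis using assms \<open>x \<in> B\<close> by blast
  next
    case False
    then have y: "y \<in> H" using assms by blast
    have "cong_words [Inl x, Inr y] [Inl x, Inl y]" "cong_words [Inr y, Inl x] [Inl y, Inl x]"
      using word_congruent_context[OF word_congruent.sym[OF cong_basic(5)[OF y]], of "[]" "[Inl x]"]
        word_congruent_context[OF word_congruent.sym[OF cong_basic(5)[OF y]], of "[Inl x]" "[]"] assms by auto
    moreover have "y \<in> A" using y HA by auto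
    ultimately have "cong_words [Inl x, Inr y] [Inl (x \<otimes> y)]" "cong_words [Inr y, Inl x] [Inl (y \<otimes> x)]"
      using assms by (blast intro: word_congruent.trans cong_basic(1))+
    then show ?thesis using assms \<open>y \<in> A\<close> by blast
  qed
  then show "\<exists>l \<in> letters. cong_words [Inl x, Inr y] [l]" "\<exists>l \<in> letters. cong_words [Inr y, Inl x] [l]"
    by blast+
qed

lemma rels_respected: "(u, v) \<in> rels \<Longrightarrow> word_value G letter u = word_value G letter v"
  using HA HB by (auto simp: amalgam_relations_def word_value_def)

lemma cong_value: "cong_words u v \<Longrightarrow> word_value G letter u = word_value G letter v"
  by (rule word_value_congruent[OF letter_closed rels_respected])

text \<open>Induction from the right: each letter is one move of the ping-pong. The value of a word
  that begins in \<open>B\<close> lies outside \<open>D\<close>, but so does \<open>\<one>\<close>;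
  therefore being different from \<open>\<one>\<close> has to be carried along.\<close>

lemma alternating_value:
  assumes "w \<in> lists letters" "w \<noteq> []" "\<And>l. l \<in> set w \<Longrightarrow> letter l \<notin> H"
    "successively (\<lambda>l l'. isl l \<noteq> isl l') w"
  shows "(isl (hd w) \<longrightarrow> word_value G letter w \<in> D) \<and>
    (\<not> isl (hd w) \<longrightarrow> word_value G letter w \<notin> D \<and> word_value G letter w \<noteq> \<one>)"
  using assms
proof (induction w rule: induct_list012)
  case (2 l)
  have "\<one> \<in> carrier G - D" using one_notin_D by auto
  then have "a \<otimes> \<one> \<in> D" if "a \<in> A - H" for a
    using A_into that by blast
  moreover have "b \<notin> D \<and> b \<noteq> \<one>" if "b \<in> B - H" for b
    using BD that H.one_closed by blast
  moreover have "letter l \<notin> H" "l \<in> letters" using 2(3)[of l] 2(1) by auto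
  ultimately show ?case
    by (cases l) (auto simp: word_value_def)
next
  case (3 l l' w)
  let ?r = "word_value G letter (l' # w)"
  have IH: "(isl l' \<longrightarrow> ?r \<in> D) \<and> (\<not> isl l' \<longrightarrow> ?r \<notin> D \<and> ?r \<noteq> \<one>)"
    using 3 by auto
  have rc: "?r \<in> carrier G" by (rule word_value_closed[OF letter_closed]) (use 3 in auto)
  have nl: "letter l \<notin> H" using 3(5)[of l] by simp
  have v: "word_value G letter (l # l' # w) = letter l \<otimes> ?r" by (rule word_value_Cons)
  show ?case
  proof (cases l)
    case (Inl a)
    then have "a \<in> A - H" "?r \<in> carrier G - D" using 3(3,6) IH rc nl by auto
    then show ?thesis using A_into[of a ?r] Inl v by auto
  next
    case (Inr b)
    then have b: "b \<in> B - H" "?r \<in> D" using 3(3,6) IH rc nl by auto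
    \<comment> \<open>Otherwise \<open>?r\<close> would be \<open>inv b\<close>, an element of both
      \<open>B\<close> and \<open>D\<close>.\<close>
    have "b \<otimes> ?r \<noteq> \<one>"
    proof
      assume "b \<otimes> ?r = \<one>"
      then have "?r = inv b" using b rc by (metis B.mem_carrier Diff_iff inv_equality inv_inv)
      then show False using b BD by auto
    qed
    with b show ?thesis using B_outof[of b ?r] Inr v by auto
  qed
qed auto

text \<open>Merging neighbours shortens a word, so by induction only words without mergeable
  neighbours remain. With two or more letters these alternate and avoid \<open>H\<close>, so their
  value is not \<open>\<one>\<close>; a single letter of value \<open>\<one>\<close> is removed by a
  relation.\<close>

lemma word_kernel:
  assumes "w \<in> lists letters" "word_value G letter w = \<one>"
  shows "cong_words w []"
  using assms
proof (induction "length w" arbitrary: w rule: less_induct)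
  case less
  have shorten: "cong_words w []" if w: "w = p @ [l, l'] @ q" and l'': "l'' \<in> letters" "cong_words [l, l'] [l'']"
    for p q l l' l''
  proof -
    have c: "cong_words w (p @ [l''] @ q)"
      unfolding w by (rule word_congruent_context[OF l''(2)]) (use less.prems(1) w in auto)
    moreover have "cong_words (p @ [l''] @ q) []"
      by (rule less.hyps) (use w l'' less.prems cong_value[OF c] in auto)
    ultimately show ?thesis by (rule word_congruent.trans)
  qed
  \<comment> \<open>A pair that is not \<open>?good\<close> can be merged. In a word of at least two
    letters, \<open>?good\<close> throughout keeps every letter outside \<open>H\<close>.\<close>
  let ?good = "\<lambda>l l'. isl l \<noteq> isl l' \<and> letter l \<notin> H \<and> letter l' \<notin> H"
  show ?case
  proof (cases "successively ?good w")
    case False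
    then obtain p l l' q where w: "w = p @ [l, l'] @ q" and ng: "\<not> ?good l l'"
      by (rule not_successivelyE)
    have ll: "l \<in> letters" "l' \<in> letters" using less.prems(1) w by auto
    have "\<exists>l'' \<in> letters. cong_words [l, l'] [l'']"
      using ll ng by (cases l; cases l') (auto dest: cong_mixed cong_basic(1,2))
    then show ?thesis using shorten[OF w] by blast
  next
    case True
    consider "w = []" | l where "w = [l]" | l l' r where "w = l # l' # r"
      by (metis neq_Nil_conv)
    then show ?thesis
    proof cases
      case 1
      then show ?thesis by (auto intro: word_congruent.refl)
    next
      case (2 l)
      have "letter l \<in> carrier G" using less.prems(1) 2 by auto
      then have "letter l = \<one>" using less.prems(2) 2 by (simp add: word_value_def)
      then show ?thesis using 2 cong_basic(3,4) by (cases l) simp_all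
    next
      case (3 l l' r)
      have nH: "letter x \<notin> H" if "x \<in> set w" for x
        by (rule successively_imp_all[OF True _ _ that]) (use 3 in auto)
      have "successively (\<lambda>l l'. isl l \<noteq> isl l') w"
        using True by (rule successively_mono) auto
      from alternating_value[OF less.prems(1) _ nH this] 3
      have "word_value G letter w \<noteq> \<one>"
        using one_notin_D by auto
      then show ?thesis using less.prems(2) by blast
    qed
  qed
qed

lemma word_surj:
  assumes "g \<in> carrier G"
  shows "\<exists>w \<in> lists letters. word_value G letter w = g"
proof -
  have single: "\<exists>w \<in> lists letters. word_value G letter w = h" if "h \<in> A \<union> B" for h
  proof -
    have "\<exists>l \<in> letters. letter l = h"
    proof (cases "h \<in> A")
      case True
      then show ?thesis by (intro bexI[of _ "Inl h"]) auto
    next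
      case False
      then show ?thesis using that by (intro bexI[of _ "Inr h"]) auto
    qed
    then obtain l where l: "l \<in> letters" "letter l = h" by blast
    have "h \<in> carrier G" using that by auto
    then show ?thesis using l by (intro bexI[of _ "[l]"]) (auto simp: word_value_def)
  qed
  have "g \<in> generate G (A \<union> B)" using gen assms by simp
  then show ?thesis
  proof (induction rule: generate.induct)
    case one
    then show ?case by (intro bexI[of _ "[]"]) (auto simp: word_value_def)
  next
    case (incl h)
    then show ?case by (rule single)
  next
    case (inv h)
    then show ?case by (intro single) auto
  next
    case (eng h1 h2)
    then obtain u v where "u \<in> lists letters" "v \<in> lists letters" "word_value G letter u = h1"
      "word_value G letter v = h2" by blast
    then show ?case
      using word_value_append[OF letter_closed] by (intro bexI[of _ "u @ v"]) auto
  qed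
qed

lemma amalgam_iso:
  "induced_map G letter \<in> iso (amalgam (G\<lparr>carrier := A\<rparr>) (G\<lparr>carrier := B\<rparr>) H) G"
proof -
  have "induced_map G letter \<in> iso (presented_monoid letters rels) G"
  proof (rule induced_map_iso[OF letter_closed])
    fix l assume l: "l \<in> letters"
    show "\<exists>w \<in> lists letters. cong_words (l # w) [] \<and> cong_words (w @ [l]) []"
    proof (cases l)
      case (Inl a)
      then have a: "a \<in> A" using l by auto
      have "cong_words [Inl a, Inl (inv a)] []" "cong_words [Inl (inv a), Inl a] []"
        using cong_basic(1)[of a "inv a"] cong_basic(1)[of "inv a" a] cong_basic(3) a
        by (auto intro: word_congruent.trans)
      then show ?thesis using a Inl by (intro bexI[of _ "[Inl (inv a)]"]) auto
    next
      case (Inr b)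
      then have b: "b \<in> B" using l by auto
      have "cong_words [Inr b, Inr (inv b)] []" "cong_words [Inr (inv b), Inr b] []"
        using cong_basic(2)[of b "inv b"] cong_basic(2)[of "inv b" b] cong_basic(4) b
        by (auto intro: word_congruent.trans)
      then show ?thesis using b Inr by (intro bexI[of _ "[Inr (inv b)]"]) auto
    qed
  qed (auto intro: rels_respected word_surj word_kernel)
  then show ?thesis by (simp add: amalgam_def)
qed

lemma splitting:
  assumes "A \<noteq> carrier G" "B \<noteq> carrier G"
  shows "splitting_over G H (Amalgam A B H)"
  unfolding splitting_over.simps using assms amalgam_iso A B H HA HB by blast

end

text \<open>The elements \<open>b\<^sub>1 a\<^sub>2 b\<^sub>2 \<dots> a\<^sub>n b\<^sub>n h\<close> of a normal form without its first letter \<open>a\<^sub>1\<close>.\<close>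

inductive amalgam_tail :: "('a, 'm) monoid_scheme \<Rightarrow> 'a set \<Rightarrow> 'a set \<Rightarrow> 'a set \<Rightarrow> 'a \<Rightarrow> bool"
  for G (structure) and H TA TB where
  last: "b \<in> TB \<Longrightarrow> h \<in> H \<Longrightarrow> amalgam_tail G H TA TB (b \<otimes> h)"
| step: "b \<in> TB \<Longrightarrow> b \<noteq> \<one> \<Longrightarrow> a \<in> TA \<Longrightarrow> a \<noteq> \<one> \<Longrightarrow> amalgam_tail G H TA TB r \<Longrightarrow>
    amalgam_tail G H TA TB (b \<otimes> (a \<otimes> r))"

lemma amalgam_tail_normal_form:
  assumes "amalgam_tail G H TA TB r" "a \<in> TA"
  shows "\<exists>ps h. amalgam_normal_form G H TA TB (a \<otimes>\<^bsub>G\<^esub> r) ps h \<and> fst (hd ps) = a"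
  using assms
proof (induction arbitrary: a rule: amalgam_tail.induct)
  case (last b h)
  then show ?case
    by (intro exI[of _ "[(a, b)]"] exI[of _ h]) (auto simp: amalgam_normal_form_def)
next
  case (step b a' r)
  then obtain ps h where nf: "amalgam_normal_form G H TA TB (a' \<otimes>\<^bsub>G\<^esub> r) ps h" "fst (hd ps) = a'"
    by blast
  then have "ps \<noteq> []" by (simp add: amalgam_normal_form_def)
  then obtain p ps' where ps: "ps = p # ps'" by (meson neq_Nil_conv)
  have "amalgam_normal_form G H TA TB (a \<otimes>\<^bsub>G\<^esub> (b \<otimes>\<^bsub>G\<^esub> (a' \<otimes>\<^bsub>G\<^esub> r))) ((a, b) # ps) h"
    using nf step ps by (auto simp: amalgam_normal_form_def nth_Cons split: nat.splits)
  then show ?case by force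
qed

lemma amalgam_normal_form_tail:
  assumes "amalgam_normal_form G H TA TB g ps h"
  shows "\<exists>r. amalgam_tail G H TA TB r \<and> fst (hd ps) \<in> TA \<and> g = fst (hd ps) \<otimes>\<^bsub>G\<^esub> r"
  using assms
proof (induction ps arbitrary: g)
  case Nil
  then show ?case by (simp add: amalgam_normal_form_def)
next
  case (Cons p ps)
  obtain a b where p: "p = (a, b)" by fastforce
  have ab: "a \<in> TA" "b \<in> TB" "h \<in> H" using Cons.prems p by (auto simp: amalgam_normal_form_def)
  show ?case
  proof (cases "ps = []")
    case True
    then show ?thesis
      using Cons.prems p ab by (auto simp: amalgam_normal_form_def intro: amalgam_tail.last)
  next
    case False
    let ?g = "foldr (\<lambda>(a, b) x. a \<otimes>\<^bsub>G\<^esub> (b \<otimes>\<^bsub>G\<^esub> x)) ps h"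
    have "fst (ps ! i) \<noteq> \<one>\<^bsub>G\<^esub>" if "i < length ps" for i
      using Cons.prems that by (auto simp: amalgam_normal_form_def dest!: spec[of _ "Suc i"])
    moreover have snd: "snd ((p # ps) ! i) \<noteq> \<one>\<^bsub>G\<^esub>" if "i < length ps" for i
      using Cons.prems that by (auto simp: amalgam_normal_form_def)
    moreover have "snd (ps ! i) \<noteq> \<one>\<^bsub>G\<^esub>" if "Suc i < length ps" for i
      using snd[of "Suc i"] that by simp
    ultimately have "amalgam_normal_form G H TA TB ?g ps h" "fst (hd ps) \<noteq> \<one>\<^bsub>G\<^esub>" "b \<noteq> \<one>\<^bsub>G\<^esub>"
      using Cons.prems False snd[of 0] p by (auto simp: amalgam_normal_form_def hd_conv_nth)
    moreover from this obtain r where "amalgam_tail G H TA TB r" "fst (hd ps) \<in> TA"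
      "?g = fst (hd ps) \<otimes>\<^bsub>G\<^esub> r" using Cons.IH by blast
    moreover have "g = a \<otimes>\<^bsub>G\<^esub> (b \<otimes>\<^bsub>G\<^esub> ?g)"
      using Cons.prems p by (simp add: amalgam_normal_form_def)
    ultimately show ?thesis using ab p by (auto intro!: amalgam_tail.step)
  qed
qed

section \<open>Normal forms in amalgamated free products\<close>

context amalgam_pingpong
begin

context
  fixes TA TB :: "'a set"
  assumes TA: "left_transversal G A H TA" and TB: "left_transversal G B H TB"
begin

abbreviation (input) tail where "tail \<equiv> amalgam_tail G H TA TB"

lemma TA_sub: "TA \<subseteq> A" and TB_sub: "TB \<subseteq> B" and TA_one: "\<one> \<in> TA" and TB_one: "\<one> \<in> TB"
  using TA TB by (auto simp: left_transversal_def)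

lemma carrier_intros [intro, simp]:
  "x \<in> TA \<Longrightarrow> x \<in> carrier G" "x \<in> TB \<Longrightarrow> x \<in> carrier G"
  using TA_sub TB_sub by auto

lemma decompose_A: "x \<in> A \<Longrightarrow> \<exists>a k. a \<in> TA \<and> k \<in> H \<and> x = a \<otimes> k \<and> (a = \<one> \<longleftrightarrow> x \<in> H)"
  by (rule left_transversal_decompose[OF A H HA TA]) blast+

lemma decompose_B: "x \<in> B \<Longrightarrow> \<exists>b k. b \<in> TB \<and> k \<in> H \<and> x = b \<otimes> k \<and> (b = \<one> \<longleftrightarrow> x \<in> H)"
  by (rule left_transversal_decompose[OF B H HB TB]) blast+

lemma tail_closed: "tail r \<Longrightarrow> r \<in> carrier G"
  by (induction rule: amalgam_tail.induct) auto

text \<open>The final factor \<open>b \<otimes> h\<close> lies in \<open>B\<close>, hence outside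
  \<open>D\<close>; every further pair enters \<open>D\<close> through \<open>a\<close> and leaves
  it through \<open>b\<close>.\<close>

lemma tail_notin_D: "tail r \<Longrightarrow> r \<notin> D"
proof (induction rule: amalgam_tail.induct)
  case (last b h)
  then have "b \<otimes> h \<in> B" using TB_sub HB by auto
  then show ?case using BD by blast
next
  case (step b a r)
  have "a \<in> A - H" "b \<in> B - H"
    using step left_transversal_notin[OF A H HA TA] left_transversal_notin[OF B H HB TB] by simp_all
  then show ?case by (intro B_outof A_into DiffI step.IH tail_closed step.hyps) simp_all
qed

text \<open>The element of \<open>H\<close> travels to the right through the transversals:
  \<open>x b = b' k\<close>, then \<open>k a = a' k'\<close>, and so on. Letters stay non-trivial
  because multiplication by an element of \<open>H\<close> does not affect membership in
  \<open>H\<close>.\<close>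

lemma tail_push:
  assumes "tail r" "x \<in> H"
  shows "tail (x \<otimes> r)"
  using assms
proof (induction arbitrary: x rule: amalgam_tail.induct)
  case (last b h)
  have "x \<otimes> b \<in> B" using last TB_sub HB by (intro B.m_closed) blast+
  then obtain b' k where "b' \<in> TB" "k \<in> H" "x \<otimes> b = b' \<otimes> k"
    using decompose_B by blast
  moreover from this last have "x \<otimes> (b \<otimes> h) = b' \<otimes> (k \<otimes> h)"
    by (intro mult_shift) simp_all
  ultimately show ?case using last by (simp add: amalgam_tail.last)
next
  case (step b a r)
  have b: "b \<in> B - H" "a \<in> A - H"
    using step left_transversal_notin[OF A H HA TA] left_transversal_notin[OF B H HB TB] by blast+
  have "x \<otimes> b \<in> B" using step TB_sub HB by auto
  then obtain b' k where k: "b' \<in> TB" "k \<in> H" "x \<otimes> b = b' \<otimes> k" "b' = \<one> \<longleftrightarrow> x \<otimes> b \<in> H"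
    using decompose_B by blast
  have "k \<otimes> a \<in> A" using step k TA_sub HA by auto
  then obtain a' k' where k': "a' \<in> TA" "k' \<in> H" "k \<otimes> a = a' \<otimes> k'" "a' = \<one> \<longleftrightarrow> k \<otimes> a \<in> H"
    using decompose_A by blast
  have "x \<otimes> b \<notin> H" "k \<otimes> a \<notin> H"
    using b step.prems k(2) H.subgroup_axioms
    by (metis DiffE H.mem_carrier H.m_closed H.m_inv_closed B.mem_carrier A.mem_carrier inv_solve_left)+
  then have "tail (b' \<otimes> (a' \<otimes> (k' \<otimes> r)))"
    using k(1,4) k'(1,4) step.IH[OF k'(2)] by (intro amalgam_tail.step) simp_all
  moreover have "x \<otimes> (b \<otimes> (a \<otimes> r)) = b' \<otimes> (a' \<otimes> (k' \<otimes> r))"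
  proof -
    have rc: "r \<in> carrier G" using step tail_closed by blast
    have "x \<otimes> (b \<otimes> (a \<otimes> r)) = b' \<otimes> (k \<otimes> (a \<otimes> r))"
      using k(3) by (rule mult_shift) (use step.hyps step.prems rc k(1,2) in simp_all)
    also have "k \<otimes> (a \<otimes> r) = a' \<otimes> (k' \<otimes> r)"
      using k'(3) by (rule mult_shift) (use step.hyps rc k(2) k'(1,2) in simp_all)
    finally show ?thesis .
  qed
  ultimately show ?case by simp
qed

lemma normal_form_A:
  assumes "x \<in> A" "a \<in> A" "tail r"
  shows "\<exists>a' \<in> TA. \<exists>r'. tail r' \<and> x \<otimes> (a \<otimes> r) = a' \<otimes> r' \<and> (a' = \<one> \<longleftrightarrow> x \<otimes> a \<in> H)"
proof -
  have "x \<otimes> a \<in> A" using assms by auto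
  then obtain a' k where k: "a' \<in> TA" "k \<in> H" "x \<otimes> a = a' \<otimes> k" "a' = \<one> \<longleftrightarrow> x \<otimes> a \<in> H"
    using decompose_A by blast
  have rc: "r \<in> carrier G" using assms tail_closed by blast
  have "x \<otimes> (a \<otimes> r) = a' \<otimes> (k \<otimes> r)"
    using k(3) by (rule mult_shift) (use assms rc k(1,2) in simp_all)
  moreover have "tail (k \<otimes> r)" using k tail_push assms by blast
  ultimately show ?thesis using k by (intro bexI[of _ a'] exI[of _ "k \<otimes> r"] conjI) simp_all
qed

lemma normal_form_B_step:
  assumes "x \<in> B" "a \<in> A" "tail r" "x \<notin> H" "a \<notin> H"
  shows "tail (x \<otimes> (a \<otimes> r))"
proof -
  obtain x' k where k: "x' \<in> TB" "k \<in> H" "x = x' \<otimes> k" "x' = \<one> \<longleftrightarrow> x \<in> H"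
    using decompose_B[OF assms(1)] by blast
  have "k \<in> A" using k HA by auto
  then obtain a' r' where r': "a' \<in> TA" "tail r'" "k \<otimes> (a \<otimes> r) = a' \<otimes> r'" "a' = \<one> \<longleftrightarrow> k \<otimes> a \<in> H"
    using normal_form_A[of k a r] assms(2,3) by blast
  have "k \<otimes> a \<notin> H"
    using assms k(2)
    by (metis H.mem_carrier H.m_closed H.m_inv_closed A.mem_carrier inv_solve_left)
  moreover have "x \<otimes> (a \<otimes> r) = x' \<otimes> (k \<otimes> (a \<otimes> r))"
    unfolding k(3) by (rule m_assoc) (use k(1,2) assms(2) tail_closed[OF assms(3)] in simp_all)
  moreover have "tail (x' \<otimes> (a' \<otimes> r'))"
    using k(1,4) r'(1,2,4) assms(4) calculation(1) by (intro amalgam_tail.step) simp_all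
  ultimately show ?thesis using r'(3) by simp
qed

text \<open>If \<open>x\<close> is outside \<open>H\<close> and \<open>a\<close> is trivial,
  \<open>x\<close> merges with the first \<open>B\<close>-letter of the tail; should the product
  fall into \<open>H\<close>, it is absorbed by the next \<open>A\<close>-letter.\<close>

lemma normal_form_B:
  assumes "x \<in> B" "a \<in> TA" "tail r"
  shows "\<exists>a' \<in> TA. \<exists>r'. tail r' \<and> x \<otimes> (a \<otimes> r) = a' \<otimes> r'"
proof -
  have rc: "r \<in> carrier G" using assms tail_closed by blast
  consider "x \<in> H" | "x \<notin> H" "a \<noteq> \<one>" | "x \<notin> H" "a = \<one>" by blast
  then show ?thesis
  proof cases
    case 1
    then show ?thesis using normal_form_A[of x a r] assms HA TA_sub by blast
  next
    case 2
    then have "a \<in> A - H" using left_transversal_notin[OF A H HA TA] assms by blast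
    then have "tail (x \<otimes> (a \<otimes> r))" using normal_form_B_step assms 2 by blast
    moreover have "x \<otimes> (a \<otimes> r) = \<one> \<otimes> (x \<otimes> (a \<otimes> r))" using assms rc by simp
    ultimately show ?thesis using TA_one by blast
  next
    case 3
    from assms(3) show ?thesis
    proof cases
      case (last b h)
      then have "x \<otimes> b \<in> B" using assms TB_sub by auto
      then obtain b' k where "b' \<in> TB" "k \<in> H" "x \<otimes> b = b' \<otimes> k"
        using decompose_B by blast
      moreover from this last have "x \<otimes> (b \<otimes> h) = b' \<otimes> (k \<otimes> h)"
        using assms by (intro mult_shift) simp_all
      ultimately have "tail (x \<otimes> r)"
        using last by (simp add: amalgam_tail.last)
      moreover have "x \<otimes> (a \<otimes> r) = \<one> \<otimes> (x \<otimes> r)" using 3 assms rc by simp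
      ultimately show ?thesis using TA_one by blast
    next
      case (step b a2 r2)
      then have r2: "r2 \<in> carrier G" "a2 \<in> A - H"
        using tail_closed left_transversal_notin[OF A H HA TA] by blast+
      have xb: "x \<otimes> b \<in> B" using assms step TB_sub by auto
      have eq: "x \<otimes> (a \<otimes> r) = (x \<otimes> b) \<otimes> (a2 \<otimes> r2)"
        using 3 step assms r2 by (simp add: m_assoc)
      show ?thesis
      proof (cases "x \<otimes> b \<in> H")
        case True
        then show ?thesis using normal_form_A[of "x \<otimes> b" a2 r2] HA r2 step eq by auto
      next
        case False
        then have "tail (x \<otimes> (a \<otimes> r))" using normal_form_B_step[OF xb] r2 step eq by auto
        moreover have "x \<otimes> (a \<otimes> r) = \<one> \<otimes> (x \<otimes> (a \<otimes> r))" using assms rc by simp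
        ultimately show ?thesis using TA_one by blast
      qed
    qed
  qed
qed

lemma normal_form_exists:
  assumes "g \<in> carrier G"
  shows "\<exists>a \<in> TA. \<exists>r. tail r \<and> g = a \<otimes> r"
proof -
  let ?nf = "\<lambda>g. \<exists>a \<in> TA. \<exists>r. tail r \<and> g = a \<otimes> r"
  have step: "?nf (x \<otimes> g)" if x: "x \<in> A \<union> B" and g: "?nf g" for x g
  proof -
    obtain a r where ar: "a \<in> TA" "tail r" "g = a \<otimes> r" using g by blast
    from x show ?thesis
    proof
      assume "x \<in> A"
      then show ?thesis using normal_form_A[of x a r] ar TA_sub by blast
    next
      assume "x \<in> B"
      then show ?thesis using normal_form_B[of x a r] ar by blast
    qed
  qed
  have "?nf (x \<otimes> g)" if "x \<in> generate G (A \<union> B)" "g \<in> carrier G" "?nf g" for x g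
    using that
  proof (induction arbitrary: g rule: generate.induct)
    case one
    then show ?case by simp
  next
    case (incl h)
    then show ?case by (intro step)
  next
    case (inv h)
    then show ?case by (intro step) auto
  next
    case (eng h1 h2)
    then have h: "h1 \<in> carrier G" "h2 \<in> carrier G" using gen by simp_all
    then have "?nf (h1 \<otimes> (h2 \<otimes> g))" using eng by simp
    then show ?case using h eng.prems(1) by (simp add: m_assoc)
  qed
  from this[of g \<one>] have "?nf \<one> \<Longrightarrow> ?thesis" using gen assms by simp
  moreover have "\<exists>a \<in> TA. \<exists>r. tail r \<and> \<one> = a \<otimes> r"
    using amalgam_tail.last[OF TB_one H.one_closed, of G TA] TA_one
    by (intro bexI[of _ \<one>] exI[of _ "\<one> \<otimes> \<one>"] conjI) simp_all
  ultimately show ?thesis by blast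
qed

text \<open>Ping-pong reads off the first syllable: a tail lies outside \<open>D\<close>, and a
  non-trivial \<open>a\<close> moves it into \<open>D\<close>. As every element has a normal form,
  this decides membership in both directions, whatever the transversals.\<close>

lemma amalgam_Z_eq: "amalgam_Z G H TA TB = D"
proof (intro equalityI subsetI)
  fix g assume "g \<in> amalgam_Z G H TA TB"
  then obtain ps h where ps: "amalgam_normal_form G H TA TB g ps h" "fst (hd ps) \<noteq> \<one>"
    by (auto simp: amalgam_Z_def)
  obtain r where r: "tail r" "fst (hd ps) \<in> TA" "g = fst (hd ps) \<otimes> r"
    using amalgam_normal_form_tail[OF ps(1)] by blast
  have "fst (hd ps) \<in> A - H" by (rule left_transversal_notin[OF A H HA TA r(2) ps(2)])
  then show "g \<in> D"
    unfolding r(3) by (rule A_into) (use r(1) tail_notin_D tail_closed in blast)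
next
  fix g assume g: "g \<in> D"
  then have gc: "g \<in> carrier G" using D by auto
  then obtain a r where ar: "a \<in> TA" "tail r" "g = a \<otimes> r" using normal_form_exists by blast
  have "a \<noteq> \<one>" using tail_notin_D[OF ar(2)] tail_closed[OF ar(2)] g ar(3) by (metis l_one)
  then show "g \<in> amalgam_Z G H TA TB"
    using amalgam_tail_normal_form[OF ar(2,1)] ar(3) gc unfolding amalgam_Z_def by blast
qed

end

lemma determined_complement: "determined_set G (Amalgam A B H) (carrier G - D)"
proof -
  obtain TA TB where "left_transversal G A H TA" "left_transversal G B H TB"
    using left_transversal_exists A B H HA HB by metis
  then show ?thesis using amalgam_Z_eq unfolding determined_set.simps Let_def by blast
qed

end

section \<open>A ping-pong criterion for HNN extensions\<close>

text \<open>There are two ping-pong sets: \<open>D\<close>, meant for the elements that begin with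
  \<open>t\<close>, and \<open>{r. t \<otimes> r \<notin> D}\<close>, meant for those that begin
  with \<open>inv t\<close>; the latter is expressed through \<open>D\<close> because multiplication
  by \<open>t\<close> leads into \<open>D\<close> unless it cancels. \<open>A_notin\<close> and
  \<open>tA_in\<close> say that \<open>A\<close> meets neither set. The four assumptions before them
  say which elements of \<open>A\<close> carry each set off itself and off the other one.\<close>

locale hnn_pingpong = group G for G (structure) +
  fixes A H0 H1 :: "'a set" and t :: 'a and D :: "'a set"
  assumes A: "subgroup A G" and H0: "subgroup H0 G" and H1: "subgroup H1 G"
    and H0A: "H0 \<subseteq> A" and H1A: "H1 \<subseteq> A" and t [simp, intro]: "t \<in> carrier G"
    and conj_H0: "(\<lambda>h. inv t \<otimes> h \<otimes> t) ` H0 = H1"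
    and gen: "generate G (insert t A) = carrier G"
    and D: "D \<subseteq> carrier G"
    and out_H0: "r \<in> D \<Longrightarrow> a \<in> A - H0 \<Longrightarrow> a \<otimes> r \<notin> D"
    and out_A: "r \<in> carrier G \<Longrightarrow> t \<otimes> r \<notin> D \<Longrightarrow> a \<in> A \<Longrightarrow> a \<otimes> r \<notin> D"
    and into_H1: "r \<in> carrier G \<Longrightarrow> t \<otimes> r \<notin> D \<Longrightarrow> a \<in> A - H1 \<Longrightarrow> t \<otimes> (a \<otimes> r) \<in> D"
    and into_A: "r \<in> D \<Longrightarrow> a \<in> A \<Longrightarrow> t \<otimes> (a \<otimes> r) \<in> D"
    and A_notin: "a \<in> A \<Longrightarrow> a \<notin> D"
    and tA_in: "a \<in> A \<Longrightarrow> t \<otimes> a \<in> D"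
begin

sublocale A: subgroup A G by (rule A)
sublocale H0: subgroup H0 G by (rule H0)
sublocale H1: subgroup H1 G by (rule H1)

abbreviation (input) phi where "phi \<equiv> \<lambda>h. inv t \<otimes> h \<otimes> t"
abbreviation (input) letters :: "'a hnn_letter set" where
  "letters \<equiv> Base ` A \<union> {Stable, Stable_inv}"
abbreviation (input) rels where "rels \<equiv> hnn_relations (G\<lparr>carrier := A\<rparr>) H0 phi"
abbreviation (input) letter :: "'a hnn_letter \<Rightarrow> 'a" where
  "letter \<equiv> case_hnn_letter (\<lambda>a. a) t (inv t)"
abbreviation (input) cong_words where
  "cong_words \<equiv> word_congruent letters rels"

lemma A_carrier: "a \<in> A \<Longrightarrow> a \<in> carrier G"
  by (rule A.mem_carrier)

lemma letter_closed: "letter \<in> letters \<rightarrow> carrier G"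
  by auto

lemma phi_H1: "h \<in> H0 \<Longrightarrow> phi h \<in> H1"
  using conj_H0 by blast

lemma t_cancel [simp]:
  assumes "x \<in> carrier G"
  shows "t \<otimes> (inv t \<otimes> x) = x" "inv t \<otimes> (t \<otimes> x) = x"
  using assms by (simp_all flip: m_assoc)

lemma phi_swap:
  assumes "h \<in> carrier G" "r \<in> carrier G"
  shows "h \<otimes> (t \<otimes> r) = t \<otimes> (phi h \<otimes> r)" "phi h \<otimes> (inv t \<otimes> r) = inv t \<otimes> (h \<otimes> r)"
  using assms by (simp_all add: m_assoc)

lemma cong_rel: "(u, v) \<in> rels \<Longrightarrow> u \<in> lists letters \<Longrightarrow> v \<in> lists letters \<Longrightarrow> cong_words u v"
  using word_congruent.rel[of u v rels letters "[]" "[]"] by simp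

lemma cong_basic:
  "x \<in> A \<Longrightarrow> y \<in> A \<Longrightarrow> cong_words [Base x, Base y] [Base (x \<otimes> y)]"
  "cong_words [Base \<one>] []" "cong_words [Stable, Stable_inv] []" "cong_words [Stable_inv, Stable] []"
  "x \<in> H0 \<Longrightarrow> cong_words [Stable_inv, Base x, Stable] [Base (phi x)]"
  by ((rule cong_rel; use H0A H1A phi_H1 in \<open>auto simp: hnn_relations_def\<close>)+)

lemma cong_H1:
  assumes "h \<in> H0"
  shows "cong_words [Stable, Base (phi h), Stable_inv] [Base h]"
proof -
  have h: "h \<in> A" "phi h \<in> A" using assms H0A H1A phi_H1 by blast+
  have "cong_words ([Stable] @ [Stable_inv, Base h, Stable] @ [Stable_inv]) ([Stable] @ [Base (phi h)] @ [Stable_inv])"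
    using h by (intro word_congruent_context cong_basic(5) assms) auto
  moreover have "cong_words ([] @ [Stable, Stable_inv] @ [Base h, Stable, Stable_inv]) ([] @ [] @ [Base h, Stable, Stable_inv])"
    using h by (intro word_congruent_context cong_basic(3)) auto
  moreover have "cong_words ([Base h] @ [Stable, Stable_inv] @ []) ([Base h] @ [] @ [])"
    using h by (intro word_congruent_context cong_basic(3)) auto
  ultimately show ?thesis
    by simp (blast intro: word_congruent.trans word_congruent.sym)
qed

lemma rels_respected:
  assumes "(u, v) \<in> rels"
  shows "word_value G letter u = word_value G letter v"
proof -
  have "phi h \<in> carrier G" "h \<in> carrier G" if "h \<in> H0" for h
    using that by simp_all
  then show ?thesis
    using assms A.mem_carrier by (auto simp: hnn_relations_def word_value_def m_assoc)
qed

lemma cong_value: "cong_words u v \<Longrightarrow> word_value G letter u = word_value G letter v"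
  by (rule word_value_congruent[OF letter_closed rels_respected])

text \<open>Besides merging and cancellation these are the pinches of Britton's lemma. Those with
  \<open>H1\<close> are not among the defining relations; \<open>cong_H1\<close> derives
  them.\<close>

definition reducible :: "'a hnn_letter list set" where
  "reducible = {[Base a, Base b] | a b. True} \<union> {[Stable, Stable_inv], [Stable_inv, Stable]} \<union>
    {[Stable_inv, Base h, Stable] | h. h \<in> H0} \<union> {[Stable, Base h, Stable_inv] | h. h \<in> H1}"

definition reduced :: "'a hnn_letter list \<Rightarrow> bool" where
  "reduced w \<longleftrightarrow> (\<nexists>p u q. w = p @ u @ q \<and> u \<in> reducible)"

lemma reduced_ConsD: "reduced (x # w) \<Longrightarrow> reduced w"
  unfolding reduced_def by (metis append_Cons)

lemma reduced_reducible: "u \<in> reducible \<Longrightarrow> \<not> reduced (u @ q)"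
  unfolding reduced_def by (metis append_Nil)

lemma not_reduced:
  "\<not> reduced (Base a # Base b # w)"
  "\<not> reduced (Stable # Stable_inv # w)" "\<not> reduced (Stable_inv # Stable # w)"
  "h \<in> H0 \<Longrightarrow> \<not> reduced (Stable_inv # Base h # Stable # w)"
  "h \<in> H1 \<Longrightarrow> \<not> reduced (Stable # Base h # Stable_inv # w)"
  using reduced_reducible[of "[_, _]" w] reduced_reducible[of "[_, _, _]" w]
  by (auto simp: reducible_def)

lemma shorten:
  assumes "u \<in> reducible" "u \<in> lists letters"
  shows "\<exists>v \<in> lists letters. length v < length u \<and> cong_words u v"
proof -
  from assms(1) consider a b where "u = [Base a, Base b]" | "u = [Stable, Stable_inv]"
    | "u = [Stable_inv, Stable]" | h where "u = [Stable_inv, Base h, Stable]" "h \<in> H0"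
    | h where "u = [Stable, Base h, Stable_inv]" "h \<in> H1"
    unfolding reducible_def by blast
  then show ?thesis
  proof cases
    case (1 a b)
    then show ?thesis using assms(2) cong_basic(1)[of a b] by (intro bexI[of _ "[Base (a \<otimes> b)]"]) auto
  next
    case 2
    then show ?thesis using cong_basic(3) by (intro bexI[of _ "[]"]) auto
  next
    case 3
    then show ?thesis using cong_basic(4) by (intro bexI[of _ "[]"]) auto
  next
    case (4 h)
    then have "phi h \<in> A" using phi_H1 H1A by blast
    then show ?thesis using 4 cong_basic(5)[of h] by (intro bexI[of _ "[Base (phi h)]"]) auto
  next
    case (5 k)
    then obtain h where h: "h \<in> H0" "k = phi h" using conj_H0 by blast
    then have "h \<in> A" using H0A by blast
    then show ?thesis using 5 h cong_H1[of h] by (intro bexI[of _ "[Base h]"]) auto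
  qed
qed

text \<open>Britton's lemma by ping-pong: a leading \<open>t\<close> puts the value into
  \<open>D\<close>, a leading \<open>inv t\<close> into the second ping-pong set. The latter is
  stated for the rest \<open>v\<close>, because the defining multiplication by \<open>t\<close>
  cancels \<open>inv t\<close>. The induction looks past at most one base letter to the next stable
  letter.\<close>

lemma reduced_value:
  assumes "w \<in> lists letters" "reduced w"
  shows "(\<forall>v. w = Stable # v \<longrightarrow> word_value G letter w \<in> D) \<and>
    (\<forall>v. w = Stable_inv # v \<longrightarrow> word_value G letter v \<notin> D)"
  using assms
proof (induction "length w" arbitrary: w rule: less_induct)
  case less
  have vc: "word_value G letter v \<in> carrier G" if "v \<in> lists letters" for v
    by (rule word_value_closed[OF letter_closed that])
  have val: "word_value G letter (Stable # v) = t \<otimes> word_value G letter v"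
    "word_value G letter (Stable_inv # v) = inv t \<otimes> word_value G letter v"
    "word_value G letter (Base a # v) = a \<otimes> word_value G letter v" for v a
    by (simp_all add: word_value_Cons)
  have tv: "t \<otimes> word_value G letter (Stable_inv # v) = word_value G letter v" if "v \<in> lists letters" for v
    using vc[OF that] by (simp add: val flip: m_assoc)
  have unit: "\<one> \<otimes> word_value G letter v = word_value G letter v" if "v \<in> lists letters" for v
    using vc[OF that] by simp
  have IH_S: "word_value G letter (Stable # v) \<in> D"
    if "length (Stable # v) < length w" "Stable # v \<in> lists letters" "reduced (Stable # v)" for v
    using less.hyps[OF that] by blast
  have IH_I: "t \<otimes> word_value G letter (Stable_inv # v) \<notin> D"
    if "length (Stable_inv # v) < length w" "Stable_inv # v \<in> lists letters" "reduced (Stable_inv # v)" for v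
    using less.hyps[OF that] tv that by auto
  show ?case
  proof (intro conjI allI impI)
    fix v assume w: "w = Stable # v"
    have v: "v \<in> lists letters" "reduced v" using less.prems w reduced_ConsD by auto
    have "t \<otimes> word_value G letter v \<in> D"
    proof (cases v)
      case Nil
      then show ?thesis using tA_in[of \<one>] by (simp add: word_value_Nil)
    next
      case (Cons x v')
      show ?thesis
      proof (cases x)
        case Stable
        have "word_value G letter v \<in> D" unfolding Cons Stable
          by (rule IH_S) (use v w Cons Stable in auto)
        then show ?thesis using into_A[of _ \<one>] unit[OF v(1)] A.one_closed by metis
      next
        case Stable_inv
        then show ?thesis using less.prems(2) w Cons not_reduced(2) by blast
      next
        case (Base a)
        have a: "a \<in> A" "v' \<in> lists letters" "reduced v'"
          using v Cons Base reduced_ConsD by auto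
        show ?thesis
        proof (cases v')
          case Nil
          then show ?thesis using tA_in[OF a(1)] a(1) Cons Base by (simp add: word_value_Nil val)
        next
          case (Cons y v'')
          show ?thesis
          proof (cases y)
            case (Base b)
            then show ?thesis using v(2) \<open>v = x # v'\<close> \<open>x = Base a\<close> Cons not_reduced(1) by blast
          next
            case Stable
            have "word_value G letter v' \<in> D" unfolding Cons Stable
              by (rule IH_S) (use a w \<open>v = x # v'\<close> Cons Stable in auto)
            then show ?thesis using into_A[OF _ a(1)] \<open>v = x # v'\<close> \<open>x = Base a\<close> val(3) by simp
          next
            case Stable_inv
            then have "a \<notin> H1"
              using less.prems(2) w \<open>v = x # v'\<close> \<open>x = Base a\<close> Cons not_reduced(5) by blast
            moreover have "t \<otimes> word_value G letter v' \<notin> D" unfolding Cons Stable_inv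
              by (rule IH_I) (use a w \<open>v = x # v'\<close> Cons Stable_inv in auto)
            ultimately show ?thesis
              using into_H1[OF vc[OF a(2)]] a(1) \<open>v = x # v'\<close> \<open>x = Base a\<close> val(3) by simp
          qed
        qed
      qed
    qed
    then show "word_value G letter w \<in> D" using w val(1) by simp
  next
    fix v assume w: "w = Stable_inv # v"
    have v: "v \<in> lists letters" "reduced v" using less.prems w reduced_ConsD by auto
    show "word_value G letter v \<notin> D"
    proof (cases v)
      case Nil
      then show ?thesis using A_notin[of \<one>] by (simp add: word_value_Nil)
    next
      case (Cons x v')
      show ?thesis
      proof (cases x)
        case Stable_inv
        have "t \<otimes> word_value G letter v \<notin> D" unfolding Cons Stable_inv
          by (rule IH_I) (use v w Cons Stable_inv in auto)
        then show ?thesis using out_A[OF vc[OF v(1)], of \<one>] unit[OF v(1)] A.one_closed by metis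
      next
        case Stable
        then show ?thesis using less.prems(2) w Cons not_reduced(3) by blast
      next
        case (Base a)
        have a: "a \<in> A" "v' \<in> lists letters" "reduced v'"
          using v Cons Base reduced_ConsD by auto
        show ?thesis
        proof (cases v')
          case Nil
          then show ?thesis using A_notin[OF a(1)] a(1) Cons Base by (simp add: word_value_Nil val)
        next
          case (Cons y v'')
          show ?thesis
          proof (cases y)
            case (Base b)
            then show ?thesis using v(2) \<open>v = x # v'\<close> \<open>x = Base a\<close> Cons not_reduced(1) by blast
          next
            case Stable
            then have "a \<notin> H0"
              using less.prems(2) w \<open>v = x # v'\<close> \<open>x = Base a\<close> Cons not_reduced(4) by blast
            moreover have "word_value G letter v' \<in> D" unfolding Cons Stable
              by (rule IH_S) (use a w \<open>v = x # v'\<close> Cons Stable in auto)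
            ultimately show ?thesis using out_H0 a(1) \<open>v = x # v'\<close> \<open>x = Base a\<close> val(3) by simp
          next
            case Stable_inv
            have "t \<otimes> word_value G letter v' \<notin> D" unfolding Cons Stable_inv
              by (rule IH_I) (use a w \<open>v = x # v'\<close> Cons Stable_inv in auto)
            then show ?thesis
              using out_A[OF vc[OF a(2)]] a(1) \<open>v = x # v'\<close> \<open>x = Base a\<close> val(3) by simp
          qed
        qed
      qed
    qed
  qed
qed

text \<open>In a reduced word of value \<open>\<one>\<close> a leading base letter \<open>a\<close>
  forces the rest to have value \<open>inv a\<close>. If the rest is not empty, it begins with a
  stable letter, so its value lies in one of the two ping-pong sets, which avoid \<open>A\<close>. A
  leading stable letter is excluded likewise, as \<open>\<one>\<close> is in
  \<open>A\<close>.\<close>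

lemma word_kernel:
  assumes "w \<in> lists letters" "word_value G letter w = \<one>"
  shows "cong_words w []"
  using assms
proof (induction "length w" arbitrary: w rule: less_induct)
  case less
  have vc: "word_value G letter v \<in> carrier G" if "v \<in> lists letters" for v
    by (rule word_value_closed[OF letter_closed that])
  show ?case
  proof (cases "reduced w")
    case False
    then obtain p u q where w: "w = p @ u @ q" "u \<in> reducible" unfolding reduced_def by blast
    have l: "p \<in> lists letters" "u \<in> lists letters" "q \<in> lists letters" using less.prems(1) w by auto
    obtain v where v: "v \<in> lists letters" "length v < length u" "cong_words u v"
      using shorten[OF w(2) l(2)] by blast
    have c: "cong_words w (p @ v @ q)"
      unfolding w by (rule word_congruent_context[OF v(3) l(1,3)])
    moreover have "cong_words (p @ v @ q) []"
      by (rule less.hyps) (use w v l less.prems(2) cong_value[OF c] in auto)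
    ultimately show ?thesis by (rule word_congruent.trans)
  next
    case True
    note val = reduced_value[OF less.prems(1) True]
    show ?thesis
    proof (cases w)
      case Nil
      then show ?thesis by (auto intro: word_congruent.refl)
    next
      case (Cons x v)
      have v: "v \<in> lists letters" "reduced v" using less.prems Cons True reduced_ConsD by auto
      note rc = vc[OF v(1)]
      have one: "letter x \<otimes> word_value G letter v = \<one>"
        using less.prems(2) Cons by (simp add: word_value_Cons)
      show ?thesis
      proof (cases x)
        case Stable
        then show ?thesis using val Cons less.prems(2) A_notin[OF A.one_closed] by simp
      next
        case Stable_inv
        then have "word_value G letter v = t" using one rc inv_solve_left'[of \<one> t "word_value G letter v"] by simp
        then show ?thesis using val Cons Stable_inv tA_in[OF A.one_closed] by simp
      next
        case (Base a)
        have a: "a \<in> A" using less.prems(1) Cons Base by auto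
        have "inv (word_value G letter v) = a"
          by (rule inv_equality) (use one Base rc a in simp_all)
        then have ar: "word_value G letter v = inv a" using rc by auto
        show ?thesis
        proof (cases v)
          case Nil
          then have "a = \<one>" using one Base a by (simp add: word_value_Nil)
          then show ?thesis using Cons Base Nil cong_basic(2) by simp
        next
          case (Cons y v')
          show ?thesis
          proof (cases y)
            case (Base b)
            then show ?thesis using True \<open>w = x # v\<close> \<open>x = Base a\<close> Cons not_reduced(1) by blast
          next
            case Stable
            then have "word_value G letter v \<in> D" using reduced_value[OF v] Cons by blast
            then show ?thesis using ar A_notin a by simp
          next
            case Stable_inv
            then have "word_value G letter v' \<notin> D" using reduced_value[OF v] Cons by blast
            moreover have "word_value G letter v' = t \<otimes> inv a"
              using ar Cons Stable_inv v(1) vc[of v'] a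
              by (simp add: word_value_Cons inv_solve_left')
            ultimately show ?thesis using tA_in[of "inv a"] a by simp
          qed
        qed
      qed
    qed
  qed
qed

lemma word_surj:
  assumes "g \<in> carrier G"
  shows "\<exists>w \<in> lists letters. word_value G letter w = g"
proof -
  have single: "\<exists>w \<in> lists letters. word_value G letter w = letter l" if "l \<in> letters" for l
    using that A_carrier by (intro bexI[of _ "[l]"]) (auto simp: word_value_def)
  have "g \<in> generate G (insert t A)" using gen assms by simp
  then show ?thesis
  proof (induction rule: generate.induct)
    case one
    then show ?case by (intro bexI[of _ "[]"]) (auto simp: word_value_def)
  next
    case (incl h)
    then show ?case using single[of Stable] single[of "Base h"] by auto
  next
    case (inv h)
    then show ?case using single[of Stable_inv] single[of "Base (inv h)"] by auto
  next
    case (eng h1 h2)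
    then obtain u v where "u \<in> lists letters" "v \<in> lists letters" "word_value G letter u = h1"
      "word_value G letter v = h2" by blast
    then show ?case
      using word_value_append[OF letter_closed] by (intro bexI[of _ "u @ v"]) auto
  qed
qed

lemma splitting: "splitting_over G H0 (HNN A H0 H1 t)"
proof -
  have "induced_map G letter \<in> iso (presented_monoid letters rels) G"
  proof (rule induced_map_iso[OF letter_closed])
    fix l assume l: "l \<in> letters"
    show "\<exists>w \<in> lists letters. cong_words (l # w) [] \<and> cong_words (w @ [l]) []"
    proof (cases l)
      case (Base a)
      then have a: "a \<in> A" using l by auto
      have "cong_words [Base a, Base (inv a)] []" "cong_words [Base (inv a), Base a] []"
        using cong_basic(1)[of a "inv a"] cong_basic(1)[of "inv a" a] cong_basic(2) a
        by (auto intro: word_congruent.trans)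
      then show ?thesis using a Base by (intro bexI[of _ "[Base (inv a)]"]) auto
    next
      case Stable
      then show ?thesis using cong_basic(3,4) by (intro bexI[of _ "[Stable_inv]"]) auto
    next
      case Stable_inv
      then show ?thesis using cong_basic(3,4) by (intro bexI[of _ "[Stable]"]) auto
    qed
  qed (blast intro: rels_respected word_surj word_kernel)+
  then have "induced_map G letter \<in> iso (hnn_extension (G\<lparr>carrier := A\<rparr>) H0 phi) G"
    by (simp add: hnn_extension_def)
  then show ?thesis
    unfolding splitting_over.simps using A H0 H1 H0A H1A t conj_H0 by blast
qed

end

text \<open>The last argument records the first pair, or \<open>None\<close> for an element of
  \<open>A\<close>. The condition on sign changes needs to know no more of the remainder, and so
  normal forms can be treated by rule induction instead of list indices.\<close>

inductive hnn_nf :: "('a, 'm) monoid_scheme \<Rightarrow> 'a set \<Rightarrow> 'a \<Rightarrow> 'a set \<Rightarrow> 'a set \<Rightarrow> 'a \<Rightarrow> ('a \<times> int) option \<Rightarrow> bool"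
  for G (structure) and A t T1 T2 where
  base: "c \<in> A \<Longrightarrow> hnn_nf G A t T1 T2 c None"
| pos: "a \<in> T1 \<Longrightarrow> hnn_nf G A t T1 T2 r s \<Longrightarrow> (\<And>a'. s = Some (a', -1) \<Longrightarrow> a' \<noteq> \<one>) \<Longrightarrow>
    hnn_nf G A t T1 T2 (a \<otimes> (t \<otimes> r)) (Some (a, 1))"
| neg: "a \<in> T2 \<Longrightarrow> hnn_nf G A t T1 T2 r s \<Longrightarrow> (\<And>a'. s = Some (a', 1) \<Longrightarrow> a' \<noteq> \<one>) \<Longrightarrow>
    hnn_nf G A t T1 T2 (a \<otimes> (inv t \<otimes> r)) (Some (a, -1))"

definition list_head :: "'b list \<Rightarrow> 'b option" where
  "list_head xs = (case xs of [] \<Rightarrow> None | x # _ \<Rightarrow> Some x)"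

lemma hnn_normal_form_Cons:
  "hnn_normal_form G A t T1 T2 g ((a, e) # es) c \<longleftrightarrow>
     (a, e) \<in> T1 \<times> {1} \<union> T2 \<times> {-1} \<and>
     (\<forall>a' e'. list_head es = Some (a', e') \<longrightarrow> e \<noteq> e' \<longrightarrow> a' \<noteq> \<one>\<^bsub>G\<^esub>) \<and>
     (\<exists>r. hnn_normal_form G A t T1 T2 r es c \<and> g = a \<otimes>\<^bsub>G\<^esub> ((t [^]\<^bsub>G\<^esub> e) \<otimes>\<^bsub>G\<^esub> r))"
proof -
  have "(\<forall>i. Suc i < length ((a, e) # es) \<longrightarrow> snd (((a, e) # es) ! i) \<noteq> snd (((a, e) # es) ! Suc i) \<longrightarrow>
            fst (((a, e) # es) ! Suc i) \<noteq> \<one>\<^bsub>G\<^esub>) \<longleftrightarrow>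
    (\<forall>a' e'. list_head es = Some (a', e') \<longrightarrow> e \<noteq> e' \<longrightarrow> a' \<noteq> \<one>\<^bsub>G\<^esub>) \<and>
    (\<forall>i. Suc i < length es \<longrightarrow> snd (es ! i) \<noteq> snd (es ! Suc i) \<longrightarrow> fst (es ! Suc i) \<noteq> \<one>\<^bsub>G\<^esub>)"
    (is "?L \<longleftrightarrow> ?R1 \<and> ?R2")
  proof
    assume L: ?L
    show "?R1 \<and> ?R2"
      using L[THEN spec, of 0] L[THEN spec, of "Suc i" for i]
      by (cases es) (auto simp: list_head_def)
  next
    assume R: "?R1 \<and> ?R2"
    show ?L
    proof (intro allI)
      fix i
      show "Suc i < length ((a, e) # es) \<longrightarrow> snd (((a, e) # es) ! i) \<noteq> snd (((a, e) # es) ! Suc i) \<longrightarrow>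
            fst (((a, e) # es) ! Suc i) \<noteq> \<one>\<^bsub>G\<^esub>"
        using R by (cases i; cases es) (auto simp: list_head_def)
    qed
  qed
  then show ?thesis by (auto simp: hnn_normal_form_def)
qed

section \<open>Normal forms in HNN extensions\<close>

context hnn_pingpong
begin

context
  fixes T1 T2 :: "'a set"
  assumes T1: "left_transversal G A H0 T1" and T2: "left_transversal G A H1 T2"
begin

abbreviation (input) nf where "nf \<equiv> hnn_nf G A t T1 T2"

lemma T_sub: "a \<in> T1 \<Longrightarrow> a \<in> A" "a \<in> T2 \<Longrightarrow> a \<in> A"
  and T_one: "\<one> \<in> T1" "\<one> \<in> T2"
  using T1 T2 by (auto simp: left_transversal_def)

lemma T_carrier [simp]: "a \<in> T1 \<Longrightarrow> a \<in> carrier G" "a \<in> T2 \<Longrightarrow> a \<in> carrier G"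
  by (simp_all add: T_sub)

lemma nf_iff: "nf g s \<longleftrightarrow> (\<exists>es c. hnn_normal_form G A t T1 T2 g es c \<and> list_head es = s)"
proof
  have pow: "t [^] (1::int) = t" "t [^] (-1::int) = inv t"
    by (simp_all add: int_pow_neg)
  assume "nf g s"
  then show "\<exists>es c. hnn_normal_form G A t T1 T2 g es c \<and> list_head es = s"
  proof (induction rule: hnn_nf.induct)
    case (base c)
    then show ?case
      by (intro exI[of _ "[]"] exI[of _ c]) (simp add: hnn_normal_form_def list_head_def)
  next
    case (pos a r s)
    then obtain es c where "hnn_normal_form G A t T1 T2 r es c" "list_head es = s" by blast
    with pos have "hnn_normal_form G A t T1 T2 (a \<otimes> (t \<otimes> r)) ((a, 1) # es) c"
      using T_sub by (auto simp: hnn_normal_form_Cons pow) (auto simp: hnn_normal_form_def list_head_def split: list.splits)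
    then show ?case by (intro exI[of _ "(a, 1) # es"] exI[of _ c]) (simp add: list_head_def)
  next
    case (neg a r s)
    then obtain es c where "hnn_normal_form G A t T1 T2 r es c" "list_head es = s" by blast
    with neg have "hnn_normal_form G A t T1 T2 (a \<otimes> (inv t \<otimes> r)) ((a, -1) # es) c"
      using T_sub by (auto simp: hnn_normal_form_Cons pow) (auto simp: hnn_normal_form_def list_head_def split: list.splits)
    then show ?case by (intro exI[of _ "(a, -1) # es"] exI[of _ c]) (simp add: list_head_def)
  qed
next
  have pow: "t [^] (1::int) = t" "t [^] (-1::int) = inv t"
    by (simp_all add: int_pow_neg)
  assume "\<exists>es c. hnn_normal_form G A t T1 T2 g es c \<and> list_head es = s"
  then obtain es c where "hnn_normal_form G A t T1 T2 g es c" "list_head es = s" by blast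
  then show "nf g s"
  proof (induction es arbitrary: g s)
    case Nil
    then show ?case by (auto simp: hnn_normal_form_def list_head_def intro: hnn_nf.base)
  next
    case (Cons x es)
    obtain a e where x: "x = (a, e)" by fastforce
    from Cons.prems(1) obtain r where r: "hnn_normal_form G A t T1 T2 r es c"
      "g = a \<otimes> ((t [^] e) \<otimes> r)" "(a, e) \<in> T1 \<times> {1} \<union> T2 \<times> {-1}"
      "\<And>a' e'. list_head es = Some (a', e') \<Longrightarrow> e \<noteq> e' \<Longrightarrow> a' \<noteq> \<one>"
      unfolding x hnn_normal_form_Cons by blast
    have s: "s = Some (a, e)" using Cons.prems(2) x by (simp add: list_head_def)
    note nf = Cons.IH[OF r(1) HOL.refl]
    from r(3) consider "a \<in> T1" "e = 1" | "a \<in> T2" "e = -1" by auto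
    then show ?case
    proof cases
      case 1
      then show ?thesis unfolding s r(2)
        using hnn_nf.pos[OF 1(1) nf] r(4)[of _ "-1"] pow by simp
    next
      case 2
      then show ?thesis unfolding s r(2)
        using hnn_nf.neg[OF 2(1) nf] r(4)[of _ "1"] pow by simp
    qed
  qed
qed

lemma nf_closed: "nf g s \<Longrightarrow> g \<in> carrier G"
  by (induction rule: hnn_nf.induct) simp_all

text \<open>Behind the first transversal element, the remainder lies in \<open>D\<close> or in
  \<open>{r. t \<otimes> r \<notin> D}\<close>, according to the first sign. At a sign change the
  transversal element is non-trivial, hence outside the associated subgroup, which is what
  \<open>into_H1\<close> and \<open>out_H0\<close> ask for.\<close>

lemma nf_D: "nf g s \<Longrightarrow>
    (\<forall>a. s = Some (a, 1) \<longrightarrow> (\<exists>r \<in> D. a \<in> T1 \<and> g = a \<otimes> r)) \<and>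
    (\<forall>a. s = Some (a, -1) \<longrightarrow> (\<exists>r \<in> carrier G. t \<otimes> r \<notin> D \<and> a \<in> T2 \<and> g = a \<otimes> r)) \<and>
    (s = None \<longrightarrow> g \<in> A) \<and> (s = None \<or> (\<exists>a. s = Some (a, 1)) \<or> (\<exists>a. s = Some (a, -1)))"
proof (induction rule: hnn_nf.induct)
  case (base c)
  then show ?case by simp
next
  case (pos a r s)
  have "t \<otimes> r \<in> D"
  proof -
    consider "s = None" | a' where "s = Some (a', 1)" | a' where "s = Some (a', -1)"
      using pos.IH by blast
    then show ?thesis
    proof cases
      case 1
      then show ?thesis using pos.IH tA_in by blast
    next
      case (2 a')
      then show ?thesis using pos.IH into_A T_sub by blast
    next
      case (3 a')
      then have "a' \<in> T2" "a' \<noteq> \<one>" using pos by blast+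
      then have "a' \<in> A - H1" by (rule left_transversal_notin[OF A H1 H1A T2])
      then show ?thesis using 3 pos.IH into_H1 by blast
    qed
  qed
  then show ?case using pos(1) by auto
next
  case (neg a r s)
  note rc = nf_closed[OF neg(2)]
  have "r \<notin> D"
  proof -
    consider "s = None" | a' where "s = Some (a', 1)" | a' where "s = Some (a', -1)"
      using neg.IH by blast
    then show ?thesis
    proof cases
      case 1
      then show ?thesis using neg.IH A_notin by blast
    next
      case (2 a')
      then have "a' \<in> T1" "a' \<noteq> \<one>" using neg by blast+
      then have "a' \<in> A - H0" by (rule left_transversal_notin[OF A H0 H0A T1])
      then show ?thesis using 2 neg.IH out_H0 by blast
    next
      case (3 a')
      then show ?thesis using neg.IH out_A T_sub by blast
    qed
  qed
  then have "\<exists>r' \<in> carrier G. t \<otimes> r' \<notin> D \<and> a \<otimes> (inv t \<otimes> r) = a \<otimes> r'"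
    using rc by (intro bexI[of _ "inv t \<otimes> r"]) simp_all
  then show ?case using neg(1) by simp
qed

lemma decompose:
  "x \<in> A \<Longrightarrow> \<exists>a k. a \<in> T1 \<and> k \<in> H0 \<and> x = a \<otimes> k \<and> (a = \<one> \<longleftrightarrow> x \<in> H0)"
  "x \<in> A \<Longrightarrow> \<exists>a k. a \<in> T2 \<and> k \<in> H1 \<and> x = a \<otimes> k \<and> (a = \<one> \<longleftrightarrow> x \<in> H1)"
   by (rule left_transversal_decompose[OF A H0 H0A T1], assumption, blast)
     (rule left_transversal_decompose[OF A H1 H1A T2], assumption, blast)

lemma absorb:
  assumes "subgroup K G" "h \<in> K" "a \<in> carrier G"
  shows "h \<otimes> a \<in> K \<longleftrightarrow> a \<in> K"
proof -
  interpret K: subgroup K G by fact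
  have "inv h \<otimes> (h \<otimes> a) = a" using assms by (simp flip: m_assoc)
  then show ?thesis using assms by (metis K.m_closed K.m_inv_closed)
qed

text \<open>An element of \<open>A\<close> changes no sign: \<open>x a = a' h\<close> with
  \<open>h\<close> in an associated subgroup, and \<open>h\<close> crosses the stable letter and is
  pushed into the remainder. The statement tracks when the first transversal element becomes
  trivial, since the sign condition one level up depends on it.\<close>

lemma nf_push:
  assumes "nf r s" "x \<in> A"
  shows "\<exists>s'. nf (x \<otimes> r) s' \<and> (s = None \<longrightarrow> s' = None) \<and>
    (\<forall>a e. s = Some (a, e) \<longrightarrow>
      (\<exists>a'. s' = Some (a', e) \<and> (a' = \<one> \<longleftrightarrow> x \<otimes> a \<in> (if e = 1 then H0 else H1))))"
  using assms
proof (induction arbitrary: x rule: hnn_nf.induct)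
  case (base c)
  then have "nf (x \<otimes> c) None" by (intro hnn_nf.base) simp
  then show ?case by (intro exI[of _ None]) simp
next
  case (pos a r s)
  have "x \<otimes> a \<in> A" using pos T_sub by simp
  then obtain a' h where a': "a' \<in> T1" "h \<in> H0" "x \<otimes> a = a' \<otimes> h" "a' = \<one> \<longleftrightarrow> x \<otimes> a \<in> H0"
    using decompose(1) by blast
  have ph: "phi h \<in> H1" "phi h \<in> A" using phi_H1[OF a'(2)] H1A by blast+
  obtain s' where s': "nf (phi h \<otimes> r) s'" "s = None \<Longrightarrow> s' = None"
    "\<And>a e. s = Some (a, e) \<Longrightarrow> \<exists>a'. s' = Some (a', e) \<and> (a' = \<one> \<longleftrightarrow> phi h \<otimes> a \<in> (if e = 1 then H0 else H1))"
    using pos.IH[OF ph(2)] by blast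
  have rc: "r \<in> carrier G" using nf_closed pos by blast
  have "x \<otimes> (a \<otimes> (t \<otimes> r)) = a' \<otimes> (h \<otimes> (t \<otimes> r))"
    using a'(3) by (rule mult_shift) (use pos rc a' in simp_all)
  also have "h \<otimes> (t \<otimes> r) = t \<otimes> (phi h \<otimes> r)"
    using a'(2) rc by (intro phi_swap) simp_all
  finally have eq: "x \<otimes> (a \<otimes> (t \<otimes> r)) = a' \<otimes> (t \<otimes> (phi h \<otimes> r))" .
  have "b \<noteq> \<one>" if b: "s' = Some (b, -1)" for b
  proof -
    obtain a2 e where s: "s = Some (a2, e)" using s'(2) b by (cases s) auto
    then have e: "e = -1" "b = \<one> \<longleftrightarrow> phi h \<otimes> a2 \<in> H1" using s'(3)[OF s] b by auto
    then have "a2 \<in> T2" using nf_D[OF pos(2)] s by blast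
    moreover have "a2 \<noteq> \<one>" using pos(3) s e by blast
    ultimately have "a2 \<in> A - H1" by (rule left_transversal_notin[OF A H1 H1A T2])
    then show ?thesis using e(2) absorb[OF H1 ph(1)] by simp
  qed
  then have "nf (a' \<otimes> (t \<otimes> (phi h \<otimes> r))) (Some (a', 1))"
    by (intro hnn_nf.pos[OF a'(1) s'(1)])
  then show ?case unfolding eq using a'(4) by (intro exI[of _ "Some (a', 1)"]) simp
next
  case (neg a r s)
  have "x \<otimes> a \<in> A" using neg T_sub by simp
  then obtain a' k where a': "a' \<in> T2" "k \<in> H1" "x \<otimes> a = a' \<otimes> k" "a' = \<one> \<longleftrightarrow> x \<otimes> a \<in> H1"
    using decompose(2) by blast
  obtain h where h: "h \<in> H0" "k = phi h" using a'(2) conj_H0 by blast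
  then have hA: "h \<in> A" using H0A by blast
  obtain s' where s': "nf (h \<otimes> r) s'" "s = None \<Longrightarrow> s' = None"
    "\<And>a e. s = Some (a, e) \<Longrightarrow> \<exists>a'. s' = Some (a', e) \<and> (a' = \<one> \<longleftrightarrow> h \<otimes> a \<in> (if e = 1 then H0 else H1))"
    using neg.IH[OF hA] by blast
  have rc: "r \<in> carrier G" using nf_closed neg by blast
  have "x \<otimes> (a \<otimes> (inv t \<otimes> r)) = a' \<otimes> (k \<otimes> (inv t \<otimes> r))"
    using a'(3) by (rule mult_shift) (use neg rc a' in simp_all)
  also have "k \<otimes> (inv t \<otimes> r) = inv t \<otimes> (h \<otimes> r)"
    unfolding h(2) using h(1) rc by (intro phi_swap) simp_all
  finally have eq: "x \<otimes> (a \<otimes> (inv t \<otimes> r)) = a' \<otimes> (inv t \<otimes> (h \<otimes> r))" .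
  have "b \<noteq> \<one>" if b: "s' = Some (b, 1)" for b
  proof -
    obtain a2 e where s: "s = Some (a2, e)" using s'(2) b by (cases s) auto
    then have e: "e = 1" "b = \<one> \<longleftrightarrow> h \<otimes> a2 \<in> H0" using s'(3)[OF s] b by auto
    then have "a2 \<in> T1" using nf_D[OF neg(2)] s by blast
    moreover have "a2 \<noteq> \<one>" using neg(3) s e by blast
    ultimately have "a2 \<in> A - H0" by (rule left_transversal_notin[OF A H0 H0A T1])
    then show ?thesis using e(2) absorb[OF H0 h(1)] by simp
  qed
  then have "nf (a' \<otimes> (inv t \<otimes> (h \<otimes> r))) (Some (a', -1))"
    by (intro hnn_nf.neg[OF a'(1) s'(1)])
  then show ?case unfolding eq using a'(4) by (intro exI[of _ "Some (a', -1)"]) simp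
qed

text \<open>There is cancellation if the normal form begins with \<open>\<one>\<close> and exponent
  -1; otherwise \<open>t\<close> becomes a new first syllable.\<close>

lemma nf_t:
  assumes "nf r s"
  shows "\<exists>s'. nf (t \<otimes> r) s'"
proof (cases "s = Some (\<one>, -1)")
  case True
  from assms show ?thesis
  proof cases
    case (neg a r' s')
    have "r' \<in> carrier G" using nf_closed neg by blast
    moreover have "a = \<one>" using True neg by simp
    ultimately have "t \<otimes> r = r'" unfolding neg(1) by simp
    then show ?thesis using neg by blast
  qed (use True in simp_all)
next
  case False
  have "nf (\<one> \<otimes> (t \<otimes> r)) (Some (\<one>, 1))"
    by (rule hnn_nf.pos[OF T_one(1) assms]) (use False in blast)
  then show ?thesis using nf_closed[OF assms] by auto
qed

lemma nf_inv_t: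
  assumes "nf r s"
  shows "\<exists>s'. nf (inv t \<otimes> r) s'"
proof (cases "s = Some (\<one>, 1)")
  case True
  from assms show ?thesis
  proof cases
    case (pos a r' s')
    have "r' \<in> carrier G" using nf_closed pos by blast
    moreover have "a = \<one>" using True pos by simp
    ultimately have "inv t \<otimes> r = r'" unfolding pos(1) by simp
    then show ?thesis using pos by blast
  qed (use True in simp_all)
next
  case False
  have "nf (\<one> \<otimes> (inv t \<otimes> r)) (Some (\<one>, -1))"
    by (rule hnn_nf.neg[OF T_one(2) assms]) (use False in blast)
  then show ?thesis using nf_closed[OF assms] by auto
qed

lemma nf_exists:
  assumes "g \<in> carrier G"
  shows "\<exists>s. nf g s"
proof -
  have "\<exists>s. nf (x \<otimes> g) s" if "x \<in> generate G (insert t A)" "g \<in> carrier G" "\<exists>s. nf g s" for x g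
    using that
  proof (induction arbitrary: g rule: generate.induct)
    case one
    then show ?case by simp
  next
    case (incl h)
    then obtain s where s: "nf g s" by blast
    show ?case using incl(1) nf_t[OF s] nf_push[OF s, of h] by auto
  next
    case (inv h)
    then obtain s where s: "nf g s" by blast
    show ?case using inv(1) nf_inv_t[OF s] nf_push[OF s, of "inv h"] by auto
  next
    case (eng h1 h2)
    then have h: "h1 \<in> carrier G" "h2 \<in> carrier G" using gen by simp_all
    then have "\<exists>s. nf (h1 \<otimes> (h2 \<otimes> g)) s" using eng by simp
    then show ?case using h eng.prems(1) by (simp add: m_assoc)
  qed
  moreover have "nf \<one> None" by (rule hnn_nf.base[OF A.one_closed])
  ultimately have "\<exists>s. nf (g \<otimes> \<one>) s" using gen assms by (metis one_closed)
  then show ?thesis using assms by simp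
qed

text \<open>Only the head \<open>(\<one>, 1)\<close> puts an element into \<open>D\<close>: a
  non-trivial element of \<open>T1\<close> moves \<open>D\<close> off itself, and elements with
  exponent -1 at the head, or with no head at all, lie outside \<open>D\<close>.\<close>

lemma hnn_Z_eq: "hnn_Z G A t T1 T2 = D"
proof -
  have Z: "hnn_Z G A t T1 T2 = {g \<in> carrier G. nf g (Some (\<one>, 1))}"
  proof -
    have "list_head es = Some (\<one>, 1::int) \<longleftrightarrow> es \<noteq> [] \<and> fst (hd es) = \<one> \<and> snd (hd es) = 1" for es
      by (cases es) (auto simp: list_head_def)
    then show ?thesis unfolding hnn_Z_def nf_iff by simp
  qed
  show ?thesis
  proof (intro equalityI subsetI)
    fix g assume "g \<in> hnn_Z G A t T1 T2"
    then have "nf g (Some (\<one>, 1))" using Z by blast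
    then obtain r where "r \<in> D" "g = \<one> \<otimes> r" using nf_D by blast
    then show "g \<in> D" using D by auto
  next
    fix g assume g: "g \<in> D"
    then have gc: "g \<in> carrier G" using D by blast
    then obtain s where s: "nf g s" using nf_exists by blast
    have "s = Some (\<one>, 1)"
    proof -
      consider "s = None" | a where "s = Some (a, 1)" | a where "s = Some (a, -1)"
        using nf_D[OF s] by blast
      then show ?thesis
      proof cases
        case 1
        then show ?thesis using nf_D[OF s] A_notin g by blast
      next
        case (2 a)
        then obtain r where r: "r \<in> D" "a \<in> T1" "g = a \<otimes> r" using nf_D[OF s] by blast
        have "a = \<one>"
        proof (rule ccontr)
          assume "a \<noteq> \<one>"
          with r(2) have "a \<in> A - H0" by (rule left_transversal_notin[OF A H0 H0A T1])
          then show False using out_H0[OF r(1)] r(3) g by blast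
        qed
        then show ?thesis using 2 by simp
      next
        case (3 a)
        then obtain r where "r \<in> carrier G" "t \<otimes> r \<notin> D" "a \<in> T2" "g = a \<otimes> r" using nf_D[OF s] by blast
        then show ?thesis using out_A T_sub g by blast
      qed
    qed
    then show "g \<in> hnn_Z G A t T1 T2" using Z gc s by blast
  qed
qed

end

lemma determined_complement: "determined_set G (HNN A H0 H1 t) (carrier G - D)"
proof -
  obtain T1 T2 where "left_transversal G A H0 T1" "left_transversal G A H1 T2"
    using left_transversal_exists A H0 H1 H0A H1A by metis
  then show ?thesis using hnn_Z_eq unfolding determined_set.simps Let_def by blast
qed

end

section \<open>Nested systems of oriented edges\<close>

lemma (in group) conjugate_subgroup:
  assumes "subgroup K G" "t \<in> carrier G"
  shows "subgroup ((\<lambda>h. inv t \<otimes> h \<otimes> t) ` K) G"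
proof -
  have "(\<lambda>h. inv t \<otimes> h \<otimes> t) \<in> hom G G"
  proof (rule homI)
    fix x y assume xy: "x \<in> carrier G" "y \<in> carrier G"
    have "t \<otimes> (inv t \<otimes> (y \<otimes> t)) = y \<otimes> t"
      using xy assms(2) by (simp flip: m_assoc)
    then show "inv t \<otimes> (x \<otimes> y) \<otimes> t = inv t \<otimes> x \<otimes> t \<otimes> (inv t \<otimes> y \<otimes> t)"
      using xy assms(2) by (simp add: m_assoc)
  qed (use assms(2) in simp)
  then interpret group_hom G G "\<lambda>h. inv t \<otimes> h \<otimes> t"
    by unfold_locales
  show ?thesis by (rule subgroup_img_is_subgroup[OF assms(1)])
qed

text \<open>Up to the equivalence \<open>eqv\<close>, the elements of \<open>P\<close> are the oriented edges of a tree: \<open>st\<close> reverses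
  an edge, and \<open>le x y\<close> holds if a geodesic runs through \<open>x\<close> and then through \<open>y\<close>.\<close>

locale edge_system = group G for G (structure) +
  fixes P :: "'p set" and le :: "'p \<Rightarrow> 'p \<Rightarrow> bool" and st :: "'p \<Rightarrow> 'p"
    and act :: "'a \<Rightarrow> 'p \<Rightarrow> 'p" and e :: 'p
  assumes e [simp]: "e \<in> P"
    and act_closed [simp]: "g \<in> carrier G \<Longrightarrow> x \<in> P \<Longrightarrow> act g x \<in> P"
    and act_mult: "g \<in> carrier G \<Longrightarrow> h \<in> carrier G \<Longrightarrow> x \<in> P \<Longrightarrow> act (g \<otimes> h) x = act g (act h x)"
    and act_one [simp]: "x \<in> P \<Longrightarrow> act \<one> x = x"
    and st_closed [simp]: "x \<in> P \<Longrightarrow> st x \<in> P"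
    and st_st [simp]: "x \<in> P \<Longrightarrow> st (st x) = x"
    and act_st [simp]: "g \<in> carrier G \<Longrightarrow> x \<in> P \<Longrightarrow> act g (st x) = st (act g x)"
    and le_refl [simp]: "x \<in> P \<Longrightarrow> le x x"
    and le_trans: "le x y \<Longrightarrow> le y z \<Longrightarrow> x \<in> P \<Longrightarrow> y \<in> P \<Longrightarrow> z \<in> P \<Longrightarrow> le x z"
    and le_st: "le x y \<Longrightarrow> x \<in> P \<Longrightarrow> y \<in> P \<Longrightarrow> le (st y) (st x)"
    and le_act: "le x y \<Longrightarrow> g \<in> carrier G \<Longrightarrow> x \<in> P \<Longrightarrow> y \<in> P \<Longrightarrow> le (act g x) (act g y)"
    and nested: "x \<in> P \<Longrightarrow> y \<in> P \<Longrightarrow> le x y \<or> le y x \<or> le x (st y) \<or> le (st y) x"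
    and not_both: "le x y \<Longrightarrow> le x (st y) \<Longrightarrow> x \<in> P \<Longrightarrow> y \<in> P \<Longrightarrow> False"
    and finite_interval: "x \<in> P \<Longrightarrow> y \<in> P \<Longrightarrow> finite {z \<in> P. le x z \<and> le z y}"
    and orbit: "x \<in> P \<Longrightarrow> \<exists>g \<in> carrier G. x = act g e \<or> x = st (act g e)"
begin

definition lt where "lt x y \<longleftrightarrow> le x y \<and> \<not> le y x"
definition eqv where "eqv x y \<longleftrightarrow> le x y \<and> le y x"

lemma act_inv [simp]:
  assumes "g \<in> carrier G" "x \<in> P"
  shows "act (inv g) (act g x) = x" "act g (act (inv g) x) = x"
  using assms by (simp_all flip: act_mult)

lemma le_st_iff [simp]: "x \<in> P \<Longrightarrow> y \<in> P \<Longrightarrow> le (st x) (st y) \<longleftrightarrow> le y x"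
  using le_st[of y x] le_st[of "st x" "st y"] by auto

lemma le_act_iff [simp]: "g \<in> carrier G \<Longrightarrow> x \<in> P \<Longrightarrow> y \<in> P \<Longrightarrow> le (act g x) (act g y) \<longleftrightarrow> le x y"
  using le_act[of x y g] le_act[of "act g x" "act g y" "inv g"] by auto

lemma lt_act_iff [simp]: "g \<in> carrier G \<Longrightarrow> x \<in> P \<Longrightarrow> y \<in> P \<Longrightarrow> lt (act g x) (act g y) \<longleftrightarrow> lt x y"
  by (simp add: lt_def)

lemma eqv_act_iff [simp]: "g \<in> carrier G \<Longrightarrow> x \<in> P \<Longrightarrow> y \<in> P \<Longrightarrow> eqv (act g x) (act g y) \<longleftrightarrow> eqv x y"
  by (simp add: eqv_def)

lemma lt_st_iff [simp]: "x \<in> P \<Longrightarrow> y \<in> P \<Longrightarrow> lt (st x) (st y) \<longleftrightarrow> lt y x"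
  by (simp add: lt_def)

lemma eqv_st_iff [simp]: "x \<in> P \<Longrightarrow> y \<in> P \<Longrightarrow> eqv (st x) (st y) \<longleftrightarrow> eqv x y"
  by (auto simp: eqv_def)

lemma st_le_swap: "x \<in> P \<Longrightarrow> y \<in> P \<Longrightarrow> le (st x) y \<longleftrightarrow> le (st y) x"
  using le_st_iff[of x "st y"] by simp

lemma lt_st_swap: "x \<in> P \<Longrightarrow> y \<in> P \<Longrightarrow> lt x (st y) \<longleftrightarrow> lt y (st x)"
  using lt_st_iff[of "st x" y] by simp

lemma eqv_st_swap: "x \<in> P \<Longrightarrow> y \<in> P \<Longrightarrow> eqv (st x) y \<longleftrightarrow> eqv x (st y)"
  using eqv_st_iff[of x "st y"] by simp

lemma lt_le: "lt x y \<Longrightarrow> le x y"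
  by (simp add: lt_def)

lemma le_cases: "le x y \<Longrightarrow> lt x y \<or> eqv x y"
  by (auto simp: lt_def eqv_def)

lemma lt_le_trans: "lt x y \<Longrightarrow> le y z \<Longrightarrow> x \<in> P \<Longrightarrow> y \<in> P \<Longrightarrow> z \<in> P \<Longrightarrow> lt x z"
  unfolding lt_def using le_trans by blast

lemma le_lt_trans: "le x y \<Longrightarrow> lt y z \<Longrightarrow> x \<in> P \<Longrightarrow> y \<in> P \<Longrightarrow> z \<in> P \<Longrightarrow> lt x z"
  unfolding lt_def using le_trans by blast

lemma eqv_refl [simp]: "x \<in> P \<Longrightarrow> eqv x x"
  by (simp add: eqv_def)

lemma eqv_sym: "eqv x y \<Longrightarrow> eqv y x"
  by (auto simp: eqv_def)

lemma eqv_trans: "eqv x y \<Longrightarrow> eqv y z \<Longrightarrow> x \<in> P \<Longrightarrow> y \<in> P \<Longrightarrow> z \<in> P \<Longrightarrow> eqv x z"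
  unfolding eqv_def using le_trans by blast

text \<open>The edges \<open>x\<close> and \<open>y\<close> end at the same vertex.\<close>

definition adj where
  "adj x y \<longleftrightarrow> eqv x y \<or> (lt x (st y) \<and> (\<forall>z \<in> P. lt x z \<longrightarrow> \<not> lt z (st y)))"

lemma eqv_adj: "eqv x y \<Longrightarrow> adj x y"
  by (simp add: adj_def)

lemma adj_cases: "adj x y \<Longrightarrow> eqv x y \<or> lt x (st y)"
  by (auto simp: adj_def)

lemma adj_refl [simp]: "x \<in> P \<Longrightarrow> adj x x"
  by (simp add: eqv_adj)

lemma adj_sym:
  assumes "adj x y" "x \<in> P" "y \<in> P"
  shows "adj y x"
proof (cases "eqv x y")
  case True
  then show ?thesis by (auto intro: eqv_adj eqv_sym)
next
  case False
  then have lt: "lt x (st y)" and no: "\<And>z. z \<in> P \<Longrightarrow> lt x z \<Longrightarrow> \<not> lt z (st y)"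
    using assms(1) by (auto simp: adj_def)
  have "\<not> lt z (st x)" if "z \<in> P" "lt y z" for z
    using no[of "st z"] lt_st_swap[of z x] lt_st_iff[of z y] that assms by auto
  then show ?thesis using lt lt_st_swap[of x y] assms by (auto simp: adj_def)
qed

text \<open>This makes the classes of \<open>adj\<close> vertices. Comparable \<open>x\<close> and
  \<open>z\<close> are equivalent, since both lie immediately below \<open>st y\<close>; and
  \<open>st z\<close> below \<open>x\<close> would force \<open>y\<close> below \<open>z\<close>.
  There remains \<open>x\<close> below \<open>st z\<close>, where nothing may lie in
  between.\<close>

lemma adj_trans:
  assumes "adj x y" "adj y z" and P: "x \<in> P" "y \<in> P" "z \<in> P"
  shows "adj x z"
proof -
  have adj_eqv: "adj a c" if "adj a b" "eqv b c" "a \<in> P" "b \<in> P" "c \<in> P" for a b c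
  proof (cases "eqv a b")
    case True
    then show ?thesis using eqv_trans that by (blast intro: eqv_adj)
  next
    case False
    have "le (st b) (st c)" "le (st c) (st b)" using that by (simp_all add: eqv_def)
    moreover have "lt a (st b)" "\<And>w. w \<in> P \<Longrightarrow> lt a w \<Longrightarrow> \<not> lt w (st b)"
      using False that(1) by (auto simp: adj_def)
    ultimately have "lt a (st c)" "\<And>w. w \<in> P \<Longrightarrow> lt a w \<Longrightarrow> \<not> lt w (st c)"
      using lt_le_trans that(3-5) st_closed by blast+
    then show ?thesis by (simp add: adj_def)
  qed
  consider "eqv y z" | "eqv x y" | "\<not> eqv x y" "\<not> eqv y z" by blast
  then show ?thesis
  proof cases
    case 1
    then show ?thesis using adj_eqv assms by blast
  next
    case 2
    then have "adj z x"
      using adj_eqv[OF adj_sym[OF assms(2)] eqv_sym] P by blast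
    then show ?thesis using adj_sym P by blast
  next
    case 3
    have xy: "lt x (st y)" and no_xy: "\<And>w. w \<in> P \<Longrightarrow> lt x w \<Longrightarrow> \<not> lt w (st y)"
      using 3 assms(1) by (auto simp: adj_def)
    have yz: "lt y (st z)" and no_yz: "\<And>w. w \<in> P \<Longrightarrow> lt y w \<Longrightarrow> \<not> lt w (st z)"
      using 3 assms(2) by (auto simp: adj_def)
    have zy: "lt z (st y)" using yz lt_st_swap P by simp
    have "\<not> eqv z y" using 3 eqv_sym by blast
    then have no_zy: "\<And>w. w \<in> P \<Longrightarrow> lt z w \<Longrightarrow> \<not> lt w (st y)"
      using adj_sym[OF assms(2)] P by (auto simp: adj_def)
    consider "le x z" | "le z x" | "le (st z) x" | "le x (st z)" "\<not> le (st z) x"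
      using nested[OF P(1,3)] by blast
    then show ?thesis
    proof cases
      case 1
      then have "eqv x z" using no_xy[OF P(3)] zy le_cases by blast
      then show ?thesis by (rule eqv_adj)
    next
      case 2
      then have "eqv z x" using no_zy[OF P(1)] xy le_cases by blast
      then show ?thesis by (rule eqv_adj[OF eqv_sym])
    next
      case 3
      then have "lt (st z) (st y)" using xy le_lt_trans P st_closed by blast
      then have "le y z" using P by (simp add: lt_def)
      then show ?thesis using not_both[OF _ lt_le[OF yz]] P by blast
    next
      case 4
      have "\<not> lt w (st z)" if w: "w \<in> P" "lt x w" for w
      proof
        \<comment> \<open>Compare \<open>w\<close> with \<open>y\<close>: \<open>y < w\<close>
          contradicts the minimality between \<open>y\<close> and \<open>st z\<close>,
          \<open>w < st y\<close> that between \<open>x\<close> and \<open>st y\<close>, and all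
          other positions end in \<open>not_both\<close>.\<close>
        assume wz: "lt w (st z)"
        have wy: "\<not> le w y"
          using not_both[OF _ lt_le[OF xy]] le_trans[OF lt_le[OF w(2)]] w P by blast
        have no: "\<not> le (st y) (st z)"
        proof
          assume "le (st y) (st z)"
          then have "le z (st z)" using le_trans[OF lt_le[OF zy]] P st_closed by blast
          then show False using not_both[OF le_refl] P by blast
        qed
        consider "le y w" | "le w (st y)" | "le (st y) w" using nested[OF w(1) P(2)] wy by blast
        then show False
        proof cases
          case 1
          then have "lt y w" using wy by (simp add: lt_def)
          then show False using no_yz[OF w(1)] wz by blast
        next
          case 2
          then have "le (st y) w" using no_xy[OF w] by (simp add: lt_def)
          then show False using no le_trans[OF _ lt_le[OF wz]] w P st_closed by blast
        next
          case 3
          then show False using no le_trans[OF _ lt_le[OF wz]] w P st_closed by blast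
        qed
      qed
      then show ?thesis using 4 by (simp add: adj_def lt_def)
    qed
  qed
qed

lemma adj_act_imp: 
  assumes "adj x y" "g \<in> carrier G" "x \<in> P" "y \<in> P"
  shows "adj (act g x) (act g y)"
proof (cases "eqv x y")
  case True
  then show ?thesis using assms by (intro eqv_adj) simp
next
  case False
  then have lt: "lt x (st y)" and no: "\<And>z. z \<in> P \<Longrightarrow> lt x z \<Longrightarrow> \<not> lt z (st y)"
    using assms(1) by (auto simp: adj_def)
  have "lt (act g x) (st (act g y))"
    using lt lt_act_iff[OF assms(2,3), of "st y"] assms by simp
  moreover have "\<not> lt z (st (act g y))" if z: "z \<in> P" "lt (act g x) z" for z
  proof -
    have "lt x (act (inv g) z)"
      using z assms lt_act_iff[of g x "act (inv g) z"] by simp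
    then have "\<not> lt (act (inv g) z) (st y)" using no z(1) assms by simp
    then show ?thesis
      using lt_act_iff[of g "act (inv g) z" "st y"] z assms by simp
  qed
  ultimately show ?thesis by (simp add: adj_def)
qed

lemma adj_act_iff [simp]: "g \<in> carrier G \<Longrightarrow> x \<in> P \<Longrightarrow> y \<in> P \<Longrightarrow> adj (act g x) (act g y) \<longleftrightarrow> adj x y"
  using adj_act_imp[of x y g] adj_act_imp[of "act g x" "act g y" "inv g"] by auto

text \<open>Connectedness of the tree: a finite interval is crossed, by induction on its size, in
  steps from \<open>x\<close> to \<open>y\<close> with nothing strictly in between, and such a step
  means that \<open>x\<close> and \<open>st y\<close> end at one vertex. Nestedness lets the walk
  start at \<open>e\<close> or \<open>st e\<close>.\<close>

lemma connected:
  assumes Q: "Q \<subseteq> P" "e \<in> Q" "\<And>x. x \<in> Q \<Longrightarrow> st x \<in> Q" "\<And>x y. x \<in> Q \<Longrightarrow> y \<in> P \<Longrightarrow> adj x y \<Longrightarrow> y \<in> Q"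
    and "y \<in> P"
  shows "y \<in> Q"
proof -
  have up: "y \<in> Q" if "x \<in> Q" "le x y" "y \<in> P" for x y
    using that
  proof (induction "card {z \<in> P. le x z \<and> le z y}" arbitrary: x y rule: less_induct)
    case less
    have x: "x \<in> P" using less.prems(1) Q(1) by blast
    note fin = finite_interval[OF x less.prems(3)]
    consider "eqv x y" | w where "w \<in> P" "lt x w" "lt w y"
      | "lt x y" "\<And>w. w \<in> P \<Longrightarrow> lt x w \<Longrightarrow> \<not> lt w y"
      using le_cases less.prems(2) by blast
    then show ?case
    proof cases
      case 1
      then show ?thesis using Q(4) less.prems eqv_adj by blast
    next
      case (2 w)
      have "y \<notin> {z \<in> P. le x z \<and> le z w}" "x \<notin> {z \<in> P. le w z \<and> le z y}"
        using 2 by (auto simp: lt_def)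
      moreover have "{z \<in> P. le x z \<and> le z w} \<subseteq> {z \<in> P. le x z \<and> le z y}"
        "{z \<in> P. le w z \<and> le z y} \<subseteq> {z \<in> P. le x z \<and> le z y}"
        using le_trans[OF _ lt_le[OF 2(3)]] le_trans[OF lt_le[OF 2(2)]] 2(1) x less.prems(3) by blast+
      moreover have "x \<in> {z \<in> P. le x z \<and> le z y}" "y \<in> {z \<in> P. le x z \<and> le z y}"
        using x less.prems by simp_all
      ultimately have "{z \<in> P. le x z \<and> le z w} \<subset> {z \<in> P. le x z \<and> le z y}"
        "{z \<in> P. le w z \<and> le z y} \<subset> {z \<in> P. le x z \<and> le z y}"
        by blast+
      then have "card {z \<in> P. le x z \<and> le z w} < card {z \<in> P. le x z \<and> le z y}"
        "card {z \<in> P. le w z \<and> le z y} < card {z \<in> P. le x z \<and> le z y}"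
        by (simp_all add: psubset_card_mono[OF fin])
      then show ?thesis
        using less.hyps less.prems(1,3) 2 lt_le by blast
    next
      case 3
      then have "adj x (st y)" using less.prems(3) by (simp add: adj_def)
      then have "st y \<in> Q" using Q(4) less.prems by simp
      then show ?thesis using Q(3)[of "st y"] less.prems(3) by simp
    qed
  qed
  consider "le e y" | "le (st e) (st y)" | "le e (st y)" | "le (st e) y"
    using nested[OF e \<open>y \<in> P\<close>] le_st st_le_swap \<open>y \<in> P\<close> e by blast
  then show ?thesis
  proof cases
    case 1
    then show ?thesis using up Q(2) \<open>y \<in> P\<close> by blast
  next
    case 2
    then have "st y \<in> Q" using up Q(2,3) \<open>y \<in> P\<close> st_closed by blast
    then show ?thesis using Q(3)[of "st y"] \<open>y \<in> P\<close> by simp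
  next
    case 3
    then have "st y \<in> Q" using up Q(2) \<open>y \<in> P\<close> st_closed by blast
    then show ?thesis using Q(3)[of "st y"] \<open>y \<in> P\<close> by simp
  next
    case 4
    then show ?thesis using up Q(2,3) \<open>y \<in> P\<close> by blast
  qed
qed

section \<open>Stabilizers and generation\<close>

lemma stabilizer_subgroup:
  assumes x: "x \<in> P" and refl: "R x x"
    and sym: "\<And>y z. R y z \<Longrightarrow> y \<in> P \<Longrightarrow> z \<in> P \<Longrightarrow> R z y"
    and trans: "\<And>y z w. R y z \<Longrightarrow> R z w \<Longrightarrow> y \<in> P \<Longrightarrow> z \<in> P \<Longrightarrow> w \<in> P \<Longrightarrow> R y w"
    and inv: "\<And>g y z. R y z \<Longrightarrow> g \<in> carrier G \<Longrightarrow> y \<in> P \<Longrightarrow> z \<in> P \<Longrightarrow> R (act g y) (act g z)"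
  shows "subgroup {g \<in> carrier G. R (act g x) x} G"
proof (rule subgroupI)
  show "{g \<in> carrier G. R (act g x) x} \<noteq> {}"
    using x refl one_closed by fastforce
next
  fix g assume "g \<in> {g \<in> carrier G. R (act g x) x}"
  then have g: "g \<in> carrier G" "R (act g x) x" by simp_all
  have "R (act (inv g) (act g x)) (act (inv g) x)"
    by (rule inv[OF g(2)]) (use g x in simp_all)
  with g show "inv g \<in> {g \<in> carrier G. R (act g x) x}"
    using sym x by simp
next
  fix g h assume "g \<in> {g \<in> carrier G. R (act g x) x}" "h \<in> {g \<in> carrier G. R (act g x) x}"
  then have gh: "g \<in> carrier G" "h \<in> carrier G" "R (act g x) x" "R (act h x) x" by simp_all
  have "R (act g (act h x)) (act g x)" by (rule inv[OF gh(4)]) (use gh x in simp_all)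
  then have "R (act g (act h x)) x" by (rule trans[OF _ gh(3)]) (use gh x in simp_all)
  then show "g \<otimes> h \<in> {g \<in> carrier G. R (act g x) x}"
    using gh x by (simp add: act_mult)
qed auto

definition stab where "stab = {g \<in> carrier G. eqv (act g e) e}"

lemma stab_subgroup: "subgroup stab G"
  unfolding stab_def by (rule stabilizer_subgroup) (simp_all add: eqv_sym, blast intro: eqv_trans)

lemma adj_stabilizer_subgroup: "x \<in> P \<Longrightarrow> subgroup {g \<in> carrier G. adj (act g x) x} G"
  by (rule stabilizer_subgroup) (simp_all add: adj_sym, blast intro: adj_trans)

text \<open>The edges \<open>g e\<close>, \<open>g\<close> in \<open>L\<close>, in both
  orientations, are closed under adjacency: translating back by \<open>inv g\<close> turns an
  adjacency into one at \<open>e\<close> or \<open>st e\<close>, where the assumptions apply. By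
  connectedness they are all edges. That \<open>k e\<close> is one of them puts \<open>k\<close>
  into \<open>L\<close>, because equal edges are adjacent.\<close>

lemma generating:
  assumes L: "subgroup L G"
    and "\<And>k. k \<in> carrier G \<Longrightarrow> adj (act k e) e \<Longrightarrow> k \<in> L"
    and "\<And>k. k \<in> carrier G \<Longrightarrow> adj (st (act k e)) e \<Longrightarrow> k \<in> L"
    and "\<And>k. k \<in> carrier G \<Longrightarrow> adj (act k e) (st e) \<Longrightarrow> k \<in> L"
    and "\<And>k. k \<in> carrier G \<Longrightarrow> adj (st (act k e)) (st e) \<Longrightarrow> k \<in> L"
  shows "L = carrier G"
proof -
  interpret L: subgroup L G by fact
  define Q where "Q = {f \<in> P. \<exists>g \<in> L. f = act g e \<or> f = st (act g e)}"
  have L_shift: "k \<in> L" if "g \<in> L" "inv g \<otimes> k \<in> L" "k \<in> carrier G" for g k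
  proof -
    have "g \<otimes> (inv g \<otimes> k) \<in> L" using that by blast
    moreover have "g \<otimes> (inv g \<otimes> k) = k" using that by (simp flip: m_assoc)
    ultimately show ?thesis by simp
  qed
  have key: "k \<in> L"
    if g: "g \<in> L" and k: "k \<in> carrier G" and f: "f = act g e \<or> f = st (act g e)" "f' = act k e \<or> f' = st (act k e)"
      and adj: "adj f' f" for g k f f'
  proof -
    have gc: "g \<in> carrier G" using g by simp
    have P: "f \<in> P" "f' \<in> P" using f gc k by auto
    have "adj (act (inv g) f') (act (inv g) f)" using adj P gc by simp
    moreover have "act (inv g) f = e \<or> act (inv g) f = st e" using f(1) gc by auto
    moreover have "act (inv g) f' = act (inv g \<otimes> k) e \<or> act (inv g) f' = st (act (inv g \<otimes> k) e)"
      using f(2) gc k by (auto simp: act_mult)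
    moreover have ck: "inv g \<otimes> k \<in> carrier G" using gc k by simp
    ultimately have "inv g \<otimes> k \<in> L" using assms(2-5)[OF ck] by auto
    then show ?thesis using L_shift g k by blast
  qed
  have Q: "y \<in> Q" if "y \<in> P" for y
  proof (rule connected[OF _ _ _ _ that])
    show "Q \<subseteq> P" by (auto simp: Q_def)
    show "e \<in> Q" unfolding Q_def using L.one_closed by (intro CollectI conjI bexI[of _ \<one>]) simp_all
    show "st x \<in> Q" if "x \<in> Q" for x
      using that unfolding Q_def by auto
    show "y \<in> Q" if "x \<in> Q" "y \<in> P" "adj x y" for x y
    proof -
      obtain g where g: "g \<in> L" "x = act g e \<or> x = st (act g e)" using \<open>x \<in> Q\<close> by (auto simp: Q_def)
      obtain k where k: "k \<in> carrier G" "y = act k e \<or> y = st (act k e)" using orbit \<open>y \<in> P\<close> by blast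
      have "x \<in> P" using \<open>x \<in> Q\<close> by (auto simp: Q_def)
      then have "adj y x" using adj_sym that by blast
      then have "k \<in> L" using key[OF g(1) k(1) g(2) k(2)] by blast
      then show ?thesis using k that(2) by (auto simp: Q_def)
    qed
  qed
  have "k \<in> L" if k: "k \<in> carrier G" for k
  proof -
    have "act k e \<in> Q" using Q k by simp
    then obtain g where g: "g \<in> L" "act k e = act g e \<or> act k e = st (act g e)" by (auto simp: Q_def)
    show ?thesis by (rule key[OF g(1) k g(2)]) (use k in auto)
  qed
  then show ?thesis using L.subset by blast
qed

definition bel where "bel f g \<longleftrightarrow> le (act g e) f \<or> le (st (act g e)) f"
definition blt where "blt f g \<longleftrightarrow> lt (act g e) f \<or> lt (st (act g e)) f"
text \<open>The elements that move the unoriented edge \<open>e\<close> into the half-tree beyond \<open>e\<close>.\<close>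

definition far where "far = {g \<in> carrier G. blt (st e) g}"

lemma bel_act [simp]:
  assumes "a \<in> carrier G" "g \<in> carrier G" "f \<in> P"
  shows "bel (act a f) (a \<otimes> g) \<longleftrightarrow> bel f g" "blt (act a f) (a \<otimes> g) \<longleftrightarrow> blt f g"
  using assms le_act_iff[of a "st (act g e)" f] lt_act_iff[of a "st (act g e)" f]
  by (simp_all add: bel_def blt_def act_mult)

lemma bel_lt: "bel f g \<Longrightarrow> lt f f' \<Longrightarrow> g \<in> carrier G \<Longrightarrow> f \<in> P \<Longrightarrow> f' \<in> P \<Longrightarrow> blt f' g"
  unfolding bel_def blt_def using le_lt_trans act_closed st_closed e by blast

lemma bel_le: "bel f g \<Longrightarrow> le f f' \<Longrightarrow> g \<in> carrier G \<Longrightarrow> f \<in> P \<Longrightarrow> f' \<in> P \<Longrightarrow> bel f' g"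
  unfolding bel_def using le_trans act_closed st_closed e by blast

lemma blt_bel: "blt f g \<Longrightarrow> bel f g"
  by (auto simp: bel_def blt_def lt_def)

text \<open>Nestedness puts the translated edge on one side of \<open>e\<close>, and
  \<open>not_both\<close> excludes the other. The edge \<open>e\<close> itself, also when reversed,
  counts as near; in particular \<open>stab\<close> lies outside \<open>far\<close>.\<close>

lemma not_blt_iff:
  assumes g: "g \<in> carrier G"
  shows "\<not> blt (st e) g \<longleftrightarrow> bel e g"
proof
  let ?f = "act g e"
  have P: "?f \<in> P" "st ?f \<in> P" "st e \<in> P" using g by simp_all
  {
    assume no: "\<not> blt (st e) g"
    consider "le ?f e" | "le e ?f" | "le ?f (st e)" | "le (st e) ?f"
      using nested[OF P(1) e] by blast
    then show "bel e g"
    proof cases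
      case 1
      then show ?thesis by (simp add: bel_def)
    next
      case 2
      then have "\<not> lt (st ?f) (st e)" "le (st ?f) (st e)" using no P by (auto simp: blt_def)
      then have "le ?f e" using P by (auto simp: lt_def)
      then show ?thesis by (simp add: bel_def)
    next
      case 3
      then have "le (st e) ?f" using no by (auto simp: blt_def lt_def)
      then show ?thesis using st_le_swap[OF e P(1)] by (simp add: bel_def)
    next
      case 4
      then show ?thesis using st_le_swap[OF e P(1)] by (simp add: bel_def)
    qed
  next
    assume "bel e g"
    then consider "le ?f e" | "le (st ?f) e" by (auto simp: bel_def)
    then show "\<not> blt (st e) g"
    proof cases
      case 1
      then have "\<not> lt ?f (st e)" using not_both[OF _ _ P(1) e] by (auto simp: lt_def)
      moreover have "\<not> lt (st ?f) (st e)" using 1 P by (auto simp: lt_def)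
      ultimately show ?thesis by (simp add: blt_def)
    next
      case 2
      then have "\<not> lt (st ?f) (st e)" using not_both[OF _ _ P(2) e] by (auto simp: lt_def)
      moreover have "\<not> lt ?f (st e)" using 2 st_le_swap[OF e P(1)] by (auto simp: lt_def)
      ultimately show ?thesis by (simp add: blt_def)
    qed
  }
qed

lemma notin_far: "g \<in> carrier G \<Longrightarrow> g \<notin> far \<longleftrightarrow> bel e g"
  using not_blt_iff by (simp add: far_def)

lemma far_carrier: "far \<subseteq> carrier G"
  by (auto simp: far_def)

text \<open>\<open>A\<close> is meant to fix the end of \<open>e\<close>, and \<open>B\<close> its
  start or, if some element inverts \<open>e\<close>, its midpoint. \<open>PB\<close> is a weak
  inequality because in the second situation \<open>st (act b e)\<close> can be equivalent to
  \<open>e\<close>. The conditions on \<open>far\<close> make both subgroups proper.\<close>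

lemma amalgam_case:
  assumes A: "subgroup A G" and B: "subgroup B G" and sub: "stab \<subseteq> A" "stab \<subseteq> B"
    and PA: "\<And>a. a \<in> A - stab \<Longrightarrow> lt (act a e) (st e)"
    and PB: "\<And>b. b \<in> B - stab \<Longrightarrow> le (st (act b e)) e"
    and gen: "generate G (A \<union> B) = carrier G"
    and far: "far \<noteq> {}" "\<not> carrier G - far \<subseteq> stab"
  shows "\<exists>\<sigma>. splitting_over G stab \<sigma> \<and> determined_set G \<sigma> (carrier G - far)"
proof -
  interpret A: subgroup A G by fact
  interpret B: subgroup B G by fact
  have BD: "B \<inter> far = {}"
  proof -
    have "b \<notin> far" if b: "b \<in> B" for b
    proof -
      have "bel e b"
      proof (cases "b \<in> stab")
        case True
        then show ?thesis by (simp add: bel_def stab_def eqv_def)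
      next
        case False
        then show ?thesis using PB[of b] b by (simp add: bel_def)
      qed
      then show ?thesis using notin_far[of b] b by simp
    qed
    then show ?thesis by blast
  qed
  interpret stab: subgroup stab G by (rule stab_subgroup)
  interpret amalgam_pingpong G A B stab far
  proof
    fix a r assume a: "a \<in> A - stab" and r: "r \<in> carrier G - far"
    then have c: "a \<in> carrier G" "r \<in> carrier G" by auto
    have "bel (act a e) (a \<otimes> r)" using r c notin_far by simp
    then have "blt (st e) (a \<otimes> r)" by (rule bel_lt[OF _ PA[OF a]]) (use c in simp_all)
    then show "a \<otimes> r \<in> far" using c by (simp add: far_def)
  next
    fix b r assume b: "b \<in> B - stab" and r: "r \<in> far"
    then have c: "b \<in> carrier G" "r \<in> carrier G" by (auto simp: far_def)
    have "blt (st e) r" using r by (simp add: far_def)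
    then have "blt (act b (st e)) (b \<otimes> r)" using bel_act(2)[of b r "st e"] c by simp
    then have "bel (st (act b e)) (b \<otimes> r)" using blt_bel c by simp
    then have "bel e (b \<otimes> r)" by (rule bel_le[OF _ PB[OF b]]) (use c in simp_all)
    then show "b \<otimes> r \<notin> far" using notin_far c by simp
  qed (use sub gen BD in \<open>auto simp: far_def\<close>)
  have "B \<noteq> carrier G" using BD far(1) by (auto simp: far_def)
  moreover have "A \<noteq> carrier G"
  proof
    assume "A = carrier G"
    have "g \<in> stab" if g: "g \<in> carrier G - far" for g
    proof (rule ccontr)
      assume "g \<notin> stab"
      then have lt: "lt (act g e) (st e)" using PA g \<open>A = carrier G\<close> by blast
      then have "blt (st e) g" by (simp add: blt_def)
      then show False using g by (simp add: far_def)
    qed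
    then show False using far(2) by blast
  qed
  ultimately show ?thesis using splitting determined_complement by blast
qed

lemma splitting_exists:
  assumes far: "far \<noteq> {}" "\<not> carrier G - far \<subseteq> stab"
  shows "\<exists>\<sigma>. splitting_over G stab \<sigma> \<and> determined_set G \<sigma> (carrier G - far)"
proof -
  define A where "A = {g \<in> carrier G. adj (act g e) e}"
  have A: "subgroup A G" unfolding A_def by (rule adj_stabilizer_subgroup) simp
  have sA: "stab \<subseteq> A" by (auto simp: A_def stab_def eqv_adj)
  have PA: "lt (act a e) (st e)" if "a \<in> A - stab" for a
    using that adj_cases by (auto simp: A_def stab_def)
  have gen_sub: "X \<subseteq> generate G X" for X :: "'a set" by (simp add: generate.incl subsetI)
  \<comment> \<open>There is one orbit of unoriented edges, so the quotient of the tree is an edge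
    folded by an inversion, a loop, or a segment.\<close>
  consider (inversion) \<tau> where "\<tau> \<in> carrier G" "eqv (act \<tau> e) (st e)"
    | (loop) t where "t \<in> carrier G" "adj (st (act t e)) e" "\<And>k. k \<in> carrier G \<Longrightarrow> \<not> eqv (act k e) (st e)"
    | (segment) "\<And>k. k \<in> carrier G \<Longrightarrow> \<not> adj (st (act k e)) e"
    by blast
  then show ?thesis
  proof cases
    case inversion
    note \<tau> = inversion
    define B where "B = {g \<in> carrier G. eqv (act g e) e \<or> eqv (act g e) (st e)}"
    have B: "subgroup B G"
      unfolding B_def
    proof (rule stabilizer_subgroup[where R = "\<lambda>x y. eqv x y \<or> eqv x (st y)"])
      fix y z w assume "eqv y z \<or> eqv y (st z)" "eqv z w \<or> eqv z (st w)" and P: "y \<in> P" "z \<in> P" "w \<in> P"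
      then consider "eqv y z" "eqv z w" | "eqv y z" "eqv z (st w)" | "eqv y (st z)" "eqv (st z) (st w)"
        | "eqv y (st z)" "eqv (st z) w"
        using eqv_st_swap[of z w] by auto
      then show "eqv y w \<or> eqv y (st w)"
        by cases (use eqv_trans P st_closed in blast)+
    next
      fix y z assume "eqv y z \<or> eqv y (st z)" "y \<in> P" "z \<in> P"
      then show "eqv z y \<or> eqv z (st y)"
        using eqv_sym[of y z] eqv_sym[of y "st z"] eqv_st_swap[of z y] by auto
    next
      fix g y z assume "eqv y z \<or> eqv y (st z)" "g \<in> carrier G" "y \<in> P" "z \<in> P"
      then show "eqv (act g y) (act g z) \<or> eqv (act g y) (st (act g z))"
        using eqv_act_iff[of g y "st z"] by auto
    qed simp_all
    let ?L = "generate G (A \<union> B)"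
    have L: "subgroup ?L G"
      by (rule generate_is_subgroup) (auto simp: A_def B_def)
    interpret L: subgroup ?L G by (rule L)
    have AL: "A \<subseteq> ?L" "B \<subseteq> ?L" using gen_sub by blast+
    have \<tau>L: "\<tau> \<in> ?L" using \<tau> AL(2) by (auto simp: B_def)
    have \<tau>adj: "adj (st e) (act \<tau> e)" by (rule eqv_adj[OF eqv_sym[OF \<tau>(2)]])
    \<comment> \<open>As \<open>act \<tau> e\<close> is equivalent to \<open>st e\<close>,
      multiplication by \<open>inv \<tau>\<close> on the left or \<open>\<tau>\<close> on the right
      exchanges orientations; this reduces the other three types of adjacency to the one that
      defines \<open>A\<close>.\<close>
    have L_left: "k \<in> ?L" if "k \<in> carrier G" "adj (act k e) (st e)" for k
    proof -
      have "adj (act k e) (act \<tau> e)" using adj_trans[OF that(2) \<tau>adj] that \<tau> by simp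
      then have "adj (act (inv \<tau>) (act k e)) (act (inv \<tau>) (act \<tau> e))"
        using that \<tau>(1) by (intro adj_act_imp) simp_all
      moreover have "inv \<tau> \<otimes> k \<in> carrier G" using that \<tau>(1) by simp
      ultimately have "inv \<tau> \<otimes> k \<in> A" using that \<tau>(1) by (simp add: A_def act_mult)
      then have "\<tau> \<otimes> (inv \<tau> \<otimes> k) \<in> ?L" by (intro L.m_closed subsetD[OF AL(1)] \<tau>L)
      then show ?thesis using that \<tau>(1) by (simp flip: m_assoc)
    qed
    have L_right: "k \<in> ?L" if "k \<in> carrier G" "k \<otimes> \<tau> \<in> ?L" for k
    proof -
      have "(k \<otimes> \<tau>) \<otimes> inv \<tau> \<in> ?L" by (intro L.m_closed L.m_inv_closed \<tau>L that(2))
      then show ?thesis using that \<tau>(1) by (simp add: m_assoc)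
    qed
    have k\<tau>: "adj (act (k \<otimes> \<tau>) e) (st (act k e))" if "k \<in> carrier G" for k
      using adj_act_imp[OF adj_sym[OF \<tau>adj], of k] that \<tau>(1) by (simp add: act_mult)
    have "?L = carrier G"
    proof (rule generating[OF L])
      fix k assume k: "k \<in> carrier G"
      show "k \<in> ?L" if "adj (act k e) e"
        using that AL(1) k by (auto simp: A_def)
      show "k \<in> ?L" if "adj (act k e) (st e)"
        by (rule L_left[OF k that])
      show "k \<in> ?L" if "adj (st (act k e)) e"
      proof -
        have "adj (act (k \<otimes> \<tau>) e) e" using adj_trans[OF k\<tau>[OF k] that] k \<tau>(1) by simp
        then have "k \<otimes> \<tau> \<in> ?L" using AL(1) k \<tau>(1) by (auto simp: A_def)
        then show ?thesis by (rule L_right[OF k])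
      qed
      show "k \<in> ?L" if "adj (st (act k e)) (st e)"
      proof -
        have "adj (act (k \<otimes> \<tau>) e) (st e)" using adj_trans[OF k\<tau>[OF k] that] k \<tau>(1) by simp
        then have "k \<otimes> \<tau> \<in> ?L" using L_left k \<tau>(1) by simp
        then show ?thesis by (rule L_right[OF k])
      qed
    qed
    then show ?thesis
    proof (intro amalgam_case[OF A B sA _ PA _ _ far])
      show "stab \<subseteq> B" by (auto simp: B_def stab_def)
      show "le (st (act b e)) e" if "b \<in> B - stab" for b
      proof -
        have "b \<in> carrier G" "eqv (act b e) (st e)" using that by (auto simp: B_def stab_def)
        then show ?thesis using eqv_st_swap[of "act b e" e] by (simp add: eqv_def)
      qed
    qed simp_all
  next
    case segment
    define B where "B = {g \<in> carrier G. adj (act g (st e)) (st e)}"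
    have B: "subgroup B G" unfolding B_def by (rule adj_stabilizer_subgroup) simp
    let ?L = "generate G (A \<union> B)"
    have L: "subgroup ?L G"
      by (rule generate_is_subgroup) (auto simp: A_def B_def)
    have AL: "A \<subseteq> ?L" "B \<subseteq> ?L" using gen_sub by blast+
    have "?L = carrier G"
    proof (rule generating[OF L])
      fix k assume k: "k \<in> carrier G"
      show "k \<in> ?L" if "adj (act k e) e"
        using that AL(1) k by (auto simp: A_def)
      show "k \<in> ?L" if "adj (st (act k e)) e"
        using that segment k by blast
      \<comment> \<open>Translation by \<open>inv k\<close> turns this into an adjacency that
        \<open>segment\<close> excludes.\<close>
      show "k \<in> ?L" if "adj (act k e) (st e)"
      proof -
        have "adj (act (inv k) (act k e)) (act (inv k) (st e))" using that k by (intro adj_act_imp) simp_all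
        then have "adj e (st (act (inv k) e))" using k by simp
        then have "adj (st (act (inv k) e)) e" by (rule adj_sym) (simp_all add: k)
        then show ?thesis using segment[of "inv k"] k by simp
      qed
      show "k \<in> ?L" if "adj (st (act k e)) (st e)"
        using that AL(2) k by (auto simp: B_def)
    qed
    then show ?thesis
    proof (intro amalgam_case[OF A B sA _ PA _ _ far])
      show "stab \<subseteq> B" by (auto simp: B_def stab_def intro!: eqv_adj)
      show "le (st (act b e)) e" if "b \<in> B - stab" for b
      proof -
        have b: "b \<in> carrier G" "adj (st (act b e)) (st e)" "\<not> eqv (act b e) e"
          using that by (auto simp: B_def stab_def)
        then have "lt (st (act b e)) (st (st e))" using adj_cases[OF b(2)] by simp
        then show ?thesis by (simp add: lt_def)
      qed
    qed simp_all
  next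
    case loop
    note t = loop(1) and t_adj = loop(2) and no_inv = loop(3)
    \<comment> \<open>\<open>t\<close> carries the start of \<open>e\<close> to its end. At the
      start both \<open>st e\<close> and \<open>f\<close>, the translate of \<open>e\<close> by
      \<open>inv t\<close>, arrive; their stabilizers \<open>stab\<close> and \<open>?H1\<close> are
      the associated subgroups, so the vertex group is taken there.\<close>
    define A' where "A' = {g \<in> carrier G. adj (act g (st e)) (st e)}"
    have A': "subgroup A' G" unfolding A'_def by (rule adj_stabilizer_subgroup) simp
    let ?H1 = "(\<lambda>h. inv t \<otimes> h \<otimes> t) ` stab"
    define f where "f = act (inv t) e"
    have f: "f \<in> P" "act t f = e" using t by (simp_all add: f_def)
    have f_adj: "adj (st e) f"
      using adj_act_imp[OF t_adj, of "inv t"] t by (simp add: f_def)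
    have af: "adj (act a f) (st e)" "adj (act a (st e)) f" "adj (act a f) f" if a: "a \<in> A'" for a
    proof -
      have ac: "a \<in> carrier G" "adj (act a (st e)) (st e)" using a by (auto simp: A'_def)
      have 1: "adj (act a f) (act a (st e))"
        using ac f by (intro adj_act_imp adj_sym[OF f_adj]) simp_all
      show 2: "adj (act a f) (st e)" by (rule adj_trans[OF 1 ac(2)]) (use ac f in simp_all)
      show "adj (act a (st e)) f" by (rule adj_trans[OF ac(2) f_adj]) (use ac f in simp_all)
      show "adj (act a f) f" by (rule adj_trans[OF 2 f_adj]) (use ac f in simp_all)
    qed
    \<comment> \<open>Either equivalence would produce an element that inverts
      \<open>e\<close>.\<close>
    have neq: "\<not> eqv (act a f) (st e)" "\<not> eqv (act a (st e)) f" if a: "a \<in> A'" for a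
    proof -
      have ac: "a \<in> carrier G" using a by (simp add: A'_def)
      show "\<not> eqv (act a f) (st e)"
        using no_inv[of "a \<otimes> inv t"] ac t by (simp add: f_def act_mult)
      show "\<not> eqv (act a (st e)) f"
      proof
        assume "eqv (act a (st e)) f"
        moreover have "act a (st e) \<in> P" using ac by (intro act_closed st_closed e)
        ultimately have "eqv (act t (act a (st e))) (act t f)" using eqv_act_iff[of t "act a (st e)" f] t f by blast
        then have "eqv (st (act (t \<otimes> a) e)) e" using ac t f by (simp add: act_mult)
        then show False using no_inv[of "t \<otimes> a"] eqv_st_swap[of "act (t \<otimes> a) e" e] ac t by simp
      qed
    qed
    have lt_f: "lt (act a f) e" "lt (act a (st e)) (st f)" if a: "a \<in> A'" for a
      using adj_cases[OF af(1)[OF a]] adj_cases[OF af(2)[OF a]] neq[OF a] by simp_all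
    have lt_A: "lt (act a (st e)) e" if a: "a \<in> A' - stab" for a
      using adj_cases[of "act a (st e)" "st e"] a by (auto simp: A'_def stab_def)
    have lt_H1: "lt (act a f) (st f)" if a: "a \<in> A' - ?H1" for a
    proof -
      have ac: "a \<in> carrier G" using a by (simp add: A'_def)
      have "\<not> eqv (act a f) f"
      proof
        assume "eqv (act a f) f"
        moreover have "act a f \<in> P" using ac f by simp
        ultimately have "eqv (act t (act a f)) (act t f)" using eqv_act_iff[of t "act a f" f] t f by blast
        then have "t \<otimes> a \<otimes> inv t \<in> stab" using ac t f by (simp add: stab_def act_mult f_def)
        moreover have "inv t \<otimes> (t \<otimes> a \<otimes> inv t) \<otimes> t = a"
        proof -
          have "inv t \<otimes> (t \<otimes> a) = a" using ac t by (simp flip: m_assoc)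
          then show ?thesis using ac t by (simp add: m_assoc)
        qed
        ultimately show False using a by (metis DiffE imageI)
      qed
      then show ?thesis using adj_cases[OF af(3)[of a]] a by blast
    qed
    have sA': "stab \<subseteq> A'" by (auto simp: A'_def stab_def intro!: eqv_adj)
    have H1A': "?H1 \<subseteq> A'"
    proof
      fix k assume "k \<in> ?H1"
      then obtain h where h: "h \<in> stab" "k = inv t \<otimes> h \<otimes> t" by blast
      then have hc: "h \<in> carrier G" "eqv (act h e) e" by (auto simp: stab_def)
      have te: "act t (st e) \<in> P" using t by (intro act_closed st_closed e)
      have 1: "adj (act h (act t (st e))) (act h e)"
        using t_adj t hc te by (intro adj_act_imp) simp_all
      have 2: "adj (act h (act t (st e))) e"
        by (rule adj_trans[OF 1 eqv_adj[OF hc(2)]]) (use hc te in simp_all)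
      have 3: "adj e (act t (st e))" by (rule adj_sym) (use t_adj t te in simp_all)
      have "adj (act h (act t (st e))) (act t (st e))"
        by (rule adj_trans[OF 2 3]) (use hc te in simp_all)
      then have "adj (act (inv t) (act h (act t (st e)))) (act (inv t) (act t (st e)))"
        using hc te t by (intro adj_act_imp) simp_all
      then show "k \<in> A'" using h hc t by (simp add: A'_def act_mult)
    qed
    let ?L = "generate G (insert t A')"
    have L: "subgroup ?L G"
      by (rule generate_is_subgroup) (use t in \<open>auto simp: A'_def\<close>)
    interpret L: subgroup ?L G by (rule L)
    have AL: "A' \<subseteq> ?L" "t \<in> ?L" using gen_sub[of "insert t A'"] by blast+
    have L_right: "k \<in> ?L" if "k \<in> carrier G" "k \<otimes> t \<in> ?L" for k
    proof -
      have "(k \<otimes> t) \<otimes> inv t \<in> ?L" by (intro L.m_closed L.m_inv_closed AL(2) that(2))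
      then show ?thesis using that t by (simp add: m_assoc)
    qed
    have L_left: "k \<in> ?L" if "k \<in> carrier G" "adj (st (act k e)) e" for k
    proof -
      have "adj (act (inv t) (st (act k e))) (act (inv t) e)" using that t by (intro adj_act_imp) simp_all
      then have 1: "adj (act (inv t \<otimes> k) (st e)) f" using that t by (simp add: f_def act_mult)
      have "adj (act (inv t \<otimes> k) (st e)) (st e)"
        by (rule adj_trans[OF 1 adj_sym[OF f_adj]]) (use that t f in simp_all)
      moreover have "inv t \<otimes> k \<in> carrier G" using that t by simp
      ultimately have "inv t \<otimes> k \<in> A'" unfolding A'_def by blast
      then have "t \<otimes> (inv t \<otimes> k) \<in> ?L" by (intro L.m_closed subsetD[OF AL(1)] AL(2))
      then show ?thesis using that t by (simp flip: m_assoc)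
    qed
    have kt: "adj (st (act (k \<otimes> t) e)) (act k e)" if "k \<in> carrier G" for k
      using adj_act_imp[OF t_adj, of k] that t by (simp add: act_mult)
    have gen: "?L = carrier G"
    proof (rule generating[OF L])
      fix k assume k: "k \<in> carrier G"
      show "k \<in> ?L" if "adj (act k e) e"
      proof -
        have "adj (st (act (k \<otimes> t) e)) e" by (rule adj_trans[OF kt[OF k] that]) (use k t in simp_all)
        then show ?thesis by (rule L_right[OF k L_left[OF m_closed[OF k t]]])
      qed
      show "k \<in> ?L" if "adj (st (act k e)) e"
        by (rule L_left[OF k that])
      show "k \<in> ?L" if "adj (act k e) (st e)"
      proof -
        have "adj (st (act (k \<otimes> t) e)) (st e)" by (rule adj_trans[OF kt[OF k] that]) (use k t in simp_all)
        moreover have "k \<otimes> t \<in> carrier G" using k t by simp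
        ultimately have "k \<otimes> t \<in> A'" unfolding A'_def using act_st e by simp
        then show ?thesis by (rule L_right[OF k subsetD[OF AL(1)]])
      qed
      show "k \<in> ?L" if "adj (st (act k e)) (st e)"
      proof -
        have "k \<in> A'" unfolding A'_def using that k by simp
        then show ?thesis using AL(1) by blast
      qed
    qed
    \<comment> \<open>In terms of the tree, \<open>t \<otimes> r \<notin> far\<close> says that
      \<open>r\<close> moves \<open>e\<close> to an edge behind \<open>f\<close>; this is the second
      ping-pong set.\<close>
    have bel_f: "bel f r" if "r \<in> carrier G" "t \<otimes> r \<notin> far" for r
    proof -
      have "bel (act t f) (t \<otimes> r)" using that t notin_far[of "t \<otimes> r"] f by simp
      then show ?thesis using that t f(1) by simp
    qed
    have far_f: "t \<otimes> r \<in> far" if "r \<in> carrier G" "blt (st f) r" for r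
    proof -
      have "blt (act t (st f)) (t \<otimes> r)" using bel_act(2)[of t r "st f"] that t f(1) by simp
      then show ?thesis using that t f by (simp add: far_def)
    qed
    interpret stab: subgroup stab G by (rule stab_subgroup)
    interpret A': subgroup A' G by (rule A')
    interpret H1: subgroup ?H1 G by (rule conjugate_subgroup[OF stab_subgroup t])
    interpret hnn_pingpong G A' stab ?H1 t far
    proof
      fix r a assume r: "r \<in> far" and a: "a \<in> A' - stab"
      have c: "r \<in> carrier G" "a \<in> carrier G" "blt (st e) r" using r a by (auto simp: far_def)
      have "bel (act a (st e)) (a \<otimes> r)" using bel_act(1)[of a r "st e"] blt_bel[OF c(3)] c by simp
      then have "bel e (a \<otimes> r)" by (rule bel_le[OF _ lt_le[OF lt_A[OF a]]]) (use c in simp_all)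
      then show "a \<otimes> r \<notin> far" using notin_far c by simp
    next
      fix r a assume r: "r \<in> carrier G" "t \<otimes> r \<notin> far" and a: "a \<in> A'"
      have c: "a \<in> carrier G" using a by simp
      have "bel (act a f) (a \<otimes> r)" using bel_f[OF r] r c f(1) by simp
      then have "bel e (a \<otimes> r)" by (rule bel_le[OF _ lt_le[OF lt_f(1)[OF a]]]) (use r c f in simp_all)
      then show "a \<otimes> r \<notin> far" using notin_far r c by simp
    next
      fix r a assume r: "r \<in> carrier G" "t \<otimes> r \<notin> far" and a: "a \<in> A' - ?H1"
      have c: "a \<in> carrier G" using a by auto
      have "bel (act a f) (a \<otimes> r)" using bel_f[OF r] r c f(1) by simp
      then have "blt (st f) (a \<otimes> r)" by (rule bel_lt[OF _ lt_H1[OF a]]) (use r c f in simp_all)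
      then show "t \<otimes> (a \<otimes> r) \<in> far" using far_f r c by simp
    next
      fix r a assume r: "r \<in> far" and a: "a \<in> A'"
      have c: "r \<in> carrier G" "a \<in> carrier G" "blt (st e) r" using r a by (auto simp: far_def)
      have "bel (act a (st e)) (a \<otimes> r)" using bel_act(1)[of a r "st e"] blt_bel[OF c(3)] c by simp
      then have "blt (st f) (a \<otimes> r)" by (rule bel_lt[OF _ lt_f(2)[OF a]]) (use c f in simp_all)
      then show "t \<otimes> (a \<otimes> r) \<in> far" using far_f c by simp
    next
      fix a assume a: "a \<in> A'"
      have "a \<in> carrier G" "adj (act a (st e)) (st e)" using a unfolding A'_def by blast+
      then have c: "a \<in> carrier G" "adj (st (act a e)) (st e)" by simp_all
      have "bel e a"
        using adj_cases[OF c(2)] c(1) by (auto simp: bel_def eqv_def lt_def)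
      then show "a \<notin> far" using notin_far c by simp
    next
      fix a assume a: "a \<in> A'"
      have c: "a \<in> carrier G" using a by simp
      have "blt (st f) a" using lt_f(2)[OF a] c by (simp add: blt_def)
      then show "t \<otimes> a \<in> far" using far_f c by simp
    qed (rule sA' H1A' t gen HOL.refl far_carrier)+
    show ?thesis using splitting determined_complement by blast
  qed
qed

end

section \<open>Finite unions of cosets\<close>

context group
begin

lemma mem_l_coset:
  assumes "U \<subseteq> carrier G" "g \<in> carrier G"
  shows "x \<in> g <# U \<longleftrightarrow> x \<in> carrier G \<and> inv g \<otimes> x \<in> U"
proof
  assume "x \<in> g <# U"
  then obtain u where "u \<in> U" "x = g \<otimes> u" by (auto simp: l_coset_def)
  moreover have "u \<in> carrier G" using calculation(1) assms(1) by blast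
  ultimately show "x \<in> carrier G \<and> inv g \<otimes> x \<in> U"
    using assms(2) by (simp flip: m_assoc)
next
  assume x: "x \<in> carrier G \<and> inv g \<otimes> x \<in> U"
  then have "x = g \<otimes> (inv g \<otimes> x)" using assms(2) by (simp flip: m_assoc)
  then show "x \<in> g <# U" using x unfolding l_coset_def by blast
qed

lemma l_coset_mult:
  assumes "U \<subseteq> carrier G" "g \<in> carrier G" "h \<in> carrier G"
  shows "(g \<otimes> h) <# U = g <# (h <# U)"
  using lcos_m_assoc[OF assms] by simp

lemma l_coset_closed: "U \<subseteq> carrier G \<Longrightarrow> g \<in> carrier G \<Longrightarrow> g <# U \<subseteq> carrier G"
  by (rule l_coset_subset_G)

lemma l_coset_inv:
  assumes "U \<subseteq> carrier G" "g \<in> carrier G"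
  shows "inv g <# (g <# U) = U" "g <# (inv g <# U) = U"
  using l_coset_mult[OF assms(1), of "inv g" g] l_coset_mult[OF assms(1), of g "inv g"]
    lcos_mult_one[OF assms(1)] assms(2) by simp_all

lemma l_coset_compl:
  assumes "U \<subseteq> carrier G" "g \<in> carrier G"
  shows "g <# (carrier G - U) = carrier G - (g <# U)"
  using mem_l_coset[OF assms] mem_l_coset[of "carrier G - U" g] assms(2) by auto

lemma l_coset_mono: "U \<subseteq> V \<Longrightarrow> g <# U \<subseteq> g <# V"
  by (auto simp: l_coset_def)

lemma l_coset_subset_iff:
  assumes "U \<subseteq> carrier G" "V \<subseteq> carrier G" "g \<in> carrier G"
  shows "g <# U \<subseteq> g <# V \<longleftrightarrow> U \<subseteq> V"
  using l_coset_mono[of U V g] l_coset_mono[of "g <# U" "g <# V" "inv g"]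
    l_coset_inv(1)[OF assms(1,3)] l_coset_inv(1)[OF assms(2,3)] by auto

lemma l_coset_set_mult:
  assumes "U \<subseteq> carrier G" "D \<subseteq> carrier G" "g \<in> carrier G"
  shows "g <# (U <#> D) = (g <# U) <#> D"
proof -
  have "g \<otimes> (u \<otimes> d) = g \<otimes> u \<otimes> d" if "u \<in> U" "d \<in> D" for u d
    by (rule m_assoc[symmetric]) (use that assms in blast)+
  then show ?thesis by (fastforce simp: l_coset_def set_mult_def)
qed

lemma set_mult_mono: "U \<subseteq> U' \<Longrightarrow> D \<subseteq> D' \<Longrightarrow> U <#> D \<subseteq> U' <#> D'"
  by (auto simp: set_mult_def)

lemma finite_set_mult: "finite C \<Longrightarrow> finite D \<Longrightarrow> finite (C <#> D)"
  by (auto simp: set_mult_def)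

lemma H_finite_iff: "H_finite G H A \<longleftrightarrow> (\<exists>F. finite F \<and> F \<subseteq> carrier G \<and> A \<subseteq> H <#> F)"
proof -
  have "(\<Union>f\<in>F. H #> f) = H <#> F" for F by (auto simp: r_coset_def set_mult_def)
  then show ?thesis by (simp add: H_finite_def)
qed

lemma H_finite_subset:
  assumes "H_finite G H B" "A \<subseteq> B"
  shows "H_finite G H A"
  using assms(1) subset_trans[OF assms(2)] unfolding H_finite_def by (elim ex_forward) simp

lemma H_finite_mono:
  assumes "H_finite G H A" "H \<subseteq> K"
  shows "H_finite G K A"
proof -
  obtain F where F: "finite F" "F \<subseteq> carrier G" "A \<subseteq> H <#> F"
    using assms(1) unfolding H_finite_iff by blast
  have "A \<subseteq> K <#> F" using F(3) set_mult_mono[OF assms(2) subset_refl] by (rule subset_trans)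
  then show ?thesis unfolding H_finite_iff using F by blast
qed

lemma H_finite_UN:
  assumes "finite I" "\<And>i. i \<in> I \<Longrightarrow> H_finite G H (A i)"
  shows "H_finite G H (\<Union>i\<in>I. A i)"
proof -
  obtain F where F: "\<And>i. i \<in> I \<Longrightarrow> finite (F i) \<and> F i \<subseteq> carrier G \<and> A i \<subseteq> (\<Union>f\<in>F i. H #> f)"
    using assms(2) unfolding H_finite_def by metis
  have "A i \<subseteq> (\<Union>f\<in>(\<Union>i\<in>I. F i). H #> f)" if "i \<in> I" for i
  proof -
    have "(\<Union>f\<in>F i. H #> f) \<subseteq> (\<Union>f\<in>(\<Union>i\<in>I. F i). H #> f)"
      using that by (intro UN_mono) auto
    with F[OF that] show ?thesis by (meson subset_trans)
  qed
  then have "(\<Union>i\<in>I. A i) \<subseteq> (\<Union>f\<in>(\<Union>i\<in>I. F i). H #> f)" by (rule UN_least)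
  moreover have "finite (\<Union>i\<in>I. F i)" "(\<Union>i\<in>I. F i) \<subseteq> carrier G"
    using F assms(1) by auto
  ultimately show ?thesis unfolding H_finite_def by blast
qed

lemma H_finite_Un:
  assumes "H_finite G H A" "H_finite G H B"
  shows "H_finite G H (A \<union> B)"
proof -
  have "H_finite G H (\<Union>C\<in>{A, B}. C)" by (rule H_finite_UN) (use assms in auto)
  then show ?thesis by simp
qed

lemma H_finite_right:
  assumes "H_finite G H A" "H \<subseteq> carrier G" "g \<in> carrier G"
  shows "H_finite G H (A #> g)"
proof -
  obtain F where F: "finite F" "F \<subseteq> carrier G" "A \<subseteq> H <#> F"
    using assms(1) unfolding H_finite_iff by blast
  have "h \<otimes> f \<otimes> g = h \<otimes> (f \<otimes> g)" if "h \<in> H" "f \<in> F" for h f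
    by (rule m_assoc) (use that F(2) assms(2,3) in blast)+
  then have "A #> g \<subseteq> H <#> (\<lambda>f. f \<otimes> g) ` F"
    using F(3) by (fastforce simp: r_coset_def set_mult_def)
  moreover have "(\<lambda>f. f \<otimes> g) ` F \<subseteq> carrier G" using F(2) assms(3) by auto
  ultimately show ?thesis unfolding H_finite_iff using F(1) by blast
qed

lemma finite_coset_image_iff:
  assumes "subgroup H G" "A \<subseteq> carrier G"
  shows "finite (coset_image G H A) \<longleftrightarrow> H_finite G H A"
proof
  assume "finite (coset_image G H A)"
  then obtain F where F: "F \<subseteq> A" "finite F" "coset_image G H A = (\<lambda>x. H #> x) ` F"
    unfolding coset_image_def by (metis finite_subset_image subset_refl)
  have "A \<subseteq> (\<Union>f\<in>F. H #> f)"
  proof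
    fix x assume x: "x \<in> A"
    then have "H #> x \<in> (\<lambda>x. H #> x) ` F" using F(3) unfolding coset_image_def by blast
    then obtain f where "f \<in> F" "H #> x = H #> f" by blast
    moreover have "x \<in> H #> x" using rcos_self[OF _ assms(1)] x assms(2) by blast
    ultimately show "x \<in> (\<Union>f\<in>F. H #> f)" by blast
  qed
  moreover have "F \<subseteq> carrier G" using F(1) assms(2) by (rule subset_trans)
  ultimately show "H_finite G H A"
    unfolding H_finite_def using F(2) by (intro exI[of _ F] conjI)
next
  assume "H_finite G H A"
  then obtain F where F: "finite F" "F \<subseteq> carrier G" "A \<subseteq> (\<Union>f\<in>F. H #> f)"
    unfolding H_finite_def by blast
  have "coset_image G H A \<subseteq> (\<lambda>f. H #> f) ` F"
  proof
    fix C assume "C \<in> coset_image G H A"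
    then obtain x where x: "C = H #> x" "x \<in> A" unfolding coset_image_def by blast
    then obtain f where f: "f \<in> F" "x \<in> H #> f" using F(3) by blast
    have "H #> f = H #> x"
      by (rule repr_independence[OF f(2) _ assms(1)]) (use f(1) F(2) in blast)
    then show "C \<in> (\<lambda>f. H #> f) ` F" using x f by blast
  qed
  then show "finite (coset_image G H A)" by (rule finite_surj[OF F(1)])
qed

lemma coset_image_right:
  assumes "H \<subseteq> carrier G" "A \<subseteq> carrier G" "g \<in> carrier G"
  shows "(\<lambda>C. C #> g) ` coset_image G H A = coset_image G H (A #> g)"
proof -
  have "(H #> a) #> g = H #> (a \<otimes> g)" if "a \<in> A" for a
    using coset_mult_assoc[OF assms(1) _ assms(3)] that assms(2) by blast
  moreover have "A #> g = (\<lambda>a. a \<otimes> g) ` A" by (auto simp: r_coset_def)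
  ultimately show ?thesis
    unfolding coset_image_def image_image by (simp add: image_image)
qed

lemma H_almost_invariantI:
  assumes K: "subgroup K G" and Y: "Y \<subseteq> carrier G" and inv: "\<And>k. k \<in> K \<Longrightarrow> k <# Y = Y"
    and fin: "\<And>g. g \<in> carrier G \<Longrightarrow> H_finite G K (sym_diff (Y #> g) Y)"
  shows "H_almost_invariant G K Y"
proof -
  have "finite (sym_diff ((\<lambda>C. C #> g) ` coset_image G K Y) (coset_image G K Y))" if g: "g \<in> carrier G" for g
  proof -
    have sub: "sym_diff (Y #> g) Y \<subseteq> carrier G" using Y r_coset_subset_G[OF Y g] by blast
    have "sym_diff (coset_image G K (Y #> g)) (coset_image G K Y) \<subseteq> coset_image G K (sym_diff (Y #> g) Y)"
      by (auto simp: coset_image_def)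
    moreover have "finite (coset_image G K (sym_diff (Y #> g) Y))"
      using finite_coset_image_iff[OF K sub] fin[OF g] by blast
    ultimately show ?thesis
      using coset_image_right[OF subgroup.subset[OF K] Y g] finite_subset by metis
  qed
  then show ?thesis
    unfolding H_almost_invariant_def almost_invariant_def almost_equal_def using Y inv by blast
qed

lemma finite_index_iff:
  assumes "subgroup H G" "H \<subseteq> K" "K \<subseteq> carrier G"
  shows "finite_index G H K \<longleftrightarrow> H_finite G H K"
proof -
  have "rcosets\<^bsub>G\<lparr>carrier := K\<rparr>\<^esub> H = coset_image G H K"
    by (auto simp: RCOSETS_def coset_image_def r_coset_def)
  then show ?thesis
    using finite_coset_image_iff[OF assms(1,3)] assms(2) by (simp add: finite_index_def)
qed

end

section \<open>Coarse inclusion\<close>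

definition (in group) coarse_le :: "'a set \<Rightarrow> 'a set \<Rightarrow> bool" where
  "coarse_le U V \<longleftrightarrow> (\<exists>D. finite D \<and> D \<subseteq> carrier G \<and> U \<subseteq> V <#> D)"

context group
begin

lemma subset_set_mult_one: "V \<subseteq> carrier G \<Longrightarrow> \<one> \<in> D \<Longrightarrow> V \<subseteq> V <#> D"
  by (force simp: set_mult_def)

lemma coarse_le_subset: "U \<subseteq> V \<Longrightarrow> V \<subseteq> carrier G \<Longrightarrow> coarse_le U V"
  unfolding coarse_le_def using subset_set_mult_one[of V "{\<one>}"] by (intro exI[of _ "{\<one>}"]) auto

lemma coarse_le_trans:
  assumes "coarse_le U V" "coarse_le V W" "W \<subseteq> carrier G"
  shows "coarse_le U W"
proof -
  obtain C D where C: "finite C" "C \<subseteq> carrier G" "U \<subseteq> V <#> C"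
    and D: "finite D" "D \<subseteq> carrier G" "V \<subseteq> W <#> D"
    using assms(1,2) unfolding coarse_le_def by blast
  have "U \<subseteq> (W <#> D) <#> C" using C(3) set_mult_mono[OF D(3), of C C] by blast
  also have "\<dots> = W <#> (D <#> C)" by (rule set_mult_assoc[OF assms(3) D(2) C(2)])
  finally show ?thesis
    unfolding coarse_le_def
    using finite_set_mult[OF D(1) C(1)] set_mult_closed[OF D(2) C(2)] by (intro exI[of _ "D <#> C"] conjI)
qed

lemma coarse_le_Un:
  assumes "coarse_le U W" "coarse_le V W"
  shows "coarse_le (U \<union> V) W"
proof -
  obtain C D where "finite C" "C \<subseteq> carrier G" "U \<subseteq> W <#> C" "finite D" "D \<subseteq> carrier G" "V \<subseteq> W <#> D"
    using assms unfolding coarse_le_def by blast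
  moreover have "W <#> C \<subseteq> W <#> (C \<union> D)" "W <#> D \<subseteq> W <#> (C \<union> D)" by (auto simp: set_mult_def)
  ultimately show ?thesis
    unfolding coarse_le_def by (intro exI[of _ "C \<union> D"] conjI finite_UnI Un_least) simp_all
qed

lemma coarse_le_act:
  assumes "coarse_le U V" "V \<subseteq> carrier G" "g \<in> carrier G"
  shows "coarse_le (g <# U) (g <# V)"
proof -
  obtain D where D: "finite D" "D \<subseteq> carrier G" "U \<subseteq> V <#> D"
    using assms(1) unfolding coarse_le_def by blast
  then have "g <# U \<subseteq> (g <# V) <#> D"
    using l_coset_mono[OF D(3), of g] l_coset_set_mult[OF assms(2) D(2) assms(3)] by simp
  then show ?thesis unfolding coarse_le_def using D by blast
qed

lemma coarse_le_act_iff: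
  assumes "U \<subseteq> carrier G" "V \<subseteq> carrier G" "g \<in> carrier G"
  shows "coarse_le (g <# U) (g <# V) \<longleftrightarrow> coarse_le U V"
  using coarse_le_act[OF _ assms(2,3)] coarse_le_act[of "g <# U" "g <# V" "inv g"]
    l_coset_inv(1)[OF assms(1,3)] l_coset_inv(1)[OF assms(2,3)] l_coset_closed[OF assms(2,3)] assms(3)
  by auto

end

section \<open>Translates of an almost invariant set with self-intersection number zero\<close>

locale noncrossing_set = group G for G (structure) +
  fixes S T H X :: "'a set"
  assumes S: "finite S" "S \<subseteq> carrier G" "generate G S = carrier G"
    and T: "finite T" "T \<subseteq> carrier G" "generate G T = H"
    and H: "subgroup H G"
    and ai: "H_almost_invariant G H X"
    and nontrivial: "H_nontrivial G H X"
    and noncrossing: "self_intersection_number G H X = 0"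
begin

abbreviation (input) co :: "'a set \<Rightarrow> 'a set" where "co U \<equiv> carrier G - U"
abbreviation (input) fin where "fin \<equiv> H_finite G H"

definition base where "base = {X, co X}"

lemma X_sub: "X \<subseteq> carrier G"
  using ai by (simp add: H_almost_invariant_def)

lemma H_carrier: "h \<in> H \<Longrightarrow> h \<in> carrier G"
  using subgroup.mem_carrier[OF H] .

lemma base_sub: "W \<in> base \<Longrightarrow> W \<subseteq> carrier G"
  using X_sub by (auto simp: base_def)

lemma base_co: "W \<in> base \<Longrightarrow> co W \<in> base"
  using X_sub by (auto simp: base_def double_diff)

lemma base_H:
  assumes "W \<in> base" "h \<in> H" "x \<in> carrier G"
  shows "h \<otimes> x \<in> W \<longleftrightarrow> x \<in> W"
proof -
  have h: "h \<in> carrier G" "inv h \<in> H" "inv h \<in> carrier G"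
    using assms(2) H_carrier subgroup.m_inv_closed[OF H] by simp_all
  have "inv h <# X = X" using ai h(2) by (simp add: H_almost_invariant_def)
  then have "x \<in> X \<longleftrightarrow> h \<otimes> x \<in> X"
    using mem_l_coset[OF X_sub h(3), of x] h(1) assms(3) by simp
  then show ?thesis using assms h(1) by (auto simp: base_def)
qed

lemma base_infinite: "W \<in> base \<Longrightarrow> \<not> fin W"
  using nontrivial finite_coset_image_iff[OF H] X_sub
  by (auto simp: base_def H_nontrivial_def)

lemma base_nonempty: "W \<in> base \<Longrightarrow> W \<noteq> {}"
  using base_infinite[of W] by (auto simp: H_finite_def)

lemma coset_in_image_iff:
  assumes "x \<in> carrier G"
  shows "H #> x \<in> coset_image G H X \<longleftrightarrow> x \<in> X"
proof
  assume "H #> x \<in> coset_image G H X"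
  then obtain y where y: "y \<in> X" "H #> x = H #> y" unfolding coset_image_def by blast
  have "x \<in> H #> y" using rcos_self[OF assms H] y(2) by simp
  then obtain h where "h \<in> H" "x = h \<otimes> y" unfolding r_coset_def by blast
  moreover have "y \<in> carrier G" using y(1) X_sub by blast
  ultimately show "x \<in> X" using base_H[of X h y] y(1) by (simp add: base_def)
next
  assume "x \<in> X"
  then show "H #> x \<in> coset_image G H X" unfolding coset_image_def by blast
qed

text \<open>The form in which almost invariance is used: if \<open>z\<close> moves \<open>x\<close>
  out of \<open>W\<close>, the coset of \<open>x\<close> lies in the symmetric difference of
  \<open>coset_image G H X\<close> and its translate by \<open>inv z\<close>.\<close>

lemma base_shift:
  assumes W: "W \<in> base" and z: "z \<in> carrier G"
  shows "fin {x \<in> W. x \<otimes> z \<notin> W}"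
proof -
  let ?P = "coset_image G H X"
  let ?Q = "(\<lambda>C. C #> inv z) ` ?P"
  have HG: "H \<subseteq> carrier G" by (rule subgroup.subset[OF H])
  have "finite (sym_diff ?Q ?P)"
    using ai z unfolding H_almost_invariant_def almost_invariant_def almost_equal_def by simp
  moreover have "coset_image G H {x \<in> W. x \<otimes> z \<notin> W} \<subseteq> sym_diff ?Q ?P"
  proof
    fix C assume "C \<in> coset_image G H {x \<in> W. x \<otimes> z \<notin> W}"
    then obtain x where x: "x \<in> W" "x \<otimes> z \<notin> W" "C = H #> x" unfolding coset_image_def by blast
    have xc: "x \<in> carrier G" using x(1) base_sub[OF W] by blast
    have "C \<in> ?Q \<longleftrightarrow> x \<otimes> z \<in> X"
    proof
      assume "C \<in> ?Q"
      then obtain y where y: "y \<in> X" "C = (H #> y) #> inv z" unfolding coset_image_def by blast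
      have yc: "y \<in> carrier G" using y(1) X_sub by blast
      have "H #> (x \<otimes> z) = ((H #> y) #> inv z) #> z"
        using x(3) y(2) coset_mult_assoc[OF HG xc z] by simp
      also have "\<dots> = H #> y"
        using coset_mult_assoc[OF r_coset_subset_G[OF HG yc], of "inv z" z] z
          coset_mult_one[OF r_coset_subset_G[OF HG yc]] by simp
      finally have "H #> (x \<otimes> z) \<in> ?P" using y(1) unfolding coset_image_def by blast
      then show "x \<otimes> z \<in> X" using coset_in_image_iff xc z by simp
    next
      assume xz: "x \<otimes> z \<in> X"
      have "(H #> (x \<otimes> z)) #> inv z = C"
        using coset_mult_assoc[OF HG, of "x \<otimes> z" "inv z"] x(3) xc z by (simp add: m_assoc)
      then show "C \<in> ?Q" using xz unfolding coset_image_def by blast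
    qed
    moreover have "C \<in> ?P \<longleftrightarrow> x \<in> X" using coset_in_image_iff[OF xc] x(3) by simp
    moreover have "x \<in> X \<longleftrightarrow> x \<otimes> z \<notin> X"
      using x(1,2) W xc z by (auto simp: base_def)
    ultimately show "C \<in> sym_diff ?Q ?P" by blast
  qed
  ultimately have "finite (coset_image G H {x \<in> W. x \<otimes> z \<notin> W})" by (rule finite_subset[rotated])
  then show ?thesis using finite_coset_image_iff[OF H, of "{x \<in> W. x \<otimes> z \<notin> W}"] base_sub[OF W] by blast
qed

text \<open>With \<open>w\<close> the set \<open>W\<close> contains all of \<open>Hw\<close>, and
  every coset \<open>Hf\<close> is the right translate of \<open>Hw\<close> by
  \<open>w^-1 f\<close>. So \<open>H\<close>-finite sets can be ignored in coarse inclusions into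
  \<open>W\<close>.\<close>

lemma base_absorb:
  assumes W: "W \<in> base" and A: "fin A"
  shows "coarse_le A W"
proof -
  obtain F where F: "finite F" "F \<subseteq> carrier G" "A \<subseteq> H <#> F"
    using A unfolding H_finite_iff by blast
  obtain w where w: "w \<in> W" using base_nonempty[OF W] by blast
  then have wc: "w \<in> carrier G" using base_sub[OF W] by blast
  have "A \<subseteq> W <#> ((\<lambda>f. inv w \<otimes> f) ` F)"
  proof
    fix x assume "x \<in> A"
    then obtain h f where hf: "h \<in> H" "f \<in> F" "x = h \<otimes> f" using F(3) unfolding set_mult_def by blast
    have c: "h \<in> carrier G" "f \<in> carrier G" using hf F(2) H_carrier by blast+
    have "inv w \<otimes> (w \<otimes> f) = f" "w \<otimes> (inv w \<otimes> f) = f" using c wc by (simp_all flip: m_assoc)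
    then have "x = (h \<otimes> w) \<otimes> (inv w \<otimes> f)" using hf(3) c wc by (simp add: m_assoc)
    moreover have "h \<otimes> w \<in> W" using base_H[OF W hf(1) wc] w by simp
    ultimately show "x \<in> W <#> ((\<lambda>f. inv w \<otimes> f) ` F)" using hf(2) unfolding set_mult_def by blast
  qed
  moreover have "(\<lambda>f. inv w \<otimes> f) ` F \<subseteq> carrier G" using F(2) wc by auto
  ultimately show ?thesis unfolding coarse_le_def using F(1)
    by (intro exI[of _ "(\<lambda>f. inv w \<otimes> f) ` F"] conjI) simp_all
qed

text \<open>Such a point leaves \<open>W\<close> under \<open>inv d\<close> for some
  \<open>d\<close> in the finite set \<open>D\<close>, so that \<open>base_shift\<close>
  applies.\<close>

lemma base_boundary:
  assumes W: "W \<in> base" and D: "finite D" "D \<subseteq> carrier G"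
  shows "fin (W \<inter> (co W <#> D))"
proof -
  have "W \<inter> (co W <#> D) \<subseteq> (\<Union>d\<in>D. {x \<in> W. x \<otimes> inv d \<notin> W})"
  proof
    fix x assume "x \<in> W \<inter> (co W <#> D)"
    then obtain y d where x: "x \<in> W" "y \<in> co W" "d \<in> D" "x = y \<otimes> d" unfolding set_mult_def by blast
    then have "x \<otimes> inv d = y" using D(2) by (simp add: subset_iff m_assoc)
    then show "x \<in> (\<Union>d\<in>D. {x \<in> W. x \<otimes> inv d \<notin> W})" using x by blast
  qed
  moreover have "fin (\<Union>d\<in>D. {x \<in> W. x \<otimes> inv d \<notin> W})"
    by (rule H_finite_UN[OF D(1)], rule base_shift[OF W]) (use D(2) in blast)
  ultimately show ?thesis using H_finite_subset by blast
qed

lemma base_not_coarse_le_co: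
  assumes W: "W \<in> base"
  shows "\<not> coarse_le W (co W)"
proof
  assume "coarse_le W (co W)"
  then obtain D where D: "finite D" "D \<subseteq> carrier G" "W \<subseteq> co W <#> D" unfolding coarse_le_def by blast
  have "fin W" using base_boundary[OF W D(1,2)] D(3) by (simp add: Int_absorb2)
  then show False using base_infinite[OF W] by blast
qed

text \<open>The part of \<open>co W\<close> that meets \<open>U\<close> lies in the boundary of
  \<open>co W\<close>, hence in some \<open>HF\<close> with \<open>F\<close> finite. It has to be
  absorbed by \<open>co U\<close>, which need not be \<open>H\<close>-invariant. The witness is a
  coset \<open>Hz\<close> in \<open>co W\<close> outside \<open>HF\<close>: it avoids
  \<open>U\<close>, and it exists because \<open>co W\<close> is not
  \<open>H\<close>-finite.\<close>

lemma base_coarse_le_dual: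
  assumes W: "W \<in> base" and U: "U \<subseteq> carrier G" and le: "coarse_le U W"
  shows "coarse_le (co W) (co U)"
proof -
  obtain D where D: "finite D" "D \<subseteq> carrier G" "U \<subseteq> W <#> D" using le unfolding coarse_le_def by blast
  have coW: "co W \<in> base" by (rule base_co[OF W])
  have "co (co W) = W" using base_sub[OF W] by (rule double_diff) simp
  then have "fin (co W \<inter> (W <#> D))" using base_boundary[OF coW D(1,2)] by simp
  then obtain F where F: "finite F" "F \<subseteq> carrier G" "co W \<inter> (W <#> D) \<subseteq> H <#> F"
    unfolding H_finite_iff by blast
  have "\<not> co W \<subseteq> H <#> F" using base_infinite[OF coW] F(1,2) unfolding H_finite_iff by blast
  then obtain z where z: "z \<in> co W" "z \<notin> H <#> F" by blast
  then have zc: "z \<in> carrier G" by simp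
  let ?D = "insert \<one> ((\<lambda>f. inv z \<otimes> f) ` F)"
  have "co W \<subseteq> co U <#> ?D"
  proof
    fix x assume x: "x \<in> co W"
    show "x \<in> co U <#> ?D"
    proof (cases "x \<in> U")
      case False
      then have "x \<in> co U" "x = x \<otimes> \<one>" using x by simp_all
      then show ?thesis unfolding set_mult_def by blast
    next
      case True
      then have "x \<in> H <#> F" using x D(3) F(3) by blast
      then obtain h f where hf: "h \<in> H" "f \<in> F" "x = h \<otimes> f" unfolding set_mult_def by blast
      have c: "h \<in> carrier G" "f \<in> carrier G" using hf F(2) H_carrier by blast+
      have hz: "h \<otimes> z \<in> co W" using base_H[OF coW hf(1) zc] z(1) by blast
      have "h \<otimes> z \<notin> H <#> F"
      proof
        assume "h \<otimes> z \<in> H <#> F"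
        then obtain h' f' where hf': "h' \<in> H" "f' \<in> F" "h \<otimes> z = h' \<otimes> f'" unfolding set_mult_def by blast
        have c': "h' \<in> carrier G" "f' \<in> carrier G" using hf' F(2) H_carrier by blast+
        have "inv h \<otimes> (h \<otimes> z) = z" using c(1) zc by (simp flip: m_assoc)
        then have "z = (inv h \<otimes> h') \<otimes> f'" using hf'(3) c c' by (simp add: m_assoc)
        moreover have "inv h \<otimes> h' \<in> H"
          using hf(1) hf'(1) subgroup.m_closed[OF H] subgroup.m_inv_closed[OF H] by simp
        ultimately have "z \<in> H <#> F" using hf'(2) unfolding set_mult_def by blast
        then show False using z(2) by blast
      qed
      then have "h \<otimes> z \<notin> U" using hz D(3) F(3) by blast
      then have "h \<otimes> z \<in> co U" using c(1) zc by simp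
      moreover have "x = (h \<otimes> z) \<otimes> (inv z \<otimes> f)"
      proof -
        have "z \<otimes> (inv z \<otimes> f) = f" using c zc by (simp flip: m_assoc)
        then show ?thesis using hf(3) c zc by (simp add: m_assoc)
      qed
      ultimately show ?thesis using hf(2) unfolding set_mult_def by blast
    qed
  qed
  moreover have "?D \<subseteq> carrier G" using F(2) zc by auto
  ultimately show ?thesis unfolding coarse_le_def using F(1)
    by (intro exI[of _ ?D] conjI) simp_all
qed

definition translates where "translates = {g <# W | g W. g \<in> carrier G \<and> W \<in> base}"

lemma translateE:
  assumes "U \<in> translates"
  obtains g W where "g \<in> carrier G" "W \<in> base" "U = g <# W"
  using assms unfolding translates_def by blast

lemma translateI: "g \<in> carrier G \<Longrightarrow> W \<in> base \<Longrightarrow> g <# W \<in> translates"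
  unfolding translates_def by blast

lemma translates_sub: "U \<in> translates \<Longrightarrow> U \<subseteq> carrier G"
  using l_coset_closed base_sub by (elim translateE) simp

lemma translates_act: "U \<in> translates \<Longrightarrow> g \<in> carrier G \<Longrightarrow> g <# U \<in> translates"
  using l_coset_mult[OF base_sub] by (elim translateE) (metis m_closed translateI)

lemma translates_co: "U \<in> translates \<Longrightarrow> co U \<in> translates"
  using l_coset_compl[OF base_sub] base_co by (elim translateE) (metis translateI)

lemma translates_co_co: "U \<in> translates \<Longrightarrow> co (co U) = U"
  using translates_sub by (simp add: double_diff)

lemma translates_act_co: "U \<in> translates \<Longrightarrow> g \<in> carrier G \<Longrightarrow> g <# (co U) = co (g <# U)"
  by (rule l_coset_compl[OF translates_sub])

lemma base_translates: "W \<in> base \<Longrightarrow> W \<in> translates"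
  using translateI[of \<one> W] lcos_mult_one[OF base_sub] by simp

lemma coarse_le_dual:
  assumes "U \<in> translates" "V \<in> translates" "coarse_le U V"
  shows "coarse_le (co V) (co U)"
proof -
  obtain g W where g: "g \<in> carrier G" "W \<in> base" "V = g <# W" using assms(2) by (rule translateE)
  note U = translates_sub[OF assms(1)]
  have ig: "inv g \<in> carrier G" using g by simp
  have iV: "inv g <# V = W" using l_coset_inv(1)[OF base_sub[OF g(2)] g(1)] g(3) by simp
  have "coarse_le (inv g <# U) W"
    using coarse_le_act[OF assms(3) translates_sub[OF assms(2)] ig] iV by simp
  then have "coarse_le (co W) (co (inv g <# U))"
    by (rule base_coarse_le_dual[OF g(2) l_coset_closed[OF U ig]])
  then have "coarse_le (g <# co W) (g <# co (inv g <# U))"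
    by (rule coarse_le_act) (use g(1) in auto)
  then show ?thesis
    using l_coset_compl[OF base_sub[OF g(2)] g(1)] l_coset_compl[OF l_coset_closed[OF U ig] g(1)]
      l_coset_inv(2)[OF U g(1)] g(3) by simp
qed

lemma not_coarse_le_co:
  assumes "U \<in> translates"
  shows "\<not> coarse_le U (co U)"
proof -
  obtain g W where g: "g \<in> carrier G" "W \<in> base" "U = g <# W" using assms by (rule translateE)
  show ?thesis
    using coarse_le_act_iff[OF base_sub[OF g(2)] _ g(1), of "co W"] base_not_coarse_le_co[OF g(2)]
      l_coset_compl[OF base_sub[OF g(2)] g(1)] g(3) by auto
qed

text \<open>Otherwise all of \<open>G\<close>, the union of \<open>V\<close> and
  \<open>co V\<close>, would lie near \<open>co U\<close>.\<close>

lemma coarse_le_not_both: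
  assumes "U \<in> translates" "V \<in> translates" "coarse_le U V" "coarse_le U (co V)"
  shows False
proof -
  have "coarse_le (co V) (co U)" using coarse_le_dual assms(1-3) by blast
  moreover have "coarse_le V (co U)"
    using coarse_le_dual[OF assms(1) translates_co[OF assms(2)] assms(4)] translates_co_co[OF assms(2)] by simp
  ultimately have "coarse_le (co V \<union> V) (co U)" by (rule coarse_le_Un)
  moreover have "coarse_le U (co V \<union> V)"
    using translates_sub[OF assms(1)] translates_sub[OF assms(2)] by (intro coarse_le_subset) auto
  ultimately have "coarse_le U (co U)" using coarse_le_trans[of U "co V \<union> V" "co U"] by simp
  then show False using not_coarse_le_co assms(1) by blast
qed

text \<open>Intersection number zero means that no translate crosses \<open>X\<close>, so some
  corner \<open>gW \<inter> W'\<close> has finite image. Being absorbed by \<open>co W'\<close>, it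
  leaves \<open>gW\<close> coarsely inside \<open>co W'\<close>. The two corners with
  \<open>g <# co X\<close> are dualized afterwards.\<close>

lemma base_nested:
  assumes g: "g \<in> carrier G"
  shows "coarse_le (g <# X) X \<or> coarse_le X (g <# X) \<or> coarse_le (g <# X) (co X) \<or> coarse_le (co X) (g <# X)"
proof -
  let ?C = "{(H #> g) <#> H | g. g \<in> carrier G \<and> translate_crosses G H X g}"
  have "ecard ?C = 0" using noncrossing by (simp add: self_intersection_number_def)
  then have "?C = {}" by (auto simp: ecard_def zero_enat_def split: if_splits)
  then have "\<not> translate_crosses G H X g" using g by blast
  have X: "X \<in> base" "co X \<in> base" by (simp_all add: base_def)
  have XX: "co (co X) = X" using X_sub by (simp add: double_diff)
  have corner: "coarse_le (g <# W) (co W')"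
    if "finite (coset_image G H ((g <# W) \<inter> W'))" "W \<in> base" "W' \<in> base" for W W'
  proof -
    have "fin ((g <# W) \<inter> W')"
      using finite_coset_image_iff[OF H, of "(g <# W) \<inter> W'"] that base_sub[OF that(3)] by blast
    then have "coarse_le ((g <# W) \<inter> W') (co W')" by (rule base_absorb[OF base_co[OF that(3)]])
    moreover have "coarse_le (co W') (co W')" by (rule coarse_le_subset) auto
    ultimately have le: "coarse_le (((g <# W) \<inter> W') \<union> co W') (co W')" by (rule coarse_le_Un)
    have "coarse_le (g <# W) (((g <# W) \<inter> W') \<union> co W')"
      using l_coset_closed[OF base_sub[OF that(2)] g] by (intro coarse_le_subset) auto
    then show ?thesis using le by (rule coarse_le_trans) auto
  qed
  have dual: "coarse_le V (g <# X)" if "coarse_le (g <# co X) (co V)" "V \<in> base" for V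
  proof -
    have "coarse_le (co (co V)) (co (g <# co X))"
      by (rule coarse_le_dual[OF translateI[OF g X(2)] base_translates[OF base_co[OF that(2)]] that(1)])
    then show ?thesis
      using l_coset_compl[OF X_sub g] l_coset_closed[OF X_sub g] base_sub[OF that(2)] by (simp add: double_diff)
  qed
  from \<open>\<not> translate_crosses G H X g\<close> consider
      "finite (coset_image G H ((g <# X) \<inter> X))" | "finite (coset_image G H ((g <# co X) \<inter> X))"
    | "finite (coset_image G H ((g <# X) \<inter> co X))" | "finite (coset_image G H ((g <# co X) \<inter> co X))"
    unfolding translate_crosses_def by blast
  then show ?thesis
  proof cases
    case 1
    then show ?thesis using corner[OF 1 X(1) X(1)] by blast
  next
    case 2
    then show ?thesis using dual[OF corner[OF 2 X(2) X(1)] X(1)] by blast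
  next
    case 3
    then show ?thesis using corner[OF 3 X(1) X(2)] XX by simp
  next
    case 4
    then show ?thesis using dual[OF corner[OF 4 X(2) X(2)] X(2)] XX by simp
  qed
qed

lemma coarse_le_nested:
  assumes U: "U \<in> translates" and V: "V \<in> translates"
  shows "coarse_le U V \<or> coarse_le V U \<or> coarse_le U (co V) \<or> coarse_le (co V) U"
proof -
  have X: "X \<in> base" by (simp add: base_def)
  have XX: "coarse_le (g <# X) (k <# X) \<or> coarse_le (k <# X) (g <# X) \<or>
      coarse_le (g <# X) (co (k <# X)) \<or> coarse_le (co (k <# X)) (g <# X)"
    if "g \<in> carrier G" "k \<in> carrier G" for g k
  proof -
    have g: "inv k \<otimes> g \<in> carrier G" using that by simp
    have kg: "k <# ((inv k \<otimes> g) <# X) = g <# X"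
    proof -
      have "k \<otimes> (inv k \<otimes> g) = g" using that by (simp flip: m_assoc)
      then show ?thesis using l_coset_mult[OF X_sub that(2) g] by simp
    qed
    have act: "coarse_le A B \<Longrightarrow> A \<subseteq> carrier G \<Longrightarrow> B \<subseteq> carrier G \<Longrightarrow> coarse_le (k <# A) (k <# B)" for A B
      using coarse_le_act that(2) by blast
    have sub: "(inv k \<otimes> g) <# X \<subseteq> carrier G" "co X \<subseteq> carrier G"
      using l_coset_closed[OF X_sub g] by auto
    show ?thesis
      using base_nested[OF g] act[OF _ sub(1) X_sub] act[OF _ X_sub sub(1)]
        act[OF _ sub(1) sub(2)] act[OF _ sub(2) sub(1)] kg l_coset_compl[OF X_sub that(2)]
      by metis
  qed
  have form: "\<exists>g \<in> carrier G. U = g <# X \<or> U = co (g <# X)" if "U \<in> translates" for U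
    using that l_coset_compl[OF X_sub] by (elim translateE) (auto simp: base_def)
  obtain g where g: "g \<in> carrier G" "U = g <# X \<or> U = co (g <# X)" using form[OF U] by blast
  obtain k where k: "k \<in> carrier G" "V = k <# X \<or> V = co (k <# X)" using form[OF V] by blast
  let ?A = "g <# X" and ?B = "k <# X"
  have t: "?A \<in> translates" "?B \<in> translates" using translateI X g k by simp_all
  have cc: "co (co ?A) = ?A" "co (co ?B) = ?B" using t translates_co_co by simp_all
  note d = coarse_le_dual[OF t] coarse_le_dual[OF t(2,1)]
    coarse_le_dual[OF t(1) translates_co[OF t(2)]] coarse_le_dual[OF translates_co[OF t(2)] t(1)]
  show ?thesis
    using XX[OF g(1) k(1)] g(2) k(2) d unfolding cc by (elim disjE) (simp_all add: cc)
qed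

end

section \<open>Local finiteness and uniform constants\<close>

context noncrossing_set
begin

lemma base_finite: "finite base"
  by (simp add: base_def)

lemma base_stab:
  assumes "h \<in> H" "W \<in> base"
  shows "h <# W = W"
proof -
  have "inv h \<in> H" using subgroup.m_inv_closed[OF H assms(1)] .
  then have "w \<in> h <# W \<longleftrightarrow> w \<in> W" for w
    using mem_l_coset[OF base_sub[OF assms(2)] H_carrier[OF assms(1)], of w]
      base_H[OF assms(2), of "inv h" w] base_sub[OF assms(2)] by blast
  then show ?thesis by blast
qed

text \<open>With \<open>y = x z\<close>, a separating \<open>gW\<close> puts \<open>g^-1 x\<close>
  into the \<open>H\<close>-finite set of points that \<open>z\<close> moves out of
  \<open>W\<close>. So \<open>g^-1 x = h f\<close> with \<open>f\<close> from a finite set, and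
  \<open>gW = (x f^-1) W\<close> because \<open>hW = W\<close>.\<close>

lemma finite_separating:
  assumes "x \<in> carrier G" "y \<in> carrier G"
  shows "finite {U \<in> translates. x \<in> U \<and> y \<notin> U}"
proof -
  define z where "z = inv x \<otimes> y"
  have z: "z \<in> carrier G" using assms by (simp add: z_def)
  have "\<forall>W\<in>base. \<exists>F. finite F \<and> F \<subseteq> carrier G \<and> {w \<in> W. w \<otimes> z \<notin> W} \<subseteq> H <#> F"
    using base_shift[OF _ z] unfolding H_finite_iff by blast
  from bchoice[OF this] obtain F where
    F: "\<forall>W\<in>base. finite (F W) \<and> F W \<subseteq> carrier G \<and> {w \<in> W. w \<otimes> z \<notin> W} \<subseteq> H <#> F W"
    by blast
  have "{U \<in> translates. x \<in> U \<and> y \<notin> U} \<subseteq> (\<Union>W\<in>base. (\<lambda>f. (x \<otimes> inv f) <# W) ` F W)"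
  proof
    fix U assume "U \<in> {U \<in> translates. x \<in> U \<and> y \<notin> U}"
    then have U: "U \<in> translates" "x \<in> U" "y \<notin> U" by simp_all
    obtain g W where g: "g \<in> carrier G" "W \<in> base" "U = g <# W" using U(1) by (rule translateE)
    note W = base_sub[OF g(2)]
    have "inv g \<otimes> x \<in> W" using U(2) mem_l_coset[OF W g(1)] g(3) by blast
    moreover have "inv g \<otimes> y \<notin> W" using U(3) mem_l_coset[OF W g(1)] g(3) assms(2) by blast
    moreover have "(inv g \<otimes> x) \<otimes> z = inv g \<otimes> y"
    proof -
      have "x \<otimes> (inv x \<otimes> y) = y" using assms by (simp flip: m_assoc)
      then show ?thesis using g(1) assms by (simp add: z_def m_assoc)
    qed
    ultimately have "inv g \<otimes> x \<in> {w \<in> W. w \<otimes> z \<notin> W}" by simp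
    note mem = this
    have FW: "finite (F W)" "F W \<subseteq> carrier G" "{w \<in> W. w \<otimes> z \<notin> W} \<subseteq> H <#> F W"
      using bspec[OF F g(2)] by simp_all
    have "inv g \<otimes> x \<in> H <#> F W" by (rule subsetD[OF FW(3) mem])
    then obtain h f where hf: "h \<in> H" "f \<in> F W" "inv g \<otimes> x = h \<otimes> f" unfolding set_mult_def by blast
    have c: "h \<in> carrier G" "f \<in> carrier G" using hf(1,2) FW(2) H_carrier by blast+
    have "(x \<otimes> inv f) <# W = U"
    proof -
      have "x = g \<otimes> (inv g \<otimes> x)" using g(1) assms by (simp flip: m_assoc)
      then have "x = g \<otimes> (h \<otimes> f)" using hf(3) by simp
      then have "x \<otimes> inv f = g \<otimes> h" using g(1) c by (simp add: m_assoc)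
      then have "(x \<otimes> inv f) <# W = g <# (h <# W)" using l_coset_mult[OF W g(1) c(1)] by simp
      moreover have "h <# W = W" by (rule base_stab[OF hf(1) g(2)])
      ultimately show ?thesis using g(3) by simp
    qed
    then show "U \<in> (\<Union>W\<in>base. (\<lambda>f. (x \<otimes> inv f) <# W) ` F W)" using g(2) hf(2) by blast
  qed
  moreover have "finite (\<Union>W\<in>base. (\<lambda>f. (x \<otimes> inv f) <# W) ` F W)"
    by (intro finite_UN_I finite_imageI base_finite) (use bspec[OF F] in simp)
  ultimately show ?thesis by (rule finite_subset)
qed

lemma translate_not_all:
  assumes "V \<in> translates" "finite D" "D \<subseteq> carrier G"
  obtains y where "y \<in> carrier G" "y \<notin> V <#> D"
proof -
  have "\<not> co V \<subseteq> V <#> D"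
    using not_coarse_le_co[OF translates_co[OF assms(1)]] translates_co_co[OF assms(1)] assms(2,3)
    unfolding coarse_le_def by auto
  then show thesis using that by blast
qed

text \<open>Each such \<open>L\<close> contains all points outside \<open>co U <#> D\<close> and
  misses all points outside \<open>V <#> D\<close>. One point of each kind exists, and only finitely
  many translates separate the two.\<close>

lemma finite_between:
  assumes "U \<in> translates" "V \<in> translates" "finite D" "D \<subseteq> carrier G"
  shows "finite {L \<in> translates. L \<subseteq> V <#> D \<and> co L \<subseteq> co U <#> D}"
proof -
  obtain y where y: "y \<in> carrier G" "y \<notin> V <#> D" using translate_not_all[OF assms(2-4)] .
  obtain x where x: "x \<in> carrier G" "x \<notin> co U <#> D" using translate_not_all[OF translates_co[OF assms(1)] assms(3,4)] .
  have "{L \<in> translates. L \<subseteq> V <#> D \<and> co L \<subseteq> co U <#> D} \<subseteq> {L \<in> translates. x \<in> L \<and> y \<notin> L}"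
    using x y by blast
  then show ?thesis by (rule finite_subset[OF _ finite_separating[OF x(1) y(1)]])
qed

text \<open>The four inclusions say that one of the four corners of \<open>U\<close> and \<open>V\<close> is empty.\<close>

definition tame where
  "tame U V \<longleftrightarrow> U \<subseteq> V \<or> V \<subseteq> U \<or> U \<subseteq> co V \<or> co V \<subseteq> U"

lemma fin_boundary:
  assumes "finite R" "R \<subseteq> carrier G"
  shows "fin {x \<in> carrier G. \<exists>s \<in> R. (x \<in> X) \<noteq> (x \<otimes> s \<in> X)}"
proof -
  have "{x \<in> carrier G. \<exists>s \<in> R. (x \<in> X) \<noteq> (x \<otimes> s \<in> X)} \<subseteq>
      (\<Union>s\<in>R. \<Union>W\<in>base. {x \<in> W. x \<otimes> s \<notin> W})"
    using assms(2) by (fastforce simp: base_def)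
  moreover have "fin (\<Union>s\<in>R. \<Union>W\<in>base. {x \<in> W. x \<otimes> s \<notin> W})"
    by (rule H_finite_UN[OF assms(1)], rule H_finite_UN[OF base_finite], rule base_shift)
      (use assms(2) in blast)+
  ultimately show ?thesis using H_finite_subset by blast
qed

text \<open>If \<open>H\<close> stays away from the boundary of \<open>g <# X\<close>, then it does not meet both sides: this is where
  finite generation of \<open>H\<close> enters.\<close>

lemma neighbourhood_one_side:
  assumes F: "finite F" "F \<subseteq> carrier G"
  shows "\<exists>F'. finite F' \<and> F' \<subseteq> carrier G \<and>
    (\<forall>g \<in> carrier G. (\<forall>h \<in> H. inv g \<otimes> h \<notin> H <#> F') \<longrightarrow> H <#> F \<subseteq> g <# X \<or> H <#> F \<subseteq> co (g <# X))"
proof -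
  \<comment> \<open>Two kinds of moves must not cross the boundary of \<open>g <# X\<close>: those
    inside \<open>H\<close>, by generators from \<open>T\<close>, and those from \<open>H\<close>
    into \<open>H <#> F\<close>.\<close>
  let ?R = "T \<union> F"
  let ?bd = "{x \<in> carrier G. \<exists>s \<in> ?R. (x \<in> X) \<noteq> (x \<otimes> s \<in> X)}"
  have R: "finite ?R" "?R \<subseteq> carrier G" using T F by simp_all
  obtain F' where F': "finite F'" "F' \<subseteq> carrier G" "?bd \<subseteq> H <#> F'"
    using fin_boundary[OF R] unfolding H_finite_iff by blast
  have "H <#> F \<subseteq> g <# X \<or> H <#> F \<subseteq> co (g <# X)"
    if g: "g \<in> carrier G" and away: "\<forall>h \<in> H. inv g \<otimes> h \<notin> H <#> F'" for g
  proof -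
    have ig: "inv g \<in> carrier G" using g by simp
    have step: "h \<in> g <# X \<longleftrightarrow> h \<otimes> s \<in> g <# X" if h: "h \<in> H" and s: "s \<in> ?R" for h s
    proof -
      have c: "h \<in> carrier G" "s \<in> carrier G" using h s R(2) H_carrier by blast+
      have "inv g \<otimes> h \<notin> ?bd" using away h F'(3) by blast
      then have "inv g \<otimes> h \<in> X \<longleftrightarrow> (inv g \<otimes> h) \<otimes> s \<in> X" using s c ig by simp
      then show ?thesis using mem_l_coset[OF X_sub g] c ig by (simp add: m_assoc)
    qed
    have gen: "\<forall>h \<in> H. h \<in> g <# X \<longleftrightarrow> h \<otimes> k \<in> g <# X" if "k \<in> generate G T" for k
      using that
    proof (induction rule: generate.induct)
      case one
      then show ?case using H_carrier by simp
    next
      case (incl k)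
      then show ?case using step by simp
    next
      case (inv k)
      have k: "k \<in> H" "k \<in> carrier G" using generate.incl[OF inv, of G] T inv by blast+
      show ?case
      proof
        fix h assume h: "h \<in> H"
        have "h \<otimes> inv k \<in> H" using h k(1) subgroup.m_closed[OF H] subgroup.m_inv_closed[OF H] by simp
        then have "h \<otimes> inv k \<in> g <# X \<longleftrightarrow> (h \<otimes> inv k) \<otimes> k \<in> g <# X" using step inv by simp
        then show "h \<in> g <# X \<longleftrightarrow> h \<otimes> inv k \<in> g <# X" using H_carrier[OF h] k(2) by (simp add: m_assoc)
      qed
    next
      case (eng k1 k2)
      have k: "k1 \<in> H" "k2 \<in> H" using eng.hyps T(3) by simp_all
      show ?case
      proof
        fix h assume h: "h \<in> H"
        have "h \<otimes> k1 \<in> H" using h k subgroup.m_closed[OF H] by simp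
        then have "h \<in> g <# X \<longleftrightarrow> (h \<otimes> k1) \<otimes> k2 \<in> g <# X" using eng.IH h by simp
        then show "h \<in> g <# X \<longleftrightarrow> h \<otimes> (k1 \<otimes> k2) \<in> g <# X"
          using H_carrier h k by (simp add: m_assoc)
      qed
    qed
    have "h \<otimes> f \<in> g <# X \<longleftrightarrow> \<one> \<in> g <# X" if h: "h \<in> H" and f: "f \<in> F" for h f
    proof -
      have "\<one> \<in> g <# X \<longleftrightarrow> \<one> \<otimes> h \<in> g <# X"
        using gen[of h] h T(3) subgroup.one_closed[OF H] by blast
      then show ?thesis using step[OF h UnI2[OF f]] H_carrier[OF h] by simp
    qed
    moreover have "h \<otimes> f \<in> carrier G" if "h \<in> H" "f \<in> F" for h f
      using that H_carrier F(2) by blast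
    ultimately show ?thesis unfolding set_mult_def by blast
  qed
  then show ?thesis using F'(1,2) by blast
qed

text \<open>From a point outside both \<open>gW\<close> and \<open>W'\<close> a generator leads into
  neither: to enter \<open>W'\<close> the point would have to be in \<open>N\<close>, hence in
  \<open>gW\<close>; to enter \<open>gW\<close>, in \<open>gN\<close>, hence in \<open>W'\<close>.
  So the corner is closed under steps in the connected Cayley graph. It misses the non-empty
  \<open>W'\<close>, so it is empty.\<close>

lemma empty_corner:
  assumes g: "g \<in> carrier G" and W: "W \<in> base" "W' \<in> base"
    and bd: "{x \<in> carrier G. \<exists>s \<in> S \<union> m_inv G ` S. (x \<in> X) \<noteq> (x \<otimes> s \<in> X)} \<subseteq> N"
    and N: "N \<subseteq> g <# W" "g <# N \<subseteq> W'" "N \<subseteq> carrier G"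
  shows "co (g <# W) \<subseteq> W'"
proof -
  let ?R = "S \<union> m_inv G ` S"
  have R: "?R \<subseteq> carrier G" using S(2) by auto
  have bdW: "x \<in> N" if "V \<in> base" "x \<in> carrier G" "s \<in> ?R" "x \<notin> V" "x \<otimes> s \<in> V" for V x s
  proof -
    have "x \<otimes> s \<in> carrier G" using that(2,3) R by blast
    then have "(x \<in> X) \<noteq> (x \<otimes> s \<in> X)" using that by (auto simp: base_def)
    then show ?thesis using that(2,3) bd by blast
  qed
  let ?C = "co (g <# W) - W'"
  have step: "x \<otimes> s \<in> ?C" if x: "x \<in> ?C" and s: "s \<in> ?R" for x s
  proof -
    have xc: "x \<in> carrier G" "x \<notin> g <# W" "x \<notin> W'" using x by simp_all
    have xs: "x \<otimes> s \<in> carrier G" using xc(1) s R by blast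
    have "x \<otimes> s \<notin> W'"
    proof
      assume "x \<otimes> s \<in> W'"
      then have "x \<in> N" using bdW[OF W(2) xc(1) s xc(3)] by blast
      then show False using N(1) xc(2) by blast
    qed
    moreover have "x \<otimes> s \<notin> g <# W"
    proof
      assume "x \<otimes> s \<in> g <# W"
      then have "inv g \<otimes> (x \<otimes> s) \<in> W" using mem_l_coset[OF base_sub[OF W(1)] g] by blast
      moreover have "inv g \<otimes> (x \<otimes> s) = (inv g \<otimes> x) \<otimes> s"
        using xc(1) s R g by (intro m_assoc[symmetric]) auto
      moreover have "inv g \<otimes> x \<notin> W" using mem_l_coset[OF base_sub[OF W(1)] g] xc by blast
      moreover have "inv g \<otimes> x \<in> carrier G" using g xc(1) by simp
      ultimately have "inv g \<otimes> x \<in> N" using bdW[OF W(1) _ s] by simp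
      then have "x \<in> g <# N" using mem_l_coset[OF N(3) g] xc(1) by blast
      then show False using N(2) xc(3) by blast
    qed
    ultimately show ?thesis using xs by simp
  qed
  have gen: "\<forall>x \<in> ?C. x \<otimes> k \<in> ?C" if "k \<in> generate G S" for k
    using that
  proof (induction rule: generate.induct)
    case one
    then show ?case by simp
  next
    case (incl k)
    then show ?case using step by blast
  next
    case (inv k)
    then show ?case using step by blast
  next
    case (eng k1 k2)
    have k: "k1 \<in> carrier G" "k2 \<in> carrier G" using eng.hyps S(3) by simp_all
    show ?case
    proof
      fix x assume x: "x \<in> ?C"
      then have "(x \<otimes> k1) \<otimes> k2 \<in> ?C" using eng.IH by blast
      moreover have "(x \<otimes> k1) \<otimes> k2 = x \<otimes> (k1 \<otimes> k2)" using x k by (intro m_assoc) simp_all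
      ultimately show "x \<otimes> (k1 \<otimes> k2) \<in> ?C" by simp
    qed
  qed
  have "?C = {}"
  proof (rule ccontr)
    assume "?C \<noteq> {}"
    then obtain x where x: "x \<in> ?C" by blast
    obtain w where w: "w \<in> W'" using base_nonempty[OF W(2)] by blast
    then have wc: "w \<in> carrier G" using base_sub[OF W(2)] by blast
    have "inv x \<otimes> w \<in> generate G S" using S(3) x wc by simp
    then have "x \<otimes> (inv x \<otimes> w) \<in> ?C" using gen x by blast
    moreover have "x \<otimes> (inv x \<otimes> w) = w" using x wc by (simp flip: m_assoc)
    ultimately show False using w by simp
  qed
  then show ?thesis by blast
qed

text \<open>If the neighbourhood \<open>?N\<close> of the boundary of \<open>X\<close> lies on one
  side of \<open>gX\<close> and on one side of \<open>g^-1 X\<close>, then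
  \<open>empty_corner\<close> applies. The first can fail only for \<open>g\<close> in
  \<open>H F'^-1 H\<close>, the second only for \<open>g\<close> in \<open>H F' H\<close>; this is
  the origin of \<open>?B\<close>.\<close>

lemma finitely_many_untame:
  "\<exists>B. finite B \<and> B \<subseteq> carrier G \<and>
    (\<forall>g \<in> carrier G. \<forall>W \<in> base. \<forall>W' \<in> base. tame (g <# W) W' \<or> (\<exists>h \<in> H. \<exists>b \<in> B. \<exists>h' \<in> H. g = h \<otimes> (b \<otimes> h')))"
proof -
  let ?R = "S \<union> m_inv G ` S"
  let ?bd = "{x \<in> carrier G. \<exists>s \<in> ?R. (x \<in> X) \<noteq> (x \<otimes> s \<in> X)}"
  have R: "finite ?R" "?R \<subseteq> carrier G" using S by auto
  obtain F where F: "finite F" "F \<subseteq> carrier G" "?bd \<subseteq> H <#> F"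
    using fin_boundary[OF R] unfolding H_finite_iff by blast
  obtain F' where F': "finite F'" "F' \<subseteq> carrier G"
    "\<And>g. g \<in> carrier G \<Longrightarrow> \<forall>h \<in> H. inv g \<otimes> h \<notin> H <#> F' \<Longrightarrow> H <#> F \<subseteq> g <# X \<or> H <#> F \<subseteq> co (g <# X)"
    using neighbourhood_one_side[OF F(1,2)] by blast
  let ?N = "H <#> F"
  let ?B = "F' \<union> m_inv G ` F'"
  have N: "?N \<subseteq> carrier G" by (rule set_mult_closed[OF subgroup.subset[OF H] F(2)])
  have X: "X \<in> base" "co X \<in> base" by (simp_all add: base_def)
  have main: "tame (g <# W) W' \<or> (\<exists>h \<in> H. \<exists>b \<in> ?B. \<exists>h' \<in> H. g = h \<otimes> (b \<otimes> h'))"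
    if g: "g \<in> carrier G" and W: "W \<in> base" "W' \<in> base" for g W W'
  proof (rule disjCI)
    assume no: "\<not> (\<exists>h \<in> H. \<exists>b \<in> ?B. \<exists>h' \<in> H. g = h \<otimes> (b \<otimes> h'))"
    have ig: "inv g \<in> carrier G" using g by simp
    have 1: "\<forall>h \<in> H. inv g \<otimes> h \<notin> H <#> F'"
    proof (intro ballI notI)
      fix h assume h: "h \<in> H" "inv g \<otimes> h \<in> H <#> F'"
      then obtain k f where k: "k \<in> H" "f \<in> F'" "inv g \<otimes> h = k \<otimes> f" unfolding set_mult_def by blast
      have c: "h \<in> carrier G" "k \<in> carrier G" "f \<in> carrier G" using h(1) k F'(2) H_carrier by blast+
      have "h = g \<otimes> (k \<otimes> f)"
      proof -
        have "g \<otimes> (inv g \<otimes> h) = h" using c g by (simp flip: m_assoc)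
        then show ?thesis using k(3) by simp
      qed
      then have "g = h \<otimes> (inv f \<otimes> inv k)"
        using c g by (simp add: m_assoc inv_mult_group flip: inv_mult_group)
      then show False using no h(1) k(1,2) subgroup.m_inv_closed[OF H] by blast
    qed
    have 2: "\<forall>h \<in> H. inv (inv g) \<otimes> h \<notin> H <#> F'"
    proof (intro ballI notI)
      fix h assume h: "h \<in> H" "inv (inv g) \<otimes> h \<in> H <#> F'"
      then obtain k f where k: "k \<in> H" "f \<in> F'" "g \<otimes> h = k \<otimes> f" using g unfolding set_mult_def by auto
      have c: "h \<in> carrier G" "k \<in> carrier G" "f \<in> carrier G" using h(1) k F'(2) H_carrier by blast+
      have "(g \<otimes> h) \<otimes> inv h = g" using c g by (simp add: m_assoc)
      then have "g = k \<otimes> (f \<otimes> inv h)" using k(3) c by (simp add: m_assoc)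
      then show False using no h(1) k(1,2) subgroup.m_inv_closed[OF H] by blast
    qed
    obtain V where V: "V \<in> base" "?N \<subseteq> g <# V"
      using F'(3)[OF g 1] X l_coset_compl[OF X_sub g] by auto
    obtain V' where V': "V' \<in> base" "?N \<subseteq> inv g <# V'"
      using F'(3)[OF ig 2] X l_coset_compl[OF X_sub ig] by auto
    have "g <# ?N \<subseteq> V'"
      using l_coset_mono[OF V'(2), of g] l_coset_inv(2)[OF base_sub[OF V'(1)] g] by simp
    then have corner: "co (g <# V) \<subseteq> V'"
      by (rule empty_corner[OF g V(1) V'(1) F(3) V(2) _ N])
    have "g <# co X = co (g <# X)" by (rule l_coset_compl[OF X_sub g])
    moreover have "g <# X \<subseteq> carrier G" by (rule l_coset_closed[OF X_sub g])
    ultimately show "tame (g <# W) W'"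
      using corner V(1) V'(1) W X_sub unfolding tame_def base_def by auto
  qed
  have "finite ?B" "?B \<subseteq> carrier G" using F'(1,2) by auto
  then show ?thesis by (intro exI[of _ ?B] conjI ballI main)
qed

text \<open>Up to left translation an untame pair is \<open>(bW, W')\<close> with \<open>b\<close>
  in \<open>B\<close>: the factor from \<open>H\<close> to the right of \<open>b\<close> fixes
  \<open>W\<close>, the one to the left can be moved over to \<open>W'\<close>, which it fixes. Left
  translation does not change a constant, so the union of finitely many constants serves for all
  pairs.\<close>

lemma uniform_untame:
  "\<exists>D. finite D \<and> D \<subseteq> carrier G \<and>
    (\<forall>U \<in> translates. \<forall>V \<in> translates. coarse_le U V \<longrightarrow> \<not> tame U V \<longrightarrow> U \<subseteq> V <#> D)"
proof -
  from finitely_many_untame obtain B where B: "finite B" "B \<subseteq> carrier G"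
    "\<forall>g \<in> carrier G. \<forall>W \<in> base. \<forall>W' \<in> base. tame (g <# W) W' \<or>
      (\<exists>h \<in> H. \<exists>b \<in> B. \<exists>h' \<in> H. g = h \<otimes> (b \<otimes> h'))"
    by (elim exE conjE)
  have "\<forall>p. \<exists>D. finite D \<and> D \<subseteq> carrier G \<and> (coarse_le (fst p) (snd p) \<longrightarrow> fst p \<subseteq> snd p <#> D)"
    unfolding coarse_le_def by blast
  from choice[OF this] obtain D' where
    D': "\<forall>p. finite (D' p) \<and> D' p \<subseteq> carrier G \<and> (coarse_le (fst p) (snd p) \<longrightarrow> fst p \<subseteq> snd p <#> D' p)"
    by blast
  define D where "D U V = D' (U, V)" for U V
  have D: "finite (D U V)" "D U V \<subseteq> carrier G" "coarse_le U V \<Longrightarrow> U \<subseteq> V <#> D U V" for U V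
    using D'[THEN spec, of "(U, V)"] by (simp_all add: D_def)
  define E where "E = (\<Union>b\<in>B. \<Union>W\<in>base. \<Union>W'\<in>base. D (b <# W) W')"
  have "finite E" unfolding E_def using B(1) D(1) by (intro finite_UN_I base_finite)
  moreover have "E \<subseteq> carrier G" unfolding E_def using D(2) by blast
  moreover have "U \<subseteq> V <#> E" if UV: "U \<in> translates" "V \<in> translates" "coarse_le U V" "\<not> tame U V" for U V
  proof -
    obtain g W where g: "g \<in> carrier G" "W \<in> base" "U = g <# W" using UV(1) by (rule translateE)
    obtain k W' where k: "k \<in> carrier G" "W' \<in> base" "V = k <# W'" using UV(2) by (rule translateE)
    note sub = base_sub[OF g(2)] base_sub[OF k(2)]
    let ?g = "inv k \<otimes> g"
    have gc: "?g \<in> carrier G" using g k by simp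
    have U: "U = k <# (?g <# W)"
    proof -
      have "k \<otimes> ?g = g" using g k by (simp flip: m_assoc)
      then show ?thesis using l_coset_mult[OF sub(1) k(1) gc] g(3) by simp
    qed
    note gW = l_coset_closed[OF sub(1) gc]
    have "tame U V" if "tame (?g <# W) W'"
      using that l_coset_mono[of "?g <# W" W' k] l_coset_mono[of W' "?g <# W" k]
        l_coset_mono[of "?g <# W" "co W'" k] l_coset_mono[of "co W'" "?g <# W" k]
        l_coset_compl[OF sub(2) k(1)] U k(3) unfolding tame_def by auto
    then have "\<exists>h \<in> H. \<exists>b \<in> B. \<exists>h' \<in> H. ?g = h \<otimes> (b \<otimes> h')"
      using bspec[OF bspec[OF bspec[OF B(3) gc] g(2)] k(2)] UV(4) by argo
    then obtain h b h' where h: "h \<in> H" "b \<in> B" "h' \<in> H" "?g = h \<otimes> (b \<otimes> h')"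
      by (elim bexE)
    have c: "h \<in> carrier G" "b \<in> carrier G" "h' \<in> carrier G" using h B(2) H_carrier by blast+
    have bW: "b <# W \<subseteq> carrier G" by (rule l_coset_closed[OF sub(1) c(2)])
    have gW_eq: "?g <# W = h <# (b <# W)"
    proof -
      have "?g <# W = h <# ((b \<otimes> h') <# W)" unfolding h(4) using c by (intro l_coset_mult[OF sub(1)]) simp_all
      also have "(b \<otimes> h') <# W = b <# (h' <# W)" by (rule l_coset_mult[OF sub(1) c(2,3)])
      finally show ?thesis using base_stab[OF h(3) g(2)] by simp
    qed
    have W'_eq: "h <# W' = W'" by (rule base_stab[OF h(1) k(2)])
    have "coarse_le (?g <# W) W'"
      using coarse_le_act_iff[OF gW sub(2) k(1)] UV(3) U k(3) by simp
    then have "coarse_le (h <# (b <# W)) (h <# W')" using gW_eq W'_eq by simp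
    then have "coarse_le (b <# W) W'" using coarse_le_act_iff[OF bW sub(2) c(1)] by simp
    then have "b <# W \<subseteq> W' <#> D (b <# W) W'" by (rule D(3))
    also have "\<dots> \<subseteq> W' <#> E"
      by (rule set_mult_mono) (use g(2) k(2) h(2) in \<open>auto simp: E_def\<close>)
    finally have "h <# (b <# W) \<subseteq> h <# (W' <#> E)" by (rule l_coset_mono)
    then have "?g <# W \<subseteq> W' <#> E"
      using l_coset_set_mult[OF sub(2) \<open>E \<subseteq> carrier G\<close> c(1)] gW_eq W'_eq by simp
    then have "k <# (?g <# W) \<subseteq> k <# (W' <#> E)" by (rule l_coset_mono)
    then show ?thesis
      using l_coset_set_mult[OF sub(2) \<open>E \<subseteq> carrier G\<close> k(1)] U k(3) by simp
  qed
  ultimately show ?thesis by blast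
qed

end

section \<open>Refining coarse inclusion\<close>

text \<open>Stands in for \<open>card P - card Q\<close> when both sets are infinite; it is
  meaningful if the two differences are finite.\<close>

definition card_diff :: "'b set \<Rightarrow> 'b set \<Rightarrow> int" where
  "card_diff P Q = int (card (P - Q)) - int (card (Q - P))"

lemma card_diff_swap: "card_diff Q P = - card_diff P Q"
  by (simp add: card_diff_def)

text \<open>In a finite window that contains both differences, the relative count is a true
  difference of cardinalities; this is the source of additivity.\<close>

lemma card_diff_window:
  assumes "finite M" "P - Q \<subseteq> M" "Q - P \<subseteq> M"
  shows "card_diff P Q = int (card (P \<inter> M)) - int (card (Q \<inter> M))"
proof -
  have "card (A \<inter> M) = card (A - B) + card (A \<inter> B \<inter> M)" if "A - B \<subseteq> M" for A B
  proof -
    have "A \<inter> M = (A - B) \<union> (A \<inter> B \<inter> M)" using that by blast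
    moreover have "finite (A - B)" using that assms(1) by (rule finite_subset)
    moreover have "(A - B) \<inter> (A \<inter> B \<inter> M) = {}" by blast
    ultimately show ?thesis using assms(1) by (simp add: card_Un_disjoint)
  qed
  from this[of P Q] this[of Q P] show ?thesis
    using assms by (simp add: card_diff_def Int_commute)
qed

lemma card_diff_add:
  assumes "finite (P - Q)" "finite (Q - P)" "finite (Q - R)" "finite (R - Q)"
  shows "card_diff P R = card_diff P Q + card_diff Q R"
proof -
  let ?M = "(P - Q) \<union> (Q - P) \<union> (Q - R) \<union> (R - Q)"
  have M: "finite ?M" using assms by simp
  have "card_diff P Q = int (card (P \<inter> ?M)) - int (card (Q \<inter> ?M))"
    "card_diff Q R = int (card (Q \<inter> ?M)) - int (card (R \<inter> ?M))"
    "card_diff P R = int (card (P \<inter> ?M)) - int (card (R \<inter> ?M))"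
    by (rule card_diff_window[OF M]; blast)+
  then show ?thesis by simp
qed

lemma card_diff_image:
  assumes "inj_on f A" "P \<subseteq> A" "Q \<subseteq> A"
  shows "card_diff (f ` P) (f ` Q) = card_diff P Q"
proof -
  have "f ` P - f ` Q = f ` (P - Q)" "f ` Q - f ` P = f ` (Q - P)"
    using inj_on_image_set_diff[OF assms(1)] assms(2,3) by blast+
  moreover have "card (f ` (P - Q)) = card (P - Q)" "card (f ` (Q - P)) = card (Q - P)"
    by (rule card_image, rule inj_on_subset[OF assms(1)], use assms(2,3) in blast)+
  ultimately show ?thesis by (simp add: card_diff_def)
qed

context noncrossing_set
begin

definition sim where "sim U V \<longleftrightarrow> coarse_le U V \<and> coarse_le V U"
text \<open>This set may be infinite, as it is for \<open>G = \<int>\<close> and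
  \<open>X = \<nat>\<close>; only its change between equivalent translates is finite.\<close>

definition low where "low U = {L \<in> translates. sim L U \<and> L \<subset> U}"

text \<open>For equivalent translates, the signed number of translates by which one has to move from \<open>U\<close>
  to reach \<open>V\<close>. It is needed since equivalent translates may be strictly nested, as for \<open>G = \<int>\<close>
  and \<open>X = \<nat>\<close>, and coarse inclusion does not displacementinguish them.\<close>

definition displacement where "displacement U V = card_diff (low V) (low U) + card_diff (low (co U)) (low (co V))"

definition ord where "ord U V \<longleftrightarrow> coarse_le U V \<and> (coarse_le V U \<longrightarrow> displacement U V \<ge> 0)"

lemma coarse_refl: "U \<in> translates \<Longrightarrow> coarse_le U U"
  using coarse_le_subset translates_sub by blast

lemma coarse_trans: "coarse_le U V \<Longrightarrow> coarse_le V W \<Longrightarrow> W \<in> translates \<Longrightarrow> coarse_le U W"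
  using coarse_le_trans translates_sub by blast

lemma coarse_act_iff: "U \<in> translates \<Longrightarrow> V \<in> translates \<Longrightarrow> g \<in> carrier G \<Longrightarrow>
    coarse_le (g <# U) (g <# V) \<longleftrightarrow> coarse_le U V"
  by (rule coarse_le_act_iff[OF translates_sub translates_sub])

lemma coarse_co_iff: "U \<in> translates \<Longrightarrow> V \<in> translates \<Longrightarrow> coarse_le (co U) (co V) \<longleftrightarrow> coarse_le V U"
  using coarse_le_dual[of V U] coarse_le_dual[of "co U" "co V"] translates_co translates_co_co by auto

lemma sim_sym: "sim U V \<Longrightarrow> sim V U"
  by (auto simp: sim_def)

lemma sim_trans: "sim U V \<Longrightarrow> sim V W \<Longrightarrow> U \<in> translates \<Longrightarrow> W \<in> translates \<Longrightarrow> sim U W"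
  unfolding sim_def using coarse_trans by blast

lemma act_psubset_iff:
  "U \<in> translates \<Longrightarrow> V \<in> translates \<Longrightarrow> g \<in> carrier G \<Longrightarrow> g <# U \<subset> g <# V \<longleftrightarrow> U \<subset> V"
  unfolding less_le_not_le using l_coset_subset_iff translates_sub by metis

lemma act_cancel:
  "U \<in> translates \<Longrightarrow> g \<in> carrier G \<Longrightarrow> g <# (inv g <# U) = U"
  "U \<in> translates \<Longrightarrow> g \<in> carrier G \<Longrightarrow> inv g <# (g <# U) = U"
  using l_coset_inv translates_sub by simp_all

lemma low_act:
  assumes U: "U \<in> translates" and g: "g \<in> carrier G"
  shows "low (g <# U) = (\<lambda>L. g <# L) ` low U"
proof -
  have ig: "inv g \<in> carrier G" using g by simp
  have iff: "g <# L \<in> low (g <# U) \<longleftrightarrow> L \<in> low U" if "L \<in> translates" for L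
    using that U g translates_act coarse_act_iff act_psubset_iff
    by (simp add: low_def sim_def)
  show ?thesis
  proof (intro equalityI subsetI)
    fix L assume L: "L \<in> low (g <# U)"
    then have t: "L \<in> translates" by (simp add: low_def)
    then have "inv g <# L \<in> low U" using iff[OF translates_act[OF t ig]] L act_cancel(1)[OF t g] by simp
    then show "L \<in> (\<lambda>L. g <# L) ` low U" using act_cancel(1)[OF t g] by (metis image_eqI)
  next
    fix L assume "L \<in> (\<lambda>L. g <# L) ` low U"
    then obtain K where K: "K \<in> low U" "L = g <# K" by blast
    then have "K \<in> translates" by (simp add: low_def)
    then show "L \<in> low (g <# U)" using iff K by blast
  qed
qed

text \<open>If \<open>L\<close> in the difference has an empty corner with \<open>V\<close>,
  equivalence leaves only \<open>V \<subseteq> L\<close>, because \<open>L \<subset> V\<close> would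
  put \<open>L\<close> into \<open>low V\<close>; then \<open>L\<close> contains a fixed
  \<open>x \<in> V\<close> and misses a fixed \<open>y \<notin> U\<close>. Otherwise the uniform
  constant squeezes \<open>L\<close> around \<open>V\<close>. Either way there are finitely
  many.\<close>

lemma finite_low_diff:
  assumes U: "U \<in> translates" and V: "V \<in> translates" and UV: "sim U V"
  shows "finite (low U - low V)"
proof -
  obtain D where D: "finite D" "D \<subseteq> carrier G"
    "\<forall>U \<in> translates. \<forall>V \<in> translates. coarse_le U V \<longrightarrow> \<not> tame U V \<longrightarrow> U \<subseteq> V <#> D"
    using uniform_untame by (elim exE conjE)
  have sub: "U \<subseteq> carrier G" "V \<subseteq> carrier G" using translates_sub U V by simp_all
  have "V \<noteq> {}" using not_coarse_le_co[OF V] coarse_le_subset[of V "co V"] by auto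
  then obtain x where x: "x \<in> V" by blast
  have "co U \<noteq> {}"
    using not_coarse_le_co[OF translates_co[OF U]] coarse_le_subset[of "co U" "co (co U)"] by auto
  then obtain y where y: "y \<in> co U" by blast
  have fin: "finite ({V} \<union> {L \<in> translates. x \<in> L \<and> y \<notin> L} \<union> {L \<in> translates. L \<subseteq> V <#> D \<and> co L \<subseteq> co V <#> D})"
    using finite_separating[of x y] x y sub finite_between[OF V V D(1,2)] by blast
  have "low U - low V \<subseteq> {V} \<union> {L \<in> translates. x \<in> L \<and> y \<notin> L} \<union> {L \<in> translates. L \<subseteq> V <#> D \<and> co L \<subseteq> co V <#> D}"
  proof
    fix L assume "L \<in> low U - low V"
    then have L: "L \<in> translates" "sim L U" "L \<subset> U" "L \<notin> low V" by (auto simp: low_def)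
    have LV: "sim L V" using sim_trans[OF L(2) UV L(1) V] .
    then have le: "coarse_le L V" "coarse_le V L" by (simp_all add: sim_def)
    have no: "\<not> L \<subset> V" using L(1,4) LV by (simp add: low_def)
    show "L \<in> {V} \<union> {L \<in> translates. x \<in> L \<and> y \<notin> L} \<union> {L \<in> translates. L \<subseteq> V <#> D \<and> co L \<subseteq> co V <#> D}"
    proof (cases "tame L V")
      case True
      then consider "L \<subseteq> V" | "V \<subseteq> L" | "L \<subseteq> co V" | "co V \<subseteq> L" unfolding tame_def by blast
      then show ?thesis
      proof cases
        case 1
        then show ?thesis using no by blast
      next
        case 2
        then have "x \<in> L" "y \<notin> L" using x y L(3) by blast+
        then show ?thesis using L(1) by blast
      next
        case 3
        then have "coarse_le L (co V)" by (rule coarse_le_subset) auto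
        then show ?thesis using coarse_le_not_both[OF L(1) V le(1)] by blast
      next
        case 4
        then have "coarse_le (co V) L" by (rule coarse_le_subset[OF _ translates_sub[OF L(1)]])
        then have "coarse_le (co V) V" using coarse_trans[OF _ le(1) V] by blast
        then show ?thesis using not_coarse_le_co[OF translates_co[OF V]] translates_co_co[OF V] by simp
      qed
    next
      case False
      have "L \<subseteq> V <#> D" using D(3) L(1) V le(1) False by blast
      moreover have "co L \<subseteq> co V <#> D"
      proof -
        have "\<not> tame (co L) (co V)"
          using False translates_sub[OF L(1)] sub(2) unfolding tame_def by blast
        moreover have "coarse_le (co L) (co V)" using coarse_co_iff[OF L(1) V] le(2) by simp
        ultimately show ?thesis using D(3) translates_co[OF L(1)] translates_co[OF V] by blast
      qed
      ultimately show ?thesis using L(1) by blast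
    qed
  qed
  then show ?thesis using fin by (rule finite_subset)
qed

lemma sim_co: "sim U V \<Longrightarrow> U \<in> translates \<Longrightarrow> V \<in> translates \<Longrightarrow> sim (co U) (co V)"
  by (simp add: sim_def coarse_co_iff)

lemma displacement_add:
  assumes "U \<in> translates" "V \<in> translates" "W \<in> translates" "sim U V" "sim V W"
  shows "displacement U W = displacement U V + displacement V W"
proof -
  have add: "card_diff (low U) (low W) = card_diff (low U) (low V) + card_diff (low V) (low W)"
    if "U \<in> translates" "V \<in> translates" "W \<in> translates" "sim U V" "sim V W" for U V W
    by (intro card_diff_add finite_low_diff that sim_sym[OF that(4)] sim_sym[OF that(5)])
  show ?thesis
    using add[OF assms(3,2,1) sim_sym[OF assms(5)] sim_sym[OF assms(4)]]
      add[OF translates_co[OF assms(1)] translates_co[OF assms(2)] translates_co[OF assms(3)]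
        sim_co[OF assms(4,1,2)] sim_co[OF assms(5,2,3)]]
    by (simp add: displacement_def)
qed

lemma displacement_swap: "displacement V U = - displacement U V"
  using card_diff_swap[of "low V" "low U"] card_diff_swap[of "low (co U)" "low (co V)"]
  by (simp add: displacement_def)

text \<open>Complementation exchanges the two summands of \<open>displacement\<close>; this
  symmetry, needed for reversing edges, is the reason for having both.\<close>

lemma displacement_co:
  "U \<in> translates \<Longrightarrow> V \<in> translates \<Longrightarrow> displacement (co V) (co U) = displacement U V"
  by (simp add: displacement_def translates_co_co)

lemma displacement_act:
  assumes "U \<in> translates" "V \<in> translates" "g \<in> carrier G"
  shows "displacement (g <# U) (g <# V) = displacement U V"
proof -
  have inj: "inj_on (\<lambda>L. g <# L) translates"
    by (rule inj_on_inverseI[where g = "\<lambda>L. inv g <# L"]) (simp add: act_cancel assms(3))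
  have sub: "low A \<subseteq> translates" for A
    by (auto simp: low_def)
  have low: "card_diff (low (g <# A)) (low (g <# B)) = card_diff (low A) (low B)"
    if "A \<in> translates" "B \<in> translates" for A B
    unfolding low_act[OF that(1) assms(3)] low_act[OF that(2) assms(3)]
    by (rule card_diff_image[OF inj sub sub])
  show ?thesis
    using low[OF assms(2,1)] low[OF translates_co[OF assms(1)] translates_co[OF assms(2)]]
      translates_act_co[OF assms(1,3)] translates_act_co[OF assms(2,3)]
    by (simp add: displacement_def)
qed

lemma low_mono:
  assumes "V \<in> translates" "sim U V" "U \<subseteq> V"
  shows "low U \<subseteq> low V"
proof
  fix L assume "L \<in> low U"
  then have L: "L \<in> translates" "sim L U" "L \<subset> U" by (simp_all add: low_def)
  have "sim L V" by (rule sim_trans[OF L(2) assms(2) L(1) assms(1)])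
  then show "L \<in> low V" using L assms(3) by (auto simp: low_def)
qed

text \<open>From \<open>U\<close> to the larger \<open>V\<close> the set \<open>low\<close> loses
  nothing and gains \<open>U\<close> itself; the summand for the complements is non-negative by the
  same monotonicity.\<close>

lemma displacement_psubset:
  assumes "U \<in> translates" "V \<in> translates" "sim U V" "U \<subset> V"
  shows "displacement U V > 0"
proof -
  have "low U \<subseteq> low V" using low_mono[OF assms(2,3)] assms(4) by blast
  moreover have "low (co V) \<subseteq> low (co U)"
    by (rule low_mono[OF translates_co[OF assms(1)] sim_co[OF sim_sym[OF assms(3)] assms(2,1)]])
      (use assms(4) in blast)
  moreover have "U \<in> low V - low U" using assms by (auto simp: low_def)
  then have "card (low V - low U) > 0"
    using finite_low_diff[OF assms(2,1) sim_sym[OF assms(3)]] card_gt_0_iff by blast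
  ultimately show ?thesis
    by (simp add: displacement_def card_diff_def Diff_eq_empty_iff[THEN iffD2])
qed

section \<open>The refined order on translates\<close>

lemma ord_coarse: "ord U V \<Longrightarrow> coarse_le U V"
  by (simp add: ord_def)

lemma ord_refl: "U \<in> translates \<Longrightarrow> ord U U"
  by (simp add: ord_def coarse_refl displacement_def card_diff_def)

lemma ord_trans:
  assumes "ord U V" "ord V W" "U \<in> translates" "V \<in> translates" "W \<in> translates"
  shows "ord U W"
proof -
  have le: "coarse_le U V" "coarse_le V W" using assms(1,2) ord_coarse by blast+
  have "displacement U W \<ge> 0" if "coarse_le W U"
  proof -
    have "coarse_le V U" "coarse_le W V" using coarse_trans that le assms(3-5) by blast+
    then show ?thesis
      using displacement_add[OF assms(3-5)] le assms(1,2) by (simp add: ord_def sim_def)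
  qed
  then show ?thesis using coarse_trans[OF le assms(5)] by (simp add: ord_def)
qed

lemma ord_co: "ord U V \<Longrightarrow> U \<in> translates \<Longrightarrow> V \<in> translates \<Longrightarrow> ord (co V) (co U)"
  by (simp add: ord_def coarse_co_iff displacement_co)

lemma ord_act: "ord U V \<Longrightarrow> g \<in> carrier G \<Longrightarrow> U \<in> translates \<Longrightarrow> V \<in> translates \<Longrightarrow> ord (g <# U) (g <# V)"
  by (simp add: ord_def coarse_act_iff displacement_act)

lemma coarse_imp_ord: "coarse_le U V \<Longrightarrow> ord U V \<or> ord V U"
  using displacement_swap[of V U] by (auto simp: ord_def)

lemma ord_nested:
  assumes U: "U \<in> translates" and V: "V \<in> translates"
  shows "ord U V \<or> ord V U \<or> ord U (co V) \<or> ord (co V) U"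
  using coarse_le_nested[OF assms] coarse_imp_ord by blast

lemma ord_not_both:
  "ord U V \<Longrightarrow> ord U (co V) \<Longrightarrow> U \<in> translates \<Longrightarrow> V \<in> translates \<Longrightarrow> False"
  using coarse_le_not_both ord_coarse by blast

text \<open>If \<open>U\<close> and \<open>V\<close> have an empty corner, \<open>ord U V\<close> is
  inclusion: \<open>V \<subset> U\<close> is excluded by \<open>displacement_psubset\<close>, and
  the corners with complements contradict coarse inclusion. There \<open>\<one>\<close> is constant
  enough; all other pairs are covered by \<open>uniform_untame\<close>.\<close>

lemma uniform_ord:
  "\<exists>D. finite D \<and> D \<subseteq> carrier G \<and> (\<forall>U \<in> translates. \<forall>V \<in> translates. ord U V \<longrightarrow> U \<subseteq> V <#> D)"
proof -
  obtain D where D: "finite D" "D \<subseteq> carrier G"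
    "\<forall>U \<in> translates. \<forall>V \<in> translates. coarse_le U V \<longrightarrow> \<not> tame U V \<longrightarrow> U \<subseteq> V <#> D"
    using uniform_untame by (elim exE conjE)
  have "U \<subseteq> V <#> insert \<one> D" if U: "U \<in> translates" and V: "V \<in> translates" and UV: "ord U V" for U V
  proof (cases "tame U V")
    case True
    note le = ord_coarse[OF UV]
    from True consider "U \<subseteq> V" | "V \<subset> U" | "U \<subseteq> co V" | "co V \<subseteq> U" unfolding tame_def by blast
    then show ?thesis
    proof cases
      case 1
      also have "V \<subseteq> V <#> insert \<one> D" by (rule subset_set_mult_one[OF translates_sub[OF V]]) simp
      finally show ?thesis .
    next
      case 2
      then have VU: "coarse_le V U" using coarse_le_subset translates_sub[OF U] by blast
      then have "displacement V U > 0" using displacement_psubset[OF V U _ 2] le by (simp add: sim_def)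
      then show ?thesis using UV VU displacement_swap[of V U] by (simp add: ord_def)
    next
      case 3
      then have "coarse_le U (co V)" by (rule coarse_le_subset) auto
      then show ?thesis using coarse_le_not_both[OF U V le] by blast
    next
      case 4
      then have "coarse_le (co V) U" by (rule coarse_le_subset[OF _ translates_sub[OF U]])
      then have "coarse_le (co V) V" using coarse_trans[OF _ le V] by blast
      then show ?thesis using not_coarse_le_co[OF translates_co[OF V]] translates_co_co[OF V] by simp
    qed
  next
    case False
    then have "U \<subseteq> V <#> D" using D(3) U V ord_coarse[OF UV] by blast
    also have "\<dots> \<subseteq> V <#> insert \<one> D" by (rule set_mult_mono) auto
    finally show ?thesis .
  qed
  moreover have "finite (insert \<one> D)" "insert \<one> D \<subseteq> carrier G" using D by simp_all
  ultimately show ?thesis by blast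
qed

lemma X_translate: "X \<in> translates"
  by (rule base_translates) (simp add: base_def)

lemma ord_finite_interval:
  assumes U: "U \<in> translates" and V: "V \<in> translates"
  shows "finite {L \<in> translates. ord U L \<and> ord L V}"
proof -
  obtain D where D: "finite D" "D \<subseteq> carrier G"
    "\<forall>U \<in> translates. \<forall>V \<in> translates. ord U V \<longrightarrow> U \<subseteq> V <#> D"
    using uniform_ord by (elim exE conjE)
  have "L \<subseteq> V <#> D \<and> co L \<subseteq> co U <#> D" if L: "L \<in> translates" "ord U L" "ord L V" for L
    using D(3) L V ord_co[OF L(2) U L(1)] translates_co[OF U] translates_co[OF L(1)] by blast
  then have "{L \<in> translates. ord U L \<and> ord L V} \<subseteq> {L \<in> translates. L \<subseteq> V <#> D \<and> co L \<subseteq> co U <#> D}"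
    by blast
  then show ?thesis by (rule finite_subset[OF _ finite_between[OF U V D(1,2)]])
qed

lemma translate_orbit:
  assumes "U \<in> translates"
  shows "\<exists>g \<in> carrier G. U = g <# X \<or> U = co (g <# X)"
proof -
  obtain g W where g: "g \<in> carrier G" "W \<in> base" "U = g <# W" using assms by (rule translateE)
  then show ?thesis using l_coset_compl[OF X_sub g(1)] by (auto simp: base_def)
qed

sublocale edges: edge_system G translates ord "\<lambda>U. co U" "\<lambda>g U. g <# U" X
proof (unfold_locales, goal_cases)
  case 1 then show ?case by (rule X_translate)
next
  case (2 g U) then show ?case by (rule translates_act[rotated])
next
  case (3 g h U) then show ?case by (intro l_coset_mult translates_sub)
next
  case (4 U) then show ?case by (intro lcos_mult_one translates_sub)
next
  case (5 U) then show ?case by (rule translates_co)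
next
  case (6 U) then show ?case by (rule translates_co_co)
next
  case (7 g U) then show ?case by (intro translates_act_co)
next
  case (8 U) then show ?case by (rule ord_refl)
next
  case (9 U V W) then show ?case by (rule ord_trans)
next
  case (10 U V) then show ?case by (rule ord_co)
next
  case (11 U V g) then show ?case by (rule ord_act)
next
  case (12 U V) then show ?case by (rule ord_nested)
next
  case (13 U V) then show ?case by (rule ord_not_both)
next
  case (14 U V) then show ?case by (rule ord_finite_interval)
next
  case (15 U) then show ?case by (rule translate_orbit)
qed

end

section \<open>The splitting\<close>

context noncrossing_set
begin

lemma stab_iff: "g \<in> edges.stab \<longleftrightarrow> g \<in> carrier G \<and> ord (g <# X) X \<and> ord X (g <# X)"
  by (auto simp: edges.stab_def edges.eqv_def)

lemma complement_far_iff: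
  "g \<in> carrier G - edges.far \<longleftrightarrow> g \<in> carrier G \<and> (ord (g <# X) X \<or> ord (co (g <# X)) X)"
  using edges.notin_far[of g] by (auto simp: edges.bel_def)

lemma H_sub_stab: "H \<subseteq> edges.stab"
proof
  fix h assume h: "h \<in> H"
  have "h <# X = X" by (rule base_stab[OF h]) (simp add: base_def)
  then show "h \<in> edges.stab" using stab_iff H_carrier[OF h] ord_refl[OF X_translate] by simp
qed

text \<open>Equivalent edges are uniformly close, so for \<open>g\<close> in the stabilizer
  \<open>g^-1 X\<close> contains a fixed \<open>x\<close> and misses a fixed \<open>y\<close>. Then
  \<open>g x\<close> is a point of \<open>X\<close> that \<open>x^-1 y\<close> moves out of
  \<open>X\<close>, and such points form an \<open>H\<close>-finite set.\<close>

lemma fin_stab: "fin edges.stab"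
proof -
  obtain D where D: "finite D" "D \<subseteq> carrier G"
    "\<forall>U \<in> translates. \<forall>V \<in> translates. ord U V \<longrightarrow> U \<subseteq> V <#> D"
    using uniform_ord by (elim exE conjE)
  obtain y where y: "y \<in> carrier G" "y \<notin> X <#> D" using translate_not_all[OF X_translate D(1,2)] .
  obtain x where x: "x \<in> carrier G" "x \<notin> co X <#> D"
    using translate_not_all[OF translates_co[OF X_translate] D(1,2)] .
  let ?z = "inv x \<otimes> y"
  have z: "?z \<in> carrier G" using x y by simp
  have "g \<in> {w \<in> X. w \<otimes> ?z \<notin> X} #> inv x" if g: "g \<in> edges.stab" for g
  proof -
    have "inv g \<in> edges.stab" using subgroup.m_inv_closed[OF edges.stab_subgroup g] .
    then have ig: "inv g \<in> carrier G" "ord (inv g <# X) X" "ord X (inv g <# X)" using stab_iff by blast+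
    have gc: "g \<in> carrier G" using g stab_iff by blast
    note t = translates_act[OF X_translate ig(1)]
    have "inv g <# X \<subseteq> X <#> D" using D(3) t X_translate ig(2) by blast
    then have yn: "y \<notin> inv g <# X" using y(2) by blast
    have "co (inv g <# X) \<subseteq> co X <#> D"
      using D(3) translates_co[OF t] translates_co[OF X_translate] ord_co[OF ig(3) X_translate t] by blast
    then have "x \<in> inv g <# X" using x by blast
    then have "g \<otimes> x \<in> X" using mem_l_coset[OF X_sub ig(1), of x] gc by simp
    moreover have "g \<otimes> y \<notin> X" using mem_l_coset[OF X_sub ig(1), of y] gc y(1) yn by simp
    moreover have "(g \<otimes> x) \<otimes> ?z = g \<otimes> y"
    proof -
      have "x \<otimes> (inv x \<otimes> y) = y" using x y by (simp flip: m_assoc)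
      then show ?thesis using gc x(1) y(1) by (simp add: m_assoc)
    qed
    ultimately have "g \<otimes> x \<in> {w \<in> X. w \<otimes> ?z \<notin> X}" by simp
    moreover have "g = (g \<otimes> x) \<otimes> inv x" using gc x(1) by (simp add: m_assoc)
    ultimately show ?thesis unfolding r_coset_def by blast
  qed
  then have "edges.stab \<subseteq> {w \<in> X. w \<otimes> ?z \<notin> X} #> inv x" by blast
  moreover have "fin ({w \<in> X. w \<otimes> ?z \<notin> X} #> inv x)"
    by (rule H_finite_right[OF base_shift[OF _ z] subgroup.subset[OF H]]) (use x(1) in \<open>simp_all add: base_def\<close>)
  ultimately show ?thesis using H_finite_subset by blast
qed

lemma commensurable_stab: "commensurable G H edges.stab"
proof -
  note sub = subgroup.subset[OF edges.stab_subgroup]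
  have "fin H" using H_finite_subset[OF fin_stab H_sub_stab] .
  then have "finite_index G H H" "finite_index G H edges.stab"
    using finite_index_iff[OF H subset_refl subgroup.subset[OF H]]
      finite_index_iff[OF H H_sub_stab sub] fin_stab by simp_all
  moreover have "H \<inter> edges.stab = H" using H_sub_stab by blast
  ultimately show ?thesis by (simp add: commensurable_def)
qed

text \<open>Fix \<open>x0\<close> in \<open>X\<close> and \<open>y0\<close> outside. If
  \<open>gX\<close> or its complement is below \<open>V\<close>, then \<open>g x0\<close> or
  \<open>g y0\<close> lies in \<open>V <#> D\<close>, so \<open>g\<close> is at bounded distance
  from \<open>V\<close>. For \<open>g\<close> in the symmetric difference this holds with
  \<open>V\<close> the side of \<open>X\<close> that does not contain \<open>g\<close>; hence
  \<open>g\<close> lies near the boundary of \<open>X\<close>.\<close>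

lemma fin_sym_diff: "fin (sym_diff X (carrier G - edges.far))"
proof -
  obtain D where D: "finite D" "D \<subseteq> carrier G"
    "\<forall>U \<in> translates. \<forall>V \<in> translates. ord U V \<longrightarrow> U \<subseteq> V <#> D"
    using uniform_ord by (elim exE conjE)
  have X: "X \<in> base" "co X \<in> base" by (simp_all add: base_def)
  obtain x0 where x0: "x0 \<in> X" using base_nonempty[OF X(1)] by blast
  obtain y0 where y0: "y0 \<in> co X" using base_nonempty[OF X(2)] by blast
  have c: "x0 \<in> carrier G" "y0 \<in> carrier G" using x0 y0 X_sub by blast+
  let ?E = "D <#> {inv x0, inv y0}"
  have E: "finite ?E" "?E \<subseteq> carrier G"
    using finite_set_mult[OF D(1)] set_mult_closed[OF D(2), of "{inv x0, inv y0}"] c by simp_all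
  have near: "g \<in> V <#> ?E"
    if g: "g \<in> carrier G" and V: "V \<in> translates" and le: "ord (g <# X) V \<or> ord (co (g <# X)) V" for g V
  proof -
    have "\<exists>w \<in> {x0, y0}. g \<otimes> w \<in> V <#> D"
    proof (rule disjE[OF le])
      assume "ord (g <# X) V"
      then have "g <# X \<subseteq> V <#> D" using D(3) translates_act[OF X_translate g] V by blast
      moreover have "g \<otimes> x0 \<in> g <# X" using x0 unfolding l_coset_def by blast
      ultimately show ?thesis by blast
    next
      assume "ord (co (g <# X)) V"
      then have "co (g <# X) \<subseteq> V <#> D"
        using D(3) translates_co[OF translates_act[OF X_translate g]] V by blast
      moreover have "g \<otimes> y0 \<in> g <# co X" using y0 unfolding l_coset_def by blast
      ultimately show ?thesis using l_coset_compl[OF X_sub g] by blast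
    qed
    then obtain w where w: "w \<in> {x0, y0}" "g \<otimes> w \<in> V <#> D" by blast
    have wc: "w \<in> carrier G" using w(1) c by blast
    have "g = (g \<otimes> w) \<otimes> inv w" using g wc by (simp add: m_assoc)
    moreover have "inv w \<in> {inv x0, inv y0}" using w(1) by blast
    ultimately have "g \<in> (V <#> D) <#> {inv x0, inv y0}" using w(2) unfolding set_mult_def by blast
    then show ?thesis
      using set_mult_assoc[OF translates_sub[OF V] D(2), of "{inv x0, inv y0}"] c by simp
  qed
  have coX: "co X \<in> translates" "co (co X) = X" using translates_co translates_co_co X_translate by simp_all
  have "sym_diff X (carrier G - edges.far) \<subseteq> (X \<inter> (co X <#> ?E)) \<union> (co X \<inter> (co (co X) <#> ?E))"
  proof
    fix g assume "g \<in> sym_diff X (carrier G - edges.far)"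
    then consider "g \<in> X" "g \<notin> carrier G - edges.far" | "g \<in> carrier G - edges.far" "g \<notin> X" by blast
    then show "g \<in> (X \<inter> (co X <#> ?E)) \<union> (co X \<inter> (co (co X) <#> ?E))"
    proof cases
      case 1
      have g: "g \<in> carrier G" using 1(1) X_sub by blast
      note t = translates_act[OF X_translate g]
      have no: "\<not> ord (g <# X) X" "\<not> ord (co (g <# X)) X" using 1(2) g complement_far_iff by blast+
      have "ord (g <# X) (co X) \<or> ord (co (g <# X)) (co X)"
        using ord_nested[OF t X_translate] no ord_co[OF _ X_translate t] ord_co[OF _ coX(1) t] coX(2) by auto
      then have "g \<in> co X <#> ?E" by (rule near[OF g coX(1)])
      then show ?thesis using 1(1) by blast
    next
      case 2
      then have g: "g \<in> carrier G" "ord (g <# X) X \<or> ord (co (g <# X)) X" using complement_far_iff by blast+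
      have "g \<in> X <#> ?E" by (rule near[OF g(1) X_translate g(2)])
      then show ?thesis using 2(2) g(1) coX(2) by simp
    qed
  qed
  moreover have "fin ((X \<inter> (co X <#> ?E)) \<union> (co X \<inter> (co (co X) <#> ?E)))"
    by (intro H_finite_Un base_boundary X E)
  ultimately show ?thesis by (rule H_finite_subset[rotated])
qed

lemma stab_invariant:
  assumes k: "k \<in> edges.stab"
  shows "k <# (carrier G - edges.far) = carrier G - edges.far"
proof -
  let ?Y = "carrier G - edges.far"
  have Yc: "?Y \<subseteq> carrier G" by blast
  have move: "k \<otimes> g \<in> ?Y" if k: "k \<in> edges.stab" and g: "g \<in> ?Y" for k g
  proof -
    have kc: "k \<in> carrier G" "ord (k <# X) X" using k stab_iff by blast+
    have gc: "g \<in> carrier G" "ord (g <# X) X \<or> ord (co (g <# X)) X" using g complement_far_iff by blast+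
    note t = translates_act[OF X_translate kc(1)] translates_act[OF X_translate gc(1)]
    have "ord (k <# U) X" if "ord U X" "U \<in> translates" for U
      by (rule ord_trans[OF ord_act[OF that(1) kc(1) that(2) X_translate] kc(2)
            translates_act[OF that(2) kc(1)] t(1) X_translate])
    then have "ord (k <# (g <# X)) X \<or> ord (k <# co (g <# X)) X"
      using gc(2) t(2) translates_co by blast
    moreover have "k <# (g <# X) = (k \<otimes> g) <# X" by (rule l_coset_mult[OF X_sub kc(1) gc(1), symmetric])
    ultimately have "ord ((k \<otimes> g) <# X) X \<or> ord (co ((k \<otimes> g) <# X)) X"
      using translates_act_co[OF t(2) kc(1)] by simp
    then show ?thesis using complement_far_iff[of "k \<otimes> g"] m_closed[OF kc(1) gc(1)] by blast
  qed
  have kc: "k \<in> carrier G" using k stab_iff by blast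
  show ?thesis
  proof (intro equalityI subsetI)
    fix x assume "x \<in> k <# ?Y"
    then obtain g where "g \<in> ?Y" "x = k \<otimes> g" unfolding l_coset_def by blast
    then show "x \<in> ?Y" using move[OF k] by blast
  next
    fix x assume x: "x \<in> ?Y"
    then have "inv k \<otimes> x \<in> ?Y" by (rule move[OF subgroup.m_inv_closed[OF edges.stab_subgroup k]])
    then show "x \<in> k <# ?Y" using mem_l_coset[OF Yc kc, of x] x by blast
  qed
qed

text \<open>The set differs from the almost invariant \<open>X\<close> by an \<open>H\<close>-finite
  set, and right translation keeps that difference \<open>H\<close>-finite. Finiteness over
  \<open>H\<close> implies finiteness over the larger \<open>stab\<close>.\<close>

lemma almost_invariant_complement_far: "H_almost_invariant G edges.stab (carrier G - edges.far)"
proof (rule H_almost_invariantI[OF edges.stab_subgroup])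
  let ?Y = "carrier G - edges.far"
  fix g assume g: "g \<in> carrier G"
  have HG: "H \<subseteq> carrier G" by (rule subgroup.subset[OF H])
  have r_mem: "x \<in> A #> g \<longleftrightarrow> x \<otimes> inv g \<in> A" if "A \<subseteq> carrier G" "x \<in> carrier G" for A x
  proof
    assume "x \<in> A #> g"
    then obtain a where a: "a \<in> A" "x = a \<otimes> g" unfolding r_coset_def by blast
    then have "x \<otimes> inv g = a" using that(1) g by (simp add: subset_iff m_assoc)
    then show "x \<otimes> inv g \<in> A" using a by simp
  next
    assume a: "x \<otimes> inv g \<in> A"
    have "x = (x \<otimes> inv g) \<otimes> g" using that(2) g by (simp add: m_assoc)
    then show "x \<in> A #> g" using a unfolding r_coset_def by blast
  qed
  have ig: "inv g \<in> carrier G" using g by simp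
  have "sym_diff (?Y #> g) ?Y \<subseteq>
      (sym_diff X ?Y #> g) \<union> (\<Union>W\<in>base. {x \<in> W. x \<otimes> inv g \<notin> W}) \<union> sym_diff X ?Y"
  proof
    fix x assume x: "x \<in> sym_diff (?Y #> g) ?Y"
    have xc: "x \<in> carrier G" using x r_coset_subset_G[of ?Y g] g by blast
    have xg: "x \<otimes> inv g \<in> carrier G" using xc g by simp
    have "(x \<otimes> inv g \<in> ?Y) \<noteq> (x \<in> ?Y)" using x r_mem[of ?Y x] xc by blast
    then consider "(x \<in> X) \<noteq> (x \<in> ?Y)" | "(x \<otimes> inv g \<in> X) \<noteq> (x \<otimes> inv g \<in> ?Y)"
      | "(x \<in> X) \<noteq> (x \<otimes> inv g \<in> X)" by blast
    then show "x \<in> (sym_diff X ?Y #> g) \<union> (\<Union>W\<in>base. {x \<in> W. x \<otimes> inv g \<notin> W}) \<union> sym_diff X ?Y"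
    proof cases
      case 1
      then show ?thesis by blast
    next
      case 2
      then have "x \<otimes> inv g \<in> sym_diff X ?Y" by blast
      moreover have "sym_diff X ?Y \<subseteq> carrier G" using X_sub by blast
      ultimately have "x \<in> sym_diff X ?Y #> g" using r_mem[of "sym_diff X ?Y" x] xc by blast
      then show ?thesis by blast
    next
      case 3
      then have "\<exists>W\<in>base. x \<in> W \<and> x \<otimes> inv g \<notin> W" using xc xg by (auto simp: base_def)
      then show ?thesis by blast
    qed
  qed
  moreover have "fin ((sym_diff X ?Y #> g) \<union> (\<Union>W\<in>base. {x \<in> W. x \<otimes> inv g \<notin> W}) \<union> sym_diff X ?Y)"
    by (intro H_finite_Un H_finite_right fin_sym_diff HG g H_finite_UN base_finite base_shift ig)
  ultimately have "fin (sym_diff (?Y #> g) ?Y)" by (rule H_finite_subset[rotated])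
  then show "H_finite G edges.stab (sym_diff (?Y #> g) ?Y)"
    by (rule H_finite_mono[OF _ H_sub_stab])
qed (rule Diff_subset, rule stab_invariant)

lemma noncrossing_splitting:
  "\<exists>H' \<sigma>. splitting_over G H' \<sigma> \<and> commensurable G H H' \<and>
     (\<exists>Y. determined_set G \<sigma> Y \<and> ai_equivalent G H X H' Y)"
proof -
  let ?Y = "carrier G - edges.far"
  have X: "X \<in> base" "co X \<in> base" by (simp_all add: base_def)
  \<comment> \<open>Non-triviality of \<open>X\<close> enters here: neither side of the edge is
    \<open>H\<close>-finite, and this makes the factors of an amalgam proper.\<close>
  have "edges.far \<noteq> {}"
  proof
    assume "edges.far = {}"
    then have "co X \<subseteq> sym_diff X ?Y" by blast
    then have "fin (co X)" by (rule H_finite_subset[OF fin_sym_diff])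
    then show False using base_infinite[OF X(2)] by blast
  qed
  moreover have "\<not> ?Y \<subseteq> edges.stab"
  proof
    assume "?Y \<subseteq> edges.stab"
    then have "X \<subseteq> edges.stab \<union> sym_diff X ?Y" by blast
    then have "fin X" by (rule H_finite_subset[OF H_finite_Un[OF fin_stab fin_sym_diff]])
    then show False using base_infinite[OF X(1)] by blast
  qed
  ultimately obtain \<sigma> where \<sigma>: "splitting_over G edges.stab \<sigma>" "determined_set G \<sigma> ?Y"
    using edges.splitting_exists by blast
  moreover have "ai_equivalent G H X edges.stab ?Y"
    using ai almost_invariant_complement_far fin_sym_diff
    by (simp add: ai_equivalent_def H_almost_equal_def)
  ultimately show ?thesis using commensurable_stab by blast
qed

end

theorem theorem2p8:
  fixes G :: "('a, 'm) monoid_scheme" and S H X :: "'a set"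
  assumes "group G"
    and "finite_generating_set G S (carrier G)"
    and "subgroup H G"
    and "\<exists>T. finite_generating_set G T H"
    and "ends_of_pair G S H \<ge> 2"
    and "H_almost_invariant G H X"
    and "H_nontrivial G H X"
    and "self_intersection_number G H X = 0"
  shows "\<exists>H' \<sigma>. splitting_over G H' \<sigma> \<and> commensurable G H H' \<and>
           (\<exists>Y. determined_set G \<sigma> Y \<and> ai_equivalent G H X H' Y)"
proof -
  interpret group G by fact
  interpret H: subgroup H G by fact
  obtain T where "finite_generating_set G T H" using assms(4) by blast
  then interpret noncrossing_set G S T H X
    using assms by unfold_locales (simp_all add: finite_generating_set_def)
  show ?thesis by (rule noncrossing_splitting)
qed

end
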